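(* Let $N\ge 1$, $\mathcal I=\{1,\dots,N\}$, and let $\mathbf t_0\in(-1,1)^{4N}$ be such that $\mathcal A_{\mathbf t_0}=\{A^{(k)}_{\mathbf t_0}:k\in\mathcal I\}$ is an irreducible set of invertible $2\times2$ real matrices which strictly preserve a common cone and which are contracting with respect to some norm on $\mathbb R^2$. Suppose that $s_0=\dim\mathcal A_{\mathbf t_0}\in(0,1)\cup(1,2)$. Then there exist an open neighbourhood $U\subset(-1,1)^{4N}$ of $\mathbf t_0$ and an open neighbourhood $U'\subset\mathbb R$ of $s_0$ such that $(s,\mathbf t)\mapsto P(s,\mathbf t)$ is (real) analytic on $U'\times U$. Moreover, $\mathbf t\mapsto\dim\mathcal A_{\mathbf t}$ is (real) analytic on $U$.
   Context: For $\mathbf t=(t_1,\dots,t_{4N})$ and $k\in\mathcal I=\{1,\dots,N\}$ let $A^{(k)}_{\mathbf t}=\begin{pmatrix}t_{4k-3}&t_{4k-2}\\t_{4k-1}&t_{4k}\end{pmatrix}$ and $\mathcal A_{\mathbf t}=\{A^{(k)}_{\mathbf t}:k\in\mathcal I\}$. A cone is a convex subset $\mathcal C\subset\mathbb R^2\setminus\{0\}$, closed in $\mathbb R^2\setminus\{0\}$, with $\operatorname{int}(\mathcal C)\ne\emptyset$ and $\lambda x\in\mathcal C$ for all $x\in\mathcal C$, $\lambda>0$. A set of matrices $\mathcal A$ strictly preserves $\mathcal C$ if $A(\mathcal C\setminus\{0\})\subset\operatorname{int}(\mathcal C)$ for all $A\in\mathcal A$. $\mathcal A$ is irreducible if no one-dimensional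 subspace of $\mathbb R^2$ is preserved by all $A\in\mathcal A$. "Contracting with respect to some norm" means there is one norm on $\mathbb R^2$ whose induced operator norm of every $A\in\mathcal A$ is $<1$. For an invertible real $2\times 2$ matrix $A$ with singular values $\alpha_1(A)\ge\alpha_2(A)>0$, the singular value function is $\phi^s(A)=\alpha_1(A)^s$ for $0\le s<1$, $\phi^s(A)=\alpha_1(A)\alpha_2(A)^{s-1}$ for $1\le s\le2$, and $\phi^s(A)=|\det A|^{s/2}$ for $s\ge 2$. The sub-additive pressure is $$P(s,\mathbf t)=\lim_{n\to\infty}\Big(\sum_{(i_1,\dots,i_n)\in\mathcal I^n}\phi^s\big(A^{(i_1)}_{\mathbf t}\cdots A^{(i_n)}_{\mathbf t}\big)\Big)^{1/n}.$$ The affinity dimension $\dim\mathcal A_{\mathbf t}$ is the unique $s>0$ with $P(s,\mathbf t)=1$. *)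

theory Defs
  imports "HOL-Analysis.Analysis"
begin

text \<open>
  The finite type \<open>'n\<close> is the alphabet, so that \<open>CARD('n)\<close> is the number \<open>N \<ge> 1\<close> of matrices.
  A parameter is stored in blocks of four: \<open>t $ k $ j\<close> is the coordinate number \<open>4(k - 1) + j\<close>
  of the vector with \<open>4N\<close> entries, for \<open>j = 1, 2, 3, 4\<close>.
\<close>

type_synonym 'n param = "real ^ 4 ^ 'n"

definition param_mat :: "'n::finite param \<Rightarrow> 'n \<Rightarrow> real ^ 2 ^ 2" where
  "param_mat t k = vector [vector [t $ k $ 1, t $ k $ 2],
                           vector [t $ k $ 3, t $ k $ 4]]"

definition param_cube :: "('n::finite param) set" where
  "param_cube = {t. \<forall>k j. - 1 < t $ k $ j \<and> t $ k $ j < 1}"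


definition is_cone :: "(real ^ 2) set \<Rightarrow> bool" where
  "is_cone C \<longleftrightarrow> convex C \<and> C \<subseteq> - {0} \<and> closedin (top_of_set (- {0})) C \<and>
     interior C \<noteq> {} \<and> (\<forall>x\<in>C. \<forall>c>0. c *\<^sub>R x \<in> C)"

definition strictly_preserves :: "(real ^ 2 ^ 2) set \<Rightarrow> (real ^ 2) set \<Rightarrow> bool" where
  "strictly_preserves S C \<longleftrightarrow> (\<forall>A\<in>S. (\<lambda>x. A *v x) ` (C - {0}) \<subseteq> interior C)"

definition irreducible_mats :: "(real ^ 2 ^ 2) set \<Rightarrow> bool" where
  "irreducible_mats S \<longleftrightarrow>
     \<not> (\<exists>V. subspace V \<and> dim V = 1 \<and> (\<forall>A\<in>S. (\<lambda>x. A *v x) ` V \<subseteq> V))"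

definition is_norm :: "('a::real_vector \<Rightarrow> real) \<Rightarrow> bool" where
  "is_norm \<nu> \<longleftrightarrow> (\<forall>x. 0 \<le> \<nu> x) \<and> (\<forall>x. \<nu> x = 0 \<longleftrightarrow> x = 0) \<and>
     (\<forall>c x. \<nu> (c *\<^sub>R x) = \<bar>c\<bar> * \<nu> x) \<and> (\<forall>x y. \<nu> (x + y) \<le> \<nu> x + \<nu> y)"

text \<open>The analogue of \<^const>\<open>onorm\<close> for a norm other than the one of the type class.\<close>

definition induced_onorm :: "(real ^ 2 \<Rightarrow> real) \<Rightarrow> real ^ 2 ^ 2 \<Rightarrow> real" where
  "induced_onorm \<nu> A = (SUP x\<in>- {0}. \<nu> (A *v x) / \<nu> x)"

definition contracting :: "(real ^ 2 ^ 2) set \<Rightarrow> bool" where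
  "contracting S \<longleftrightarrow> (\<exists>\<nu>. is_norm \<nu> \<and> (\<forall>A\<in>S. induced_onorm \<nu> A < 1))"


text \<open>
  The singular values of \<open>A\<close> are the square roots of the eigenvalues of \<open>A\<^sup>T A\<close>; in
  dimension two the larger and the smaller one (equal in the case of a double eigenvalue) come from
  the maximum and the minimum of the set of eigenvalues.
\<close>

definition gram_eigenvalues :: "real ^ 2 ^ 2 \<Rightarrow> real set" where
  "gram_eigenvalues A = {l. \<exists>v. v \<noteq> 0 \<and> (transpose A ** A) *v v = l *\<^sub>R v}"

definition sing1 :: "real ^ 2 ^ 2 \<Rightarrow> real" where
  "sing1 A = sqrt (Max (gram_eigenvalues A))"

definition sing2 :: "real ^ 2 ^ 2 \<Rightarrow> real" where
  "sing2 A = sqrt (Min (gram_eigenvalues A))"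

text \<open>Only meaningful for invertible \<open>A\<close> and \<open>s \<ge> 0\<close>.\<close>

definition svf :: "real \<Rightarrow> real ^ 2 ^ 2 \<Rightarrow> real" where
  "svf s A = (if s < 1 then sing1 A powr s
              else if s \<le> 2 then sing1 A * sing2 A powr (s - 1)
              else \<bar>det A\<bar> powr (s / 2))"

definition word_mat :: "'n::finite param \<Rightarrow> 'n list \<Rightarrow> real ^ 2 ^ 2" where
  "word_mat t w = foldr (\<lambda>i M. param_mat t i ** M) w (mat 1)"

definition pressure_seq :: "real \<Rightarrow> 'n::finite param \<Rightarrow> nat \<Rightarrow> real" where
  "pressure_seq s t n = (\<Sum>w | length w = n. svf s (word_mat t w)) powr (1 / real n)"

definition pressure :: "real \<Rightarrow> 'n::finite param \<Rightarrow> real" where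
  "pressure s t = lim (pressure_seq s t)"

definition affinity_dim :: "'n::finite param \<Rightarrow> real" where
  "affinity_dim t = (THE s. 0 < s \<and> pressure s t = 1)"

text \<open>
  The description in \<^const>\<open>affinity_dim\<close> is proper only under the following condition; it
  fails for example for a single contracting matrix.
\<close>

definition has_affinity_dim :: "'n::finite param \<Rightarrow> bool" where
  "has_affinity_dim t \<longleftrightarrow> (\<exists>!s. 0 < s \<and> pressure s t = 1)"


text \<open>
  Real analyticity in several variables: near every point of the open set \<open>U\<close> the function is the
  sum of a power series. Multi-indices are functions on the basis, extended by zero;
  for real families \<^const>\<open>has_sum\<close> is absolute convergence.
\<close>

definition multi_indices :: "('a::euclidean_space \<Rightarrow> nat) set" where
  "multi_indices = {\<alpha>. \<forall>b. b \<notin> Basis \<longrightarrow> \<alpha> b = 0}"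

definition real_analytic_on :: "('a::euclidean_space \<Rightarrow> real) \<Rightarrow> 'a set \<Rightarrow> bool" where
  "real_analytic_on f U \<longleftrightarrow>
     (\<forall>x\<in>U. \<exists>c. \<exists>r>0. \<forall>h. norm h < r \<longrightarrow>
        ((\<lambda>\<alpha>. c \<alpha> * (\<Prod>b\<in>Basis. (h \<bullet> b) ^ \<alpha> b)) has_sum f (x + h)) multi_indices)"

end

theory Submission
  imports Defs "HOL-Complex_Analysis.Complex_Analysis" "HOL-Real_Asymp.Real_Asymp"
begin

text \<open>
  In the coordinates of a cone-adapted basis the matrices have positive entries, and the singular
  value function of a product is comparable to a power of the second coordinate of the image of a
  fixed vector times a power of the determinant. The pressure is therefore the growth rate of
  iterates of a transfer operator on functions of finite words. For parameters in a small complex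
  polydisc the weights of this operator are close to real positive ones, in a Lipschitz sense, so
  that it preserves a complexification of a cone of positive log-Lipschitz functions. Hence the
  ratios of consecutive iterates lie in a fixed compact subset of the right half-plane, the
  logarithms of the iterates divided by \<open>n\<close> are uniformly bounded and separately holomorphic, and
  by a normal family argument the logarithm of the pressure extends to a bounded separately
  holomorphic function, which has a power series. Since the matrices contract, the pressure strictly decreases in \<open>s\<close>,
  and the dimension is an analytic implicit function.
\<close>

subsection \<open>Bounded separately holomorphic functions\<close>

text \<open>Functions of words, rather than of directions in the projective line, are used because
  prepending a letter does not depend on the parameter: when the matrices become complex, the maps
  stay fixed and only the weights move. The price is that the natural distance between words comes
  from Moebius orbits, which do move, so the distance must combine the perturbed and the unperturbed
  orbit. Analyticity rests on bounds for the finite approximants on a complex neighbourhood that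
  serves every \<open>n\<close>. This dictates the order of choices throughout: all constants come
  from the real parameter, and only then is the polydisc made small. Two things stand in the way of
  a complex extension. Absolute values of determinants are not holomorphic, but near the real
  parameter they are the determinant times a constant sign. The singular value function has no
  uniform formula in \<open>s\<close>, but its two exponents are affine in \<open>s\<close> on each
  of the intervals between 0, 1 and 2. Joint continuity in the complex variables is never known in
  advance; a uniform bound replaces it everywhere.\<close>

lemma holomorphic_bounded_lipschitz:
  assumes "f holomorphic_on ball c R" "\<And>z. z \<in> ball c R \<Longrightarrow> norm (f z) \<le> M"
    and "0 < R" "z \<in> cball c (R/2)" "z' \<in> cball c (R/2)"
  shows "norm (f z - f z') \<le> 4 * M / R * norm (z - z')"
proof (rule field_differentiable_bound[OF convex_cball _ _ assms(4,5)])
  fix x assume x: "x \<in> cball c (R/2)"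
  \<comment> \<open>Room for Cauchy's estimate: \<open>R/2 + R/4 < R\<close>, and a circle of radius
    \<open>R/4\<close> turns the bound \<open>M\<close> into the derivative bound
    \<open>M / (R/4)\<close>.\<close>
  have sub: "cball x (R/4) \<subseteq> ball c R"
  proof
    fix y assume "y \<in> cball x (R/4)"
    then show "y \<in> ball c R" using x \<open>0 < R\<close> dist_triangle[of c y x] by auto
  qed
  have xb: "x \<in> ball c R" using sub \<open>0 < R\<close> by (simp add: subset_iff)
  show "(f has_field_derivative deriv f x) (at x within cball c (R/2))"
    using holomorphic_derivI[OF assms(1) open_ball xb] .
  have "norm ((deriv ^^ 1) f x) \<le> fact 1 * M / (R/4) ^ 1"
  proof (rule Cauchy_inequality)
    show "f holomorphic_on ball x (R/4)"
      using assms(1) sub ball_subset_cball holomorphic_on_subset by blast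
    show "continuous_on (cball x (R/4)) f"
      using assms(1) sub holomorphic_on_imp_continuous_on continuous_on_subset by blast
    fix y assume "norm (x - y) = R/4"
    then have "y \<in> cball x (R/4)" by (simp add: dist_norm)
    then show "norm (f y) \<le> M" using sub assms(2) by blast
  qed (use \<open>0 < R\<close> in auto)
  then show "norm (deriv f x) \<le> 4 * M / R" by (simp add: mult.commute)
qed

text \<open>A uniform bound makes the functions equi-Lipschitz on smaller discs, so that pointwise
  convergence is already locally uniform and Weierstrass' theorem applies. The filter is arbitrary
  because the complexified pressure is a limit along a filter finer than that of the sequence, not
  along a subsequence.\<close>

lemma holomorphic_on_pointwise_limit:
  assumes F: "F \<noteq> bot"
    and hol: "\<And>n. f n holomorphic_on S" and S: "open S"
    and bd: "\<And>n z. z \<in> S \<Longrightarrow> norm (f n z) \<le> M"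
    and lim: "\<And>z. z \<in> S \<Longrightarrow> ((\<lambda>n. f n z) \<longlongrightarrow> g z) F"
  shows "g holomorphic_on S"
proof -
  have "\<exists>f'. (g has_field_derivative f') (at z)" if z: "z \<in> S" for z
  proof -
    obtain R where R: "0 < R" "ball z R \<subseteq> S" using S z openE by blast
    define K where "K = cball z (R/2)"
    have KS: "K \<subseteq> S" using R unfolding K_def by (auto simp: subset_iff)
    define L where "L = 4 * M / R"
    have M0: "M \<ge> 0" using bd[OF z] norm_ge_zero order_trans by blast
    have L0: "L \<ge> 0" unfolding L_def using M0 R by simp
    have lf: "norm (f n x - f n y) \<le> L * norm (x - y)" if "x \<in> K" "y \<in> K" for n x y
      unfolding L_def using holomorphic_bounded_lipschitz[of "f n" z R M x y] hol R bd that
      unfolding K_def by (meson holomorphic_on_subset subset_iff)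
    have lg: "norm (g x - g y) \<le> L * norm (x - y)" if "x \<in> K" "y \<in> K" for x y
    proof (rule tendsto_upperbound[OF _ _ F])
      show "((\<lambda>n. norm (f n x - f n y)) \<longlongrightarrow> norm (g x - g y)) F"
        using lim that KS by (intro tendsto_intros) auto
    qed (use lf that in auto)
    have ul: "uniform_limit K f g F"
      unfolding uniform_limit_iff
    proof (intro allI impI)
      fix e :: real assume e: "0 < e"
      \<comment> \<open>Two Lipschitz errors \<open>L * d\<close> and one error \<open>d\<close> at
        a point of a finite \<open>d\<close>-net then add up to less than \<open>e\<close>.\<close>
      define d where "d = e / (2 * L + 2)"
      have d: "d > 0" unfolding d_def using e L0 by (simp add: add_nonneg_pos)
      have de: "(2 * L + 2) * d = e" unfolding d_def using L0 by simp
      obtain k where k: "finite k" "k \<subseteq> K" "K \<subseteq> (\<Union>x\<in>k. ball x d)"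
        using compact_eq_totally_bounded[of K] d unfolding K_def by (metis compact_cball
            compactE_image compact_imp_seq_compact seq_compact_imp_totally_bounded)
      have "\<forall>\<^sub>F n in F. \<forall>x\<in>k. dist (f n x) (g x) < d"
        using k(1) by (rule eventually_ball_finite) (use lim k KS d in \<open>auto simp: tendsto_iff\<close>)
      then show "\<forall>\<^sub>F n in F. \<forall>x\<in>K. dist (f n x) (g x) < e"
      proof eventually_elim
        case (elim n)
        show ?case
        proof
          fix y assume y: "y \<in> K"
          then obtain x where x: "x \<in> k" "dist x y < d" using k by auto
          have xK: "x \<in> K" using x k by auto
          have "norm (f n y - f n x) \<le> L * d" 
            using lf[OF y xK, of n] x(2) L0 
            by (smt (verit) dist_norm dist_commute mult_left_mono)
          moreover have "norm (g x - g y) \<le> L * d" 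
            using lg[OF xK y] x(2) L0 by (smt (verit) dist_norm mult_left_mono)
          moreover have "norm (f n x - g x) < d" using elim x by (auto simp: dist_norm)
          moreover have "norm (f n y - g y) \<le> norm (f n y - f n x) + norm (f n x - g x) + norm (g x - g y)"
            using norm_triangle_ineq[of "f n y - f n x" "f n x - g x"] 
              norm_triangle_ineq[of "f n y - g x" "g x - g y"] by simp
          moreover have "L * d + d + L * d < e" using de d by (simp add: algebra_simps)
          ultimately show "dist (f n y) (g y) < e" by (simp add: dist_norm)
        qed
      qed
    qed
    have ev: "\<forall>\<^sub>F n in F. continuous_on (cball z (R/2)) (f n) \<and> f n holomorphic_on ball z (R/2)"
      using holomorphic_on_subset[OF hol KS] holomorphic_on_subset[OF _ ball_subset_cball[of z "R/2"]]
      unfolding K_def by (auto intro!: always_eventually holomorphic_on_imp_continuous_on)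
    have "g holomorphic_on ball z (R/2)"
      using holomorphic_uniform_limit[OF ev ul[unfolded K_def]] F by (metis trivial_limit_def)
    then show ?thesis using R by (auto simp: holomorphic_on_open)
  qed
  then show ?thesis using S by (simp add: holomorphic_on_open)
qed

section \<open>Taylor coefficients in one variable as functions of another\<close>

lemma powser_remainder:
  fixes a :: "nat \<Rightarrow> complex"
  assumes R: "0 < R" and M: "0 \<le> M" and a: "\<And>n. norm (a n) \<le> M / R ^ n"
    and h: "norm h \<le> R / 2"
  shows "summable (\<lambda>i. a (i + k) * h ^ i)" "norm (\<Sum>i. a (i + k) * h ^ i) \<le> 2 * M / R ^ k"
proof -
  have b: "norm (a (i + k) * h ^ i) \<le> M / R ^ k * (1/2) ^ i" for i
  proof -
    have "norm (a (i + k) * h ^ i) \<le> M / R ^ (i + k) * (R / 2) ^ i"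
      unfolding norm_mult norm_power using a h R M by (intro mult_mono power_mono) auto
    also have "\<dots> = M / R ^ k * (1/2) ^ i" using R by (simp add: power_add power_divide)
    finally show ?thesis .
  qed
  have g: "(\<lambda>i. M / R ^ k * (1/2) ^ i) sums (M / R ^ k * 2)"
    using geometric_sums[of "1/2::real"] by (intro sums_mult) simp
  have sn: "summable (\<lambda>i. norm (a (i + k) * h ^ i))"
    by (rule summable_comparison_test'[OF sums_summable[OF g]]) (use b in auto)
  then show "summable (\<lambda>i. a (i + k) * h ^ i)" by (rule summable_norm_cancel)
  have "norm (\<Sum>i. a (i + k) * h ^ i) \<le> (\<Sum>i. norm (a (i + k) * h ^ i))"
    by (rule summable_norm[OF sn])
  also have "\<dots> \<le> M / R ^ k * 2"
    using b sums_unique[OF g] sums_summable[OF g] sn by (metis (no_types, lifting) suminf_le)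
  finally show "norm (\<Sum>i. a (i + k) * h ^ i) \<le> 2 * M / R ^ k" by (simp add: mult.commute)
qed

definition taylor_coeff :: "(complex \<Rightarrow> complex) \<Rightarrow> nat \<Rightarrow> complex" where
  "taylor_coeff f k = (deriv ^^ k) f 0 / fact k"

lemma taylor_coeff_bound:
  assumes hol: "f holomorphic_on ball 0 R" and R: "0 < R"
    and bd: "\<And>z. z \<in> ball 0 R \<Longrightarrow> norm (f z) \<le> M"
  shows "norm (taylor_coeff f k) \<le> M / (R/2) ^ k"
proof -
  have "norm ((deriv ^^ k) f 0) \<le> fact k * M / (R/2) ^ k"
  proof (rule Cauchy_inequality)
    have sub: "cball 0 (R/2) \<subseteq> ball (0::complex) R" using R by auto
    then show "f holomorphic_on ball 0 (R/2)"
      using hol ball_subset_cball holomorphic_on_subset by blast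
    show "continuous_on (cball 0 (R/2)) f"
      using hol sub holomorphic_on_imp_continuous_on continuous_on_subset by blast
  qed (use R bd in auto)
  then have "norm ((deriv ^^ k) f 0) / fact k \<le> (fact k * M / (R/2) ^ k) / fact k"
    by (intro divide_right_mono) auto
  then show ?thesis unfolding taylor_coeff_def by (simp add: norm_divide)
qed

lemma taylor_coeff_sums:
  assumes "f holomorphic_on ball 0 R" "norm h < R"
  shows "(\<lambda>k. taylor_coeff f k * h ^ k) sums f h"
  using holomorphic_power_series[of f 0 R h] assms unfolding taylor_coeff_def by simp

text \<open>With separate holomorphy and a bound alone, Cauchy's integral over a circle does not
  immediately give holomorphy in \<open>w\<close>. Instead the coefficient is the limit of the
  remainder after \<open>k\<close> terms, divided by \<open>h ^ k\<close>, along a sequence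
  \<open>h\<close> tending to zero. By induction on \<open>k\<close> these quotients are holomorphic
  in \<open>w\<close>; they are uniformly bounded, and so their pointwise limit is holomorphic
  too.\<close>

lemma holomorphic_taylor_coeff:
  assumes R: "0 < R" and S: "open S"
    and hz: "\<And>w. w \<in> S \<Longrightarrow> (\<lambda>z. \<phi> z w) holomorphic_on ball 0 R"
    and hw: "\<And>z. z \<in> ball 0 R \<Longrightarrow> \<phi> z holomorphic_on S"
    and bd: "\<And>z w. z \<in> ball 0 R \<Longrightarrow> w \<in> S \<Longrightarrow> norm (\<phi> z w) \<le> M"
  shows "(\<lambda>w. taylor_coeff (\<lambda>z. \<phi> z w) k) holomorphic_on S"
proof (induction k rule: less_induct)
  case (less k)
  define c where "c w j = taylor_coeff (\<lambda>z. \<phi> z w) j" for w j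
  \<comment> \<open>Nonzero and at most \<open>R/4\<close>, half of the radius \<open>R/2\<close>
    that governs the decay of the coefficients; there the quotients are bounded independently of
    \<open>n\<close>.\<close>
  define h where "h n = (of_real (R / (4 * (real n + 1))) :: complex)" for n
  have h0: "h n \<noteq> 0" and hR: "norm (h n) \<le> (R/2)/2" "h n \<in> ball 0 R" for n
  proof -
    have "R / (4 * (real n + 1)) \<le> R / 4" using R by (intro divide_left_mono) auto
    moreover have "R / (4 * (real n + 1)) > 0" using R by simp
    moreover have "R / 4 < R" using R by simp
    ultimately have "R / (4 * (real n + 1)) < R" by linarith
    with \<open>R / (4 * (real n + 1)) \<le> R / 4\<close> \<open>R / (4 * (real n + 1)) > 0\<close>
    show "h n \<noteq> 0" "norm (h n) \<le> (R/2)/2" "h n \<in> ball 0 R"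
      using R unfolding h_def by (simp_all del: of_real_divide of_real_mult)
  qed
  have hlim: "filterlim h (at 0) sequentially"
  proof -
    have "(\<lambda>n. R / (4 * (real n + 1))) \<longlonglongrightarrow> 0" by real_asymp
    then have "h \<longlonglongrightarrow> of_real 0" unfolding h_def by (rule tendsto_of_real)
    then show ?thesis using h0 by (simp add: filterlim_at)
  qed
  have cb: "norm (c w j) \<le> M / (R/2) ^ j" if "w \<in> S" for w j
    unfolding c_def using taylor_coeff_bound hz[OF that] R bd that by blast
  have M0: "M \<ge> 0" if "w \<in> S" for w
    using order_trans[OF norm_ge_zero bd[of 0 w]] that R by auto
  define q where "q n w = (\<phi> (h n) w - (\<Sum>j<k. c w j * h n ^ j)) / h n ^ k" for n w
  have qeq: "q n w = (\<Sum>i. c w (i + k) * h n ^ i)" if w: "w \<in> S" for n w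
  proof -
    have s: "(\<lambda>j. c w j * h n ^ j) sums \<phi> (h n) w"
      unfolding c_def using taylor_coeff_sums[OF hz[OF w]] hR(2)[of n] by simp
    have "(\<lambda>i. c w (i + k) * h n ^ (i + k)) sums (\<phi> (h n) w - (\<Sum>j<k. c w j * h n ^ j))"
      using sums_iff_shift[of "\<lambda>j. c w j * h n ^ j" k] s by simp
    then have "(\<lambda>i. c w (i + k) * h n ^ (i + k) / h n ^ k) sums q n w"
      unfolding q_def by (rule sums_divide)
    then show ?thesis using h0 by (simp add: power_add sums_iff)
  qed
  have "(\<lambda>w. c w k) holomorphic_on S"
  proof (rule holomorphic_on_pointwise_limit[where f = q and F = sequentially and M = "2 * M / (R/2)^k"])
    fix n show "q n holomorphic_on S"
      unfolding q_def c_def using less hw[OF hR(2)] h0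
      by (intro holomorphic_intros) (auto simp: eta_contract_eq)
  next
    fix n w assume w: "w \<in> S"
    show "norm (q n w) \<le> 2 * M / (R/2) ^ k"
      unfolding qeq[OF w] using powser_remainder(2)[of "R/2" M "c w" "h n" k] R M0[OF w] cb[OF w] hR(1) by simp
  next
    fix w assume w: "w \<in> S"
    have "((\<lambda>x. \<Sum>i. c w (i + k) * x ^ i) \<longlongrightarrow> c w (0 + k)) (at 0)"
    proof (rule powser_limit_0[where a = "\<lambda>i. c w (i + k)"])
      show "R/4 > 0" using R by simp
      fix x :: complex assume "norm x < R/4"
      then show "(\<lambda>i. c w (i + k) * x ^ i) sums (\<Sum>i. c w (i + k) * x ^ i)"
        using powser_remainder(1)[of "R/2" M "c w" x k] R M0[OF w] cb[OF w] by (simp add: summable_sums)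
    qed
    then have "(\<lambda>n. \<Sum>i. c w (i + k) * h n ^ i) \<longlonglongrightarrow> c w (0 + k)"
      using hlim by (rule filterlim_compose)
    then show "(\<lambda>n. q n w) \<longlonglongrightarrow> c w k" using qeq[OF w] by simp
  qed (use S in auto)
  then show ?case unfolding c_def .
qed


section \<open>Power series in several variables\<close>

definition polydisc :: "'b set \<Rightarrow> real \<Rightarrow> ('b \<Rightarrow> complex) set" where
  "polydisc B R = {\<zeta>. (\<forall>b\<in>B. norm (\<zeta> b) < R) \<and> (\<forall>b. b \<notin> B \<longrightarrow> \<zeta> b = 0)}"

text \<open>The bound \<open>M\<close> takes the place of joint continuity, as in Osgood's lemma.
  Points are total functions that vanish off \<open>B\<close>, so that variables can be removed one
  at a time without a change of type.\<close>

definition sep_holomorphic :: "'b set \<Rightarrow> real \<Rightarrow> real \<Rightarrow> (('b \<Rightarrow> complex) \<Rightarrow> complex) \<Rightarrow> bool" where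
  "sep_holomorphic B R M F \<longleftrightarrow> (\<forall>\<zeta>\<in>polydisc B R. norm (F \<zeta>) \<le> M \<and>
     (\<forall>b\<in>B. (\<lambda>z. F (\<zeta>(b := z))) holomorphic_on ball 0 R))"

definition finsupp_on :: "'b set \<Rightarrow> ('b \<Rightarrow> nat) set" where
  "finsupp_on B = {\<alpha>. \<forall>b. b \<notin> B \<longrightarrow> \<alpha> b = 0}"

lemma has_sum_finsupp_insert:
  fixes f :: "('b \<Rightarrow> nat) \<Rightarrow> 'c::{comm_monoid_add,topological_space}"
  assumes "x \<notin> B"
  shows "((\<lambda>(k, \<alpha>). f (\<alpha>(x := k))) has_sum S) (UNIV \<times> finsupp_on B) \<longleftrightarrow> (f has_sum S) (finsupp_on (insert x B))"
  by (rule has_sum_reindex_bij_witness[where i = "\<lambda>\<alpha>. (\<alpha> x, \<alpha>(x := 0))" and j = "\<lambda>(k, \<alpha>). \<alpha>(x := k)"])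
    (use assms in \<open>auto simp: finsupp_on_def fun_eq_iff\<close>)

lemma prod_pow_insert:
  assumes "finite B" "x \<notin> B"
  shows "(\<Prod>b\<in>insert x B. (\<zeta> b :: 'c::comm_semiring_1) ^ (\<alpha>(x := k)) b) = \<zeta> x ^ k * (\<Prod>b\<in>B. \<zeta> b ^ \<alpha> b)"
proof -
  have "(\<Prod>b\<in>B. \<zeta> b ^ (\<alpha>(x := k)) b) = (\<Prod>b\<in>B. \<zeta> b ^ \<alpha> b)"
    using assms by (intro prod.cong) auto
  then show ?thesis using assms by simp
qed

lemma summable_half_powers:
  assumes "finite B"
  shows "(\<lambda>\<alpha>. \<Prod>b\<in>B. (1/2::real) ^ \<alpha> b) summable_on finsupp_on B"
  using assms
proof (induction B)
  case empty
  have "finsupp_on {} = {\<lambda>_::'a. 0}" by (auto simp: finsupp_on_def)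
  then show ?case by simp
next
  case (insert x B)
  obtain S where S: "((\<lambda>\<alpha>. \<Prod>b\<in>B. (1/2::real) ^ \<alpha> b) has_sum S) (finsupp_on B)"
    using insert.IH by (auto simp: summable_on_def)
  have "(\<lambda>(k, \<alpha>). (1/2) ^ k * (\<Prod>b\<in>B. (1/2::real) ^ \<alpha> b)) summable_on (UNIV \<times> finsupp_on B)"
  proof (rule summable_on_SigmaI)
    show "((\<lambda>y. case (k, y) of (k, \<alpha>) \<Rightarrow> (1/2) ^ k * (\<Prod>b\<in>B. (1/2::real) ^ \<alpha> b)) has_sum (1/2) ^ k * S) (finsupp_on B)" for k :: nat
      using has_sum_cmult_right[OF S, of "(1/2)^k"] by simp
    have "(\<lambda>k. (1/2::real) ^ k) summable_on UNIV"
      by (rule summable_nonneg_imp_summable_on) (auto intro: summable_geometric)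
    then show "(\<lambda>k. (1/2) ^ k * S) summable_on UNIV" by (rule summable_on_cmult_left)
  qed (auto intro!: mult_nonneg_nonneg prod_nonneg)
  then obtain T where "((\<lambda>(k, \<alpha>). (1/2) ^ k * (\<Prod>b\<in>B. (1/2::real) ^ \<alpha> b)) has_sum T) (UNIV \<times> finsupp_on B)"
    by (auto simp: summable_on_def)
  then have "((\<lambda>(k, \<alpha>). \<Prod>b\<in>insert x B. (1/2::real) ^ (\<alpha>(x := k)) b) has_sum T) (UNIV \<times> finsupp_on B)"
    using insert.hyps prod_pow_insert[of B x "\<lambda>_. 1/2::real"] by (simp cong: if_cong)
  then show ?case
    using has_sum_finsupp_insert[OF insert.hyps(2), of "\<lambda>\<alpha>. \<Prod>b\<in>insert x B. (1/2::real) ^ \<alpha> b" T]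
    by (auto simp: summable_on_def)
qed

text \<open>Induction on the variables: the Taylor coefficients in the new variable are separately
  holomorphic in the others, on a polydisc of the same radius and with bound
  \<open>M / (R/2) ^ k\<close>. Radius is given up only in the coefficient bounds
  (\<open>R/2\<close>) and in the evaluation (\<open>R/4\<close>), so the loss does not accumulate
  with the number of variables, and the terms are dominated by powers of 1/2.\<close>

theorem sep_holomorphic_power_series:
  assumes "finite B" "0 < R" "sep_holomorphic B R M F"
  shows "\<exists>c. (\<forall>\<alpha>. norm (c \<alpha>) \<le> M / (\<Prod>b\<in>B. (R/2) ^ \<alpha> b)) \<and> (\<forall>\<zeta>\<in>polydisc B (R/4).
           ((\<lambda>\<alpha>. c \<alpha> * (\<Prod>b\<in>B. \<zeta> b ^ \<alpha> b)) has_sum F \<zeta>) (finsupp_on B))"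
  using assms(1,3)
proof (induction B arbitrary: F M)
  case empty
  have 1: "finsupp_on {} = {\<lambda>_::'a. 0}" by (auto simp: finsupp_on_def)
  have 2: "polydisc {} r = {\<lambda>_::'a. 0}" for r by (auto simp: polydisc_def)
  show ?case using empty unfolding sep_holomorphic_def 2 1
    by (intro exI[of _ "\<lambda>_. F (\<lambda>_. 0)"]) (auto simp: has_sum_finite_iff)
next
  case (insert x B)
  define C where "C k \<zeta> = taylor_coeff (\<lambda>z. F (\<zeta>(x := z))) k" for k \<zeta>
  have F1: "norm (F \<zeta>) \<le> M" if "\<zeta> \<in> polydisc (insert x B) R" for \<zeta>
    using insert.prems that by (auto simp: sep_holomorphic_def)
  have F2: "(\<lambda>z. F (\<zeta>(b := z))) holomorphic_on ball 0 R" if "\<zeta> \<in> polydisc (insert x B) R" "b \<in> insert x B" for \<zeta> b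
    using insert.prems that by (auto simp: sep_holomorphic_def)
  have up: "\<zeta>(x := z) \<in> polydisc (insert x B) R" if "\<zeta> \<in> polydisc B R" "norm z < R" for \<zeta> z
    using that by (auto simp: polydisc_def)
  have inc: "\<zeta> \<in> polydisc (insert x B) R" if "\<zeta> \<in> polydisc B R" for \<zeta>
    using that \<open>0 < R\<close> insert.hyps by (auto simp: polydisc_def)
  have sep: "sep_holomorphic B R (M / (R/2) ^ k) (C k)" for k
    unfolding sep_holomorphic_def
  proof (intro ballI conjI)
    fix \<zeta> assume z: "\<zeta> \<in> polydisc B R"
    show "norm (C k \<zeta>) \<le> M / (R/2) ^ k"
      unfolding C_def using F1[OF up[OF z]] F2[OF inc[OF z]] \<open>0 < R\<close>
      by (intro taylor_coeff_bound) auto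
    fix b assume b: "b \<in> B"
    have bw: "\<zeta>(b := w) \<in> polydisc B R" if "norm w < R" for w
      using z b that by (auto simp: polydisc_def)
    show "(\<lambda>w. C k (\<zeta>(b := w))) holomorphic_on ball 0 R"
      unfolding C_def
    proof (rule holomorphic_taylor_coeff[where R = R and M = M])
      fix w :: complex assume "w \<in> ball 0 R"
      then show "(\<lambda>z. F (\<zeta>(b := w, x := z))) holomorphic_on ball 0 R"
        using F2[OF inc[OF bw], of w x] by simp
    next
      fix u :: complex assume "u \<in> ball 0 R"
      then have "(\<lambda>w. F ((\<zeta>(x := u))(b := w))) holomorphic_on ball 0 R"
        using F2[OF up[OF z], of u b] b by simp
      moreover have "(\<zeta>(x := u))(b := w) = \<zeta>(b := w, x := u)" for w
        using b insert.hyps by (auto simp: fun_upd_twist)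
      ultimately show "(\<lambda>w. F (\<zeta>(b := w, x := u))) holomorphic_on ball 0 R" by simp
    qed (use \<open>0 < R\<close> F1[OF up[OF bw]] in auto)
  qed
  have "\<forall>k. \<exists>c. (\<forall>\<alpha>. norm (c \<alpha>) \<le> M / (R/2) ^ k / (\<Prod>b\<in>B. (R/2) ^ \<alpha> b)) \<and> (\<forall>\<zeta>\<in>polydisc B (R/4).
           ((\<lambda>\<alpha>. c \<alpha> * (\<Prod>b\<in>B. \<zeta> b ^ \<alpha> b)) has_sum C k \<zeta>) (finsupp_on B))"
    using insert.IH[OF sep] by blast
  from choice[OF this] obtain cc where cc: "\<forall>k. (\<forall>\<alpha>. norm (cc k \<alpha>) \<le> M / (R/2) ^ k / (\<Prod>b\<in>B. (R/2) ^ \<alpha> b)) \<and> (\<forall>\<zeta>\<in>polydisc B (R/4).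
           ((\<lambda>\<alpha>. cc k \<alpha> * (\<Prod>b\<in>B. \<zeta> b ^ \<alpha> b)) has_sum C k \<zeta>) (finsupp_on B))" ..
  have cb: "norm (cc k \<alpha>) \<le> M / (R/2) ^ k / (\<Prod>b\<in>B. (R/2) ^ \<alpha> b)" for k \<alpha> using cc by blast
  have cs: "((\<lambda>\<alpha>. cc k \<alpha> * (\<Prod>b\<in>B. \<zeta> b ^ \<alpha> b)) has_sum C k \<zeta>) (finsupp_on B)" 
    if "\<zeta> \<in> polydisc B (R/4)" for k \<zeta> using cc that by blast
  define c where "c \<alpha> = cc (\<alpha> x) (\<alpha>(x := 0))" for \<alpha>
  have M0: "M \<ge> 0" using order_trans[OF norm_ge_zero F1[of "\<lambda>_. 0"]] \<open>0 < R\<close>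
    by (simp add: polydisc_def)
  show ?case
  proof (intro exI[of _ c] conjI allI ballI)
    fix \<alpha>
    have "(\<Prod>b\<in>B. (R/2) ^ (\<alpha>(x := 0)) b) = (\<Prod>b\<in>B. (R/2) ^ \<alpha> b)"
      using insert.hyps by (intro prod.cong) auto
    then show "norm (c \<alpha>) \<le> M / (\<Prod>b\<in>insert x B. (R/2) ^ \<alpha> b)"
      unfolding c_def using cb[of "\<alpha> x" "\<alpha>(x := 0)"] insert.hyps by simp
  next
    fix \<zeta> assume z: "\<zeta> \<in> polydisc (insert x B) (R/4)"
    define \<zeta>' where "\<zeta>' = \<zeta>(x := 0)"
    have z': "\<zeta>' \<in> polydisc B (R/4)" using z \<open>0 < R\<close> by (auto simp: polydisc_def \<zeta>'_def)
    have z'R: "\<zeta>' \<in> polydisc B R" using z' \<open>0 < R\<close> by (force simp: polydisc_def)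
    have zx: "norm (\<zeta> x) < R/4" using z by (auto simp: polydisc_def)
    define f where "f = (\<lambda>(k, \<alpha>). cc k \<alpha> * (\<zeta> x ^ k * (\<Prod>b\<in>B. \<zeta> b ^ \<alpha> b)))"
    have pe: "(\<Prod>b\<in>B. \<zeta>' b ^ \<alpha> b) = (\<Prod>b\<in>B. \<zeta> b ^ \<alpha> b)" for \<alpha>
      using insert.hyps unfolding \<zeta>'_def by (intro prod.cong) auto
    have "(f has_sum F \<zeta>) (UNIV \<times> finsupp_on B)"
    proof (rule has_sum_SigmaI)
      fix k :: nat
      show "((\<lambda>y. f (k, y)) has_sum C k \<zeta>' * \<zeta> x ^ k) (finsupp_on B)"
        using has_sum_cmult_left[OF cs[OF z', of k], of "\<zeta> x ^ k"] unfolding pe f_def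
        by (simp add: mult_ac)
    next
      have s: "(\<lambda>k. C k \<zeta>' * \<zeta> x ^ k) sums F \<zeta>"
      proof -
        have "(\<lambda>k. taylor_coeff (\<lambda>z. F (\<zeta>'(x := z))) k * \<zeta> x ^ k) sums F (\<zeta>'(x := \<zeta> x))"
          using F2[OF inc[OF z'R], of x] zx \<open>0 < R\<close> by (intro taylor_coeff_sums[where R = R]) auto
        then show ?thesis unfolding C_def \<zeta>'_def by simp
      qed
      have "norm (C k \<zeta>' * \<zeta> x ^ k) \<le> M * (1/2) ^ k" for k
      proof -
        have "norm (C k \<zeta>') \<le> M / (R/2) ^ k" using sep[of k] z'R by (auto simp: sep_holomorphic_def)
        moreover have "norm (\<zeta> x ^ k) \<le> (R/4) ^ k" using zx by (auto simp: norm_power intro!: power_mono)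
        ultimately have "norm (C k \<zeta>' * \<zeta> x ^ k) \<le> M / (R/2) ^ k * (R/4) ^ k"
          unfolding norm_mult using M0 \<open>0 < R\<close> by (intro mult_mono) auto
        also have "\<dots> = M * ((R/4) / (R/2)) ^ k" unfolding power_divide[of "R/4" "R/2"] by simp
        also have "(R/4) / (R/2) = 1/2" using \<open>0 < R\<close> by simp
        finally show ?thesis .
      qed
      then have "summable (\<lambda>k. norm (C k \<zeta>' * \<zeta> x ^ k))"
        by (intro summable_comparison_test'[OF summable_mult[OF summable_geometric, of "1/2::real" M]]) auto
      then show "((\<lambda>k. C k \<zeta>' * \<zeta> x ^ k) has_sum F \<zeta>) UNIV"
        using s by (rule norm_summable_imp_has_sum)
    next
      \<comment> \<open>Passing from the iterated sum to a sum over all multi-indices requires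
        absolute summability, obtained by comparison with products of powers of 1/2.\<close>
      have "(\<lambda>p. M * (case p of (k, \<alpha>) \<Rightarrow> \<Prod>b\<in>insert x B. (1/2::real) ^ (\<alpha>(x := k)) b)) summable_on (UNIV \<times> finsupp_on B)"
        using summable_half_powers[of "insert x B"] insert.hyps(1)
          has_sum_finsupp_insert[OF insert.hyps(2), of "\<lambda>\<alpha>. \<Prod>b\<in>insert x B. (1/2::real) ^ \<alpha> b"]
        by (intro summable_on_cmult_right) (auto simp: summable_on_def)
      then have "(\<lambda>p. norm (f p)) summable_on (UNIV \<times> finsupp_on B)"
      proof (rule summable_on_comparison_test)
        fix p :: "nat \<times> ('a \<Rightarrow> nat)" assume "p \<in> UNIV \<times> finsupp_on B"
        obtain k \<alpha> where p: "p = (k, \<alpha>)" by force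
        have q0: "(\<Prod>b\<in>B. (R/2) ^ \<alpha> b) > 0" using \<open>0 < R\<close> by (intro prod_pos) auto
        have "norm (f p) = norm (cc k \<alpha>) * (norm (\<zeta> x) ^ k * (\<Prod>b\<in>B. norm (\<zeta> b) ^ \<alpha> b))"
          unfolding f_def p by (simp add: norm_mult norm_power prod_norm[symmetric])
        also have "\<dots> \<le> (M / (R/2) ^ k / (\<Prod>b\<in>B. (R/2) ^ \<alpha> b)) * ((R/4) ^ k * (\<Prod>b\<in>B. (R/4) ^ \<alpha> b))"
          using cb[of k \<alpha>] zx z q0 M0 \<open>0 < R\<close> 
          by (intro mult_mono power_mono prod_mono) (auto simp: polydisc_def less_imp_le intro!: prod_nonneg power_mono mult_nonneg_nonneg)
        also have "\<dots> = M * (((R/4) ^ k / (R/2) ^ k) * ((\<Prod>b\<in>B. (R/4) ^ \<alpha> b) / (\<Prod>b\<in>B. (R/2) ^ \<alpha> b)))"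
          by simp
        also have "(\<Prod>b\<in>B. (R/4) ^ \<alpha> b) / (\<Prod>b\<in>B. (R/2) ^ \<alpha> b) = (\<Prod>b\<in>B. (1/2) ^ \<alpha> b)"
          unfolding prod_dividef[symmetric] power_divide[symmetric] using \<open>0 < R\<close> by simp
        also have "(R/4) ^ k / (R/2) ^ k = (1/2) ^ k"
          unfolding power_divide[symmetric] using \<open>0 < R\<close> by simp
        also have "(1/2) ^ k * (\<Prod>b\<in>B. (1/2::real) ^ \<alpha> b) = (\<Prod>b\<in>insert x B. (1/2::real) ^ (\<alpha>(x := k)) b)"
          using prod_pow_insert[OF insert.hyps, of "\<lambda>_. 1/2::real"] by simp
        finally show "norm (f p) \<le> M * (case p of (k, \<alpha>) \<Rightarrow> \<Prod>b\<in>insert x B. (1/2::real) ^ (\<alpha>(x := k)) b)"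
          unfolding p by simp
      qed auto
      then show "f summable_on UNIV \<times> finsupp_on B" by (rule abs_summable_summable)
    qed
    moreover have "f (k, \<alpha>) = c (\<alpha>(x := k)) * (\<Prod>b\<in>insert x B. \<zeta> b ^ (\<alpha>(x := k)) b)"
      if "\<alpha> \<in> finsupp_on B" for k \<alpha>
    proof -
      have "\<alpha>(x := k, x := 0) = \<alpha>" using that insert.hyps by (auto simp: finsupp_on_def)
      then show ?thesis unfolding f_def c_def prod_pow_insert[OF insert.hyps] by simp
    qed
    moreover define g where "g = (\<lambda>(k, \<alpha>). c (\<alpha>(x := k)) * (\<Prod>b\<in>insert x B. \<zeta> b ^ (\<alpha>(x := k)) b))"
    ultimately have S: "(f has_sum F \<zeta>) (UNIV \<times> finsupp_on B)" and
      fg: "p \<in> UNIV \<times> finsupp_on B \<Longrightarrow> f p = g p" for p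
      by (auto simp only: mem_Sigma_iff prod.case)
    have "(g has_sum F \<zeta>) (UNIV \<times> finsupp_on B)"
      by (rule iffD1[OF has_sum_cong[OF fg] S])
    then show "((\<lambda>\<alpha>. c \<alpha> * (\<Prod>b\<in>insert x B. \<zeta> b ^ \<alpha> b)) has_sum F \<zeta>) (finsupp_on (insert x B))"
      unfolding g_def
      by (rule iffD1[OF has_sum_finsupp_insert[OF insert.hyps(2), of "\<lambda>\<alpha>. c \<alpha> * (\<Prod>b\<in>insert x B. \<zeta> b ^ \<alpha> b)"]])
  qed
qed

lemma sep_holomorphic_shift:
  assumes "sep_holomorphic B R M F" "\<And>b. b \<in> B \<Longrightarrow> norm (v b) \<le> R/2" "\<And>b. b \<notin> B \<Longrightarrow> v b = 0"
  shows "sep_holomorphic B (R/2) M (\<lambda>\<zeta>. F (\<lambda>b. \<zeta> b + v b))"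
  unfolding sep_holomorphic_def
proof (intro ballI conjI)
  fix \<zeta> assume z: "\<zeta> \<in> polydisc B (R/2)"
  have w: "(\<lambda>b. \<zeta> b + v b) \<in> polydisc B R"
    unfolding polydisc_def
  proof (safe)
    fix b assume "b \<in> B"
    then show "norm (\<zeta> b + v b) < R" 
      using z assms(2)[of b] norm_triangle_ineq[of "\<zeta> b" "v b"] by (auto simp: polydisc_def)
  qed (use z assms(3) in \<open>auto simp: polydisc_def\<close>)
  then show "norm (F (\<lambda>b. \<zeta> b + v b)) \<le> M" using assms(1) by (auto simp: sep_holomorphic_def)
  fix b assume b: "b \<in> B"
  have "(\<lambda>z. F ((\<lambda>b. \<zeta> b + v b)(b := z))) holomorphic_on ball 0 R"
    using assms(1) w b by (auto simp: sep_holomorphic_def)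
  moreover have "(\<lambda>z. z + v b) ` ball 0 (R/2) \<subseteq> ball 0 R"
  proof safe
    fix z :: complex assume "z \<in> ball 0 (R/2)"
    then show "z + v b \<in> ball 0 R" using assms(2)[OF b] norm_triangle_ineq[of z "v b"] by auto
  qed
  ultimately have "((\<lambda>z. F ((\<lambda>b. \<zeta> b + v b)(b := z))) \<circ> (\<lambda>z. z + v b)) holomorphic_on ball 0 (R/2)"
    by (intro holomorphic_on_compose_gen[where t = "ball 0 R"] holomorphic_intros)
  moreover have "((\<lambda>z. F ((\<lambda>b. \<zeta> b + v b)(b := z))) \<circ> (\<lambda>z. z + v b)) = (\<lambda>z. F (\<lambda>b'. (\<zeta>(b := z)) b' + v b'))"
    by (auto simp: fun_eq_iff intro!: arg_cong[of _ _ F])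
  ultimately show "(\<lambda>z. F (\<lambda>b'. (\<zeta>(b := z)) b' + v b')) holomorphic_on ball 0 (R/2)" by simp
qed

definition complex_coords :: "'a::euclidean_space \<Rightarrow> 'a \<Rightarrow> complex" where
  "complex_coords h b = (if b \<in> Basis then of_real (h \<bullet> b) else 0)"

text \<open>Analyticity asks for an expansion at every point \<open>x\<close> near
  \<open>x0\<close>, so \<open>F\<close> is recentred at \<open>x\<close>, which costs half of the
  radius. Since the values on real arguments are real, the real parts of the complex coefficients
  have the same sum there.\<close>

theorem real_analytic_onI:
  fixes f :: "'a::euclidean_space \<Rightarrow> real"
  assumes R: "0 < R" and sep: "sep_holomorphic Basis R M F"
    and F: "\<And>h. norm h < R \<Longrightarrow> F (complex_coords h) = of_real (f (x0 + h))"
  shows "real_analytic_on f (ball x0 (R/2))"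
  unfolding real_analytic_on_def
proof
  fix x assume x: "x \<in> ball x0 (R/2)"
  define v where "v = complex_coords (x - x0)"
  have nx: "norm (x - x0) < R/2" using x by (simp add: dist_norm norm_minus_commute)
  have "sep_holomorphic Basis (R/2) M (\<lambda>\<zeta>. F (\<lambda>b. \<zeta> b + v b))"
  proof (rule sep_holomorphic_shift[OF sep])
    fix b :: 'a assume "b \<in> Basis"
    then show "norm (v b) \<le> R/2" using Basis_le_norm[of b "x - x0"] nx by (simp add: v_def complex_coords_def)
  qed (auto simp: v_def complex_coords_def)
  from sep_holomorphic_power_series[OF finite_Basis _ this] R
  obtain c where c: "\<And>\<zeta>. \<zeta> \<in> polydisc Basis (R/2/4) \<Longrightarrow>
           ((\<lambda>\<alpha>. c \<alpha> * (\<Prod>b\<in>Basis. \<zeta> b ^ \<alpha> b)) has_sum F (\<lambda>b. \<zeta> b + v b)) (finsupp_on Basis)"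
    by auto
  show "\<exists>c. \<exists>r>0. \<forall>h. norm h < r \<longrightarrow>
        ((\<lambda>\<alpha>. c \<alpha> * (\<Prod>b\<in>Basis. (h \<bullet> b) ^ \<alpha> b)) has_sum f (x + h)) multi_indices"
  proof (intro exI[of _ "\<lambda>\<alpha>. Re (c \<alpha>)"] exI[of _ "R/2/4"] conjI allI impI)
    fix h :: 'a assume h: "norm h < R/2/4"
    have "complex_coords h \<in> polydisc Basis (R/2/4)"
      using h le_less_trans[OF Basis_le_norm[of _ h], of _ "R/2/4"]
      by (auto simp: polydisc_def complex_coords_def)
    from c[OF this] have "((\<lambda>\<alpha>. Re (c \<alpha> * (\<Prod>b\<in>Basis. complex_coords h b ^ \<alpha> b))) has_sum Re (F (\<lambda>b. complex_coords h b + v b))) (finsupp_on Basis)"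
      by (rule has_sum_Re)
    moreover have "(\<lambda>b. complex_coords h b + v b) = complex_coords (h + (x - x0))"
      by (auto simp: v_def complex_coords_def inner_add_left)
    moreover have "norm (h + (x - x0)) < R" using norm_triangle_ineq[of h "x - x0"] h nx R by simp
    moreover have "Re (c \<alpha> * (\<Prod>b\<in>Basis. complex_coords h b ^ \<alpha> b)) = Re (c \<alpha>) * (\<Prod>b\<in>Basis. (h \<bullet> b) ^ \<alpha> b)" for \<alpha>
    proof -
      have "(\<Prod>b\<in>Basis. complex_coords h b ^ \<alpha> b) = of_real (\<Prod>b\<in>Basis. (h \<bullet> b) ^ \<alpha> b)"
        unfolding of_real_prod by (intro prod.cong) (auto simp: complex_coords_def)
      then show ?thesis by (simp only:) (simp del: of_real_prod)
    qed
    ultimately show "((\<lambda>\<alpha>. Re (c \<alpha>) * (\<Prod>b\<in>Basis. (h \<bullet> b) ^ \<alpha> b)) has_sum f (x + h)) multi_indices"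
      using F[of "h + (x - x0)"] by (simp add: multi_indices_def finsupp_on_def algebra_simps)
  qed (use R in auto)
qed


text \<open>Separate holomorphy does not obviously survive the substitution of a function of the
  second variable for the first. Expanding in the first variable, the partial sums are holomorphic;
  \<open>R/4\<close> against the coefficient radius \<open>R/2\<close> bounds them by
  \<open>2 * M\<close>, and they converge pointwise. This is what makes Newton iterates
  holomorphic.\<close>

lemma holomorphic_on_compose_sep:
  assumes R: "0 < R" and S: "open S"
    and hz: "\<And>w. w \<in> S \<Longrightarrow> (\<lambda>z. \<phi> z w) holomorphic_on ball 0 R"
    and hw: "\<And>z. z \<in> ball 0 R \<Longrightarrow> \<phi> z holomorphic_on S"
    and bd: "\<And>z w. z \<in> ball 0 R \<Longrightarrow> w \<in> S \<Longrightarrow> norm (\<phi> z w) \<le> M"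
    and \<sigma>: "\<sigma> holomorphic_on S" "\<And>w. w \<in> S \<Longrightarrow> norm (\<sigma> w) \<le> R/4"
  shows "(\<lambda>w. \<phi> (\<sigma> w) w) holomorphic_on S"
proof (rule holomorphic_on_pointwise_limit[where F = sequentially and M = "2 * M" and
      f = "\<lambda>n w. \<Sum>k<n. taylor_coeff (\<lambda>z. \<phi> z w) k * \<sigma> w ^ k"])
  fix n show "(\<lambda>w. \<Sum>k<n. taylor_coeff (\<lambda>z. \<phi> z w) k * \<sigma> w ^ k) holomorphic_on S"
    using holomorphic_taylor_coeff[OF R S hz hw bd] \<sigma> by (intro holomorphic_intros) auto
next
  fix w assume w: "w \<in> S"
  have sR: "norm (\<sigma> w) < R" using \<sigma>(2)[OF w] R by linarith
  show "(\<lambda>n. \<Sum>k<n. taylor_coeff (\<lambda>z. \<phi> z w) k * \<sigma> w ^ k) \<longlonglongrightarrow> \<phi> (\<sigma> w) w"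
    using taylor_coeff_sums[OF hz[OF w] sR] by (simp add: sums_def)
  fix n
  have M0: "M \<ge> 0" using order_trans[OF norm_ge_zero bd[of 0 w]] R w by auto
  have b: "norm (taylor_coeff (\<lambda>z. \<phi> z w) k * \<sigma> w ^ k) \<le> M * (1/2) ^ k" for k
  proof -
    have "norm (taylor_coeff (\<lambda>z. \<phi> z w) k * \<sigma> w ^ k) \<le> M / (R/2) ^ k * (R/4) ^ k"
      unfolding norm_mult norm_power using taylor_coeff_bound[OF hz[OF w] R bd[OF _ w]] \<sigma>(2)[OF w] M0 R
      by (intro mult_mono power_mono) auto
    also have "\<dots> = M * ((R/4) / (R/2)) ^ k" unfolding power_divide[of "R/4" "R/2"] by simp
    also have "(R/4) / (R/2) = 1/2" using R by simp
    finally show ?thesis .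
  qed
  have "norm (\<Sum>k<n. taylor_coeff (\<lambda>z. \<phi> z w) k * \<sigma> w ^ k) \<le> (\<Sum>k<n. M * (1/2) ^ k)"
    using b by (intro sum_norm_le) auto
  also have "\<dots> = M * (\<Sum>k<n. (1/2) ^ k)" by (simp add: sum_distrib_left)
  also have "\<dots> \<le> M * 2"
    using M0 by (intro mult_left_mono) (simp_all add: sum_gp_strict)
  finally show "norm (\<Sum>k<n. taylor_coeff (\<lambda>z. \<phi> z w) k * \<sigma> w ^ k) \<le> 2 * M"
    using M0 by simp
qed (use S in auto)

text \<open>Tychonoff's theorem for a product of discs over all arguments at once: the sequence has
  a cluster point \<open>g\<close>, and some filter finer than \<open>sequentially\<close> converges
  to it at every argument simultaneously. Wherever the sequence converges in the ordinary sense,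
  \<open>G \<le> sequentially\<close> preserves its limit.\<close>

lemma bounded_functions_filter_limit:
  fixes f :: "nat \<Rightarrow> 'a \<Rightarrow> complex"
  assumes "\<And>n x. norm (f n x) \<le> M"
  obtains G g where "G \<noteq> bot" "G \<le> sequentially" "\<And>x. ((\<lambda>n. f n x) \<longlongrightarrow> g x) G" "\<And>x. norm (g x) \<le> M"
proof -
  define K where "K = (PiE UNIV (\<lambda>_. cball 0 M) :: ('a \<Rightarrow> complex) set)"
  have "compactin (product_topology (\<lambda>_. euclidean) UNIV) K"
    unfolding K_def compactin_PiE by simp
  then have K: "compact K" by (simp add: euclidean_product_topology)
  define F where "F = filtermap f sequentially"
  have "F \<noteq> bot" unfolding F_def by (simp add: filtermap_bot_iff)
  moreover have "eventually (\<lambda>x. x \<in> K) F"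
    unfolding F_def eventually_filtermap K_def using assms by (simp add: PiE_iff)
  ultimately obtain g where g: "g \<in> K" "inf (nhds g) F \<noteq> bot"
    using K unfolding compact_filter by blast
  \<comment> \<open>The times at which the sequence is close to \<open>g\<close>; that
    \<open>g\<close> is a cluster point says exactly that this filter is proper.\<close>
  define G where "G = inf (filtercomap f (nhds g)) sequentially"
  have "G \<noteq> bot"
  proof
    assume "G = bot"
    then have "eventually (\<lambda>_. False) G" by simp
    then obtain P Q where PQ: "eventually P (filtercomap f (nhds g))" "eventually Q sequentially"
      "\<And>n. P n \<Longrightarrow> Q n \<Longrightarrow> False" unfolding G_def eventually_inf by blast
    obtain P' where P': "eventually P' (nhds g)" "\<And>n. P' (f n) \<Longrightarrow> P n"
      using PQ(1) unfolding eventually_filtercomap by blast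
    have "eventually (\<lambda>h. \<not> P' h) F"
      unfolding F_def eventually_filtermap by (rule eventually_mono[OF PQ(2)]) (use PQ(3) P' in blast)
    then have "eventually (\<lambda>_. False) (inf (nhds g) F)"
      unfolding eventually_inf using P'(1) by blast
    then show False using g(2) by (simp add: eventually_False)
  qed
  moreover have "G \<le> sequentially" by (simp add: G_def)
  moreover have lim: "((\<lambda>n. f n x) \<longlongrightarrow> g x) G" for x
  proof -
    have f1: "filterlim f (nhds g) G"
      unfolding G_def by (metis filterlim_filtercomap filterlim_inf filterlim_mono inf.cobounded1 order_refl)
    have f2: "((\<lambda>h. h x) \<longlongrightarrow> g x) (nhds g)"
    proof -
      have c: "continuous_on UNIV (\<lambda>h::'a \<Rightarrow> complex. h x)"
        by (rule continuous_on_product_coordinates)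
      have o: "open ((\<lambda>h::'a \<Rightarrow> complex. h x) -` S)" if "open S" for S
        using that c by (rule open_vimage)
      show ?thesis unfolding tendsto_def eventually_nhds
      proof (intro allI impI)
        fix S :: "complex set" assume "open S" "g x \<in> S"
        then show "\<exists>T. open T \<and> g \<in> T \<and> (\<forall>h\<in>T. h x \<in> S)"
          by (intro exI[of _ "(\<lambda>h::'a \<Rightarrow> complex. h x) -` S"]) (simp add: o)
      qed
    qed
    show ?thesis by (rule filterlim_compose[OF f2 f1])
  qed
  moreover have "norm (g x) \<le> M" for x using g(1) unfolding K_def by (auto simp: PiE_iff)
  ultimately show ?thesis using that by blast
qed

subsection \<open>Perturbations of positive transfer operators\<close>

text \<open>Pairwise angles bounded away from a right angle make a set of complex numbers fit into a closed quadrant.\<close>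

lemma quadrant_rotation:
  assumes \<nu>: "0 < \<nu>" and S: "\<And>e e'. e \<in> S \<Longrightarrow> e' \<in> S \<Longrightarrow> \<nu> * (norm e * norm e') \<le> Re (e * cnj e')"
    and e0: "e0 \<in> S" "e0 \<noteq> 0"
  obtains c where "c \<noteq> 0" "\<And>e. e \<in> S \<Longrightarrow> 0 \<le> Re (e / c)" "\<And>e. e \<in> S \<Longrightarrow> 0 \<le> Im (e / c)"
proof -
  \<comment> \<open>\<open>q e\<close> is \<open>e\<close> turned so that \<open>e0\<close> becomes
    positive, and \<open>sl e\<close> is the tangent of its angle. The infimum \<open>\<mu>\<close>
    of the slopes is the lowest ray; division by \<open>c\<close> turns it to the positive real
    axis, and no element of \<open>S\<close> is more than a right angle above it.\<close>
  define q where "q e = e * cnj e0" for e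
  define sl where "sl e = Im (q e) / Re (q e)" for e
  define T where "T = sl ` (S - {0})"
  have Rq: "0 < Re (q e)" if "e \<in> S" "e \<noteq> 0" for e
  proof -
    have "0 < \<nu> * (norm e * norm e0)" using \<nu> that e0 by simp
    then show ?thesis using S[OF that(1) e0(1)] unfolding q_def by linarith
  qed
  have lb: "- 1 / \<nu> \<le> sl e" if "e \<in> S" "e \<noteq> 0" for e
  proof -
    have "\<bar>Im (q e)\<bar> \<le> norm (q e)" by (rule abs_Im_le_cmod)
    also have "\<dots> = norm e * norm e0" by (simp add: q_def norm_mult)
    also have "\<dots> \<le> Re (q e) / \<nu>" using S[OF that(1) e0(1)] \<nu> unfolding q_def
      by (simp add: field_simps)
    finally show ?thesis using Rq[OF that] \<nu> unfolding sl_def by (simp add: field_simps abs_le_iff)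
  qed
  have Tb: "bdd_below T" unfolding T_def using lb by (intro bdd_belowI2[of _ "-1/\<nu>"]) auto
  have Tn: "T \<noteq> {}" using e0 by (auto simp: T_def)
  define \<mu> where "\<mu> = Inf T"
  define c where "c = e0 * Complex 1 \<mu>"
  have "Complex 1 \<mu> \<noteq> 0" "Complex 1 (-\<mu>) \<noteq> 0" by (simp_all add: complex_eq_iff)
  note ne = this
  have c0: "c \<noteq> 0" using e0 ne by (simp add: c_def)
  have ec: "e / c = q e * Complex 1 (- \<mu>) / of_real ((norm e0)\<^sup>2 * (1 + \<mu>\<^sup>2))" for e
  proof -
    have "Complex 1 \<mu> * Complex 1 (-\<mu>) = of_real (1 + \<mu>\<^sup>2)"
      by (simp add: complex_eq_iff power2_eq_square)
    moreover have "e0 * cnj e0 = of_real ((norm e0)\<^sup>2)" by (simp add: complex_norm_square[symmetric])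
    ultimately have "c * (cnj e0 * Complex 1 (-\<mu>)) = of_real ((norm e0)\<^sup>2 * (1 + \<mu>\<^sup>2))"
      unfolding c_def of_real_mult by (metis mult.assoc mult.left_commute)
    moreover have "cnj e0 * Complex 1 (-\<mu>) \<noteq> 0" using e0 ne by simp
    ultimately show ?thesis unfolding q_def using c0
      by (metis (no_types, lifting) mult.assoc mult_divide_mult_cancel_right)
  qed
  have D: "0 < (norm e0)\<^sup>2 * (1 + \<mu>\<^sup>2)" using e0 by (simp add: add_pos_nonneg)
  have signs: "0 \<le> Re (q e) + \<mu> * Im (q e) \<and> 0 \<le> Im (q e) - \<mu> * Re (q e)" if e: "e \<in> S" for e
  proof (cases "e = 0")
    case False
    have r: "0 < Re (q e)" using Rq[OF e False] .
    have m: "\<mu> \<le> sl e" unfolding \<mu>_def using Tb e False by (intro cInf_lower) (auto simp: T_def)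
    \<comment> \<open>The hypothesis for the pair \<open>e\<close>, \<open>e'\<close>, divided by
      \<open>Re (q e')\<close>: it involves \<open>e'\<close> through its slope only, so that the
      infimum over \<open>e'\<close> can be taken.\<close>
    have pw: "0 \<le> Re (q e) + sl e' * Im (q e)" if "e' \<in> S" "e' \<noteq> 0" for e'
    proof -
      have "q e * cnj (q e') = e * cnj e' * of_real ((norm e0)\<^sup>2)"
        unfolding q_def complex_norm_square by (simp add: mult_ac)
      then have "Re (q e * cnj (q e')) = Re (e * cnj e' * of_real ((norm e0)\<^sup>2))" by (rule arg_cong)
      also have "\<dots> = Re (e * cnj e') * (norm e0)\<^sup>2"
        by (simp del: of_real_power complex_cnj_mult)
      finally have "Re (q e * cnj (q e')) = Re (e * cnj e') * (norm e0)\<^sup>2" .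
      moreover have "0 \<le> Re (e * cnj e')" 
        using S[OF e that(1)] \<nu> by (smt (verit) mult_nonneg_nonneg norm_ge_zero)
      ultimately have "0 \<le> Re (q e) * Re (q e') + Im (q e) * Im (q e')" by simp
      then have "0 \<le> (Re (q e) * Re (q e') + Im (q e) * Im (q e')) / Re (q e')"
        using Rq[OF that] by (intro divide_nonneg_pos) auto
      then show ?thesis unfolding sl_def using Rq[OF that] by (simp add: add_divide_distrib mult.commute)
    qed
    have "0 \<le> Re (q e) + \<mu> * Im (q e)"
    proof (cases "Im (q e) > 0")
      case True
      have "- Re (q e) / Im (q e) \<le> \<mu>" unfolding \<mu>_def
      proof (rule cInf_greatest[OF Tn])
        fix x assume "x \<in> T"
        then obtain e' where "e' \<in> S" "e' \<noteq> 0" "x = sl e'" by (auto simp: T_def)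
        then show "- Re (q e) / Im (q e) \<le> x" using pw[of e'] True by (simp add: field_simps)
      qed
      then show ?thesis using True by (simp add: field_simps)
    next
      case F: False
      show ?thesis
      proof (cases "Im (q e) = 0")
        case False
        with F have i: "Im (q e) < 0" by simp
        then have "sl e < 0" unfolding sl_def using r by (simp add: divide_less_0_iff)
        then have "\<mu> < 0" using m by simp
        then show ?thesis using i r by (smt (verit) mult_neg_neg)
      qed (use r in simp)
    qed
    moreover have "0 \<le> Im (q e) - \<mu> * Re (q e)" using m r unfolding sl_def by (simp add: field_simps)
    ultimately show ?thesis by simp
  qed (simp add: q_def)
  show ?thesis
  proof (rule that[OF c0])
    fix e assume "e \<in> S"
    note s = signs[OF this]
    show "0 \<le> Re (e / c)" unfolding ec Re_divide_of_real using s D by (intro divide_nonneg_pos) (auto simp: algebra_simps)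
    show "0 \<le> Im (e / c)" unfolding ec Im_divide_of_real using s D by (intro divide_nonneg_pos) (auto simp: algebra_simps)
  qed
qed

section \<open>Real cones of functions and their complexification\<close>

lemma exp_diff_le:
  fixes x y :: real assumes "0 \<le> y" "y \<le> x" shows "x - y \<le> exp x - exp y"
proof -
  have "exp x - exp y = exp y * (exp (x - y) - 1)" by (simp add: exp_diff algebra_simps)
  moreover have "x - y \<le> exp (x - y) - 1" using exp_ge_add_one_self[of "x - y"] by linarith
  moreover have "1 * (exp (x - y) - 1) \<le> exp y * (exp (x - y) - 1)" using assms by (intro mult_right_mono) auto
  ultimately show ?thesis by simp
qed

lemma exp_minus_one_le:
  fixes x :: real assumes "0 \<le> x" shows "exp x - 1 \<le> x * exp x"
proof -
  have "1 - x \<le> exp (-x)" using exp_ge_add_one_self[of "-x"] by simp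
  then have "(1 - x) * exp x \<le> exp (-x) * exp x" by (intro mult_right_mono) auto
  then show ?thesis by (simp add: algebra_simps exp_minus)
qed

text \<open>A Birkhoff cone: functions whose logarithm has Lipschitz constant \<open>K\<close>. The
  multiplicative form admits the zero function, which is the imaginary part at the start of the
  iteration.\<close>

definition log_lipschitz_cone :: "real \<Rightarrow> ('x \<Rightarrow> 'x \<Rightarrow> real) \<Rightarrow> ('x \<Rightarrow> real) set" where
  "log_lipschitz_cone K d = {a. (\<forall>x. 0 \<le> a x) \<and> (\<forall>x y. a x \<le> exp (K * d x y) * a y)}"

text \<open>The Ruelle operator with inverse branches \<open>\<tau> k\<close>; it is defined over a
  semiring so that the real operator and its complex perturbation share it.\<close>

definition transfer :: "('k::finite \<Rightarrow> 'x \<Rightarrow> 'x) \<Rightarrow> ('k \<Rightarrow> 'x \<Rightarrow> 'b::comm_semiring_1) \<Rightarrow> ('x \<Rightarrow> 'b) \<Rightarrow> 'x \<Rightarrow> 'b" where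
  "transfer \<tau> G f x = (\<Sum>k\<in>UNIV. G k x * f (\<tau> k x))"

text \<open>Besides symmetry, no axiom of a metric is needed of \<open>d\<close>, not even the triangle inequality.\<close>

locale perturbed_transfer =
  fixes \<tau> :: "'k::finite \<Rightarrow> 'x \<Rightarrow> 'x" and d :: "'x \<Rightarrow> 'x \<Rightarrow> real"
    and g :: "'k \<Rightarrow> 'x \<Rightarrow> real" and H :: "'k \<Rightarrow> 'x \<Rightarrow> complex"
    and \<theta> \<kappa> \<epsilon> :: real
  assumes d0: "0 \<le> d x y" and d1: "d x y \<le> 1" and dsym: "d x y = d y x"
    and \<theta>: "0 \<le> \<theta>" "\<theta> < 1" and d\<tau>: "d (\<tau> k x) (\<tau> k y) \<le> \<theta> * d x y"
    and g0: "0 < g k x" and \<kappa>: "0 \<le> \<kappa>" and gl: "g k x \<le> exp (\<kappa> * d x y) * g k y"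
    and \<epsilon>: "0 \<le> \<epsilon>" and H: "norm (H k x) \<le> \<epsilon>" "norm (H k x - H k y) \<le> \<epsilon> * d x y"
begin

text \<open>The solution of \<open>\<kappa> + \<theta> * K = K - 1\<close>: on the cone the real
  operator improves the Lipschitz constant of the logarithm by one. This gap leaves room for a
  perturbation.\<close>

definition K where "K = (\<kappa> + 1) / (1 - \<theta>)"
definition G where "G k x = of_real (g k x) * (1 + H k x)"

lemma K1: "1 \<le> K" using \<theta> \<kappa> unfolding K_def by (simp add: field_simps)

lemma K_eq: "\<kappa> + \<theta> * K = K - 1" using \<theta> unfolding K_def by (simp add: field_simps)

abbreviation "lcone \<equiv> log_lipschitz_cone K d"
abbreviation "L \<equiv> transfer \<tau> g"
abbreviation "M \<equiv> transfer \<tau> G"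

lemma cone_nonneg: "a \<in> lcone \<Longrightarrow> 0 \<le> a x" by (simp add: log_lipschitz_cone_def)

lemma cone_le: "a \<in> lcone \<Longrightarrow> a x \<le> exp K * a y"
proof -
  assume a: "a \<in> lcone"
  have "a x \<le> exp (K * d x y) * a y" using a by (simp add: log_lipschitz_cone_def)
  also have "\<dots> \<le> exp K * a y" using K1 d1[of x y] cone_nonneg[OF a, of y]
    by (intro mult_right_mono) (auto simp: mult_left_le)
  finally show ?thesis .
qed

lemma term_le:
  assumes "a \<in> lcone"
  shows "g k x * a (\<tau> k x) \<le> exp ((K - 1) * d x y) * (g k y * a (\<tau> k y))"
proof -
  have "a (\<tau> k x) \<le> exp (K * d (\<tau> k x) (\<tau> k y)) * a (\<tau> k y)" using assms by (simp add: log_lipschitz_cone_def)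
  also have "\<dots> \<le> exp (\<theta> * K * d x y) * a (\<tau> k y)"
    using d\<tau>[of k x y] K1 cone_nonneg[OF assms] by (intro mult_right_mono) (auto simp: mult.assoc mult.left_commute)
  finally have "g k x * a (\<tau> k x) \<le> (exp (\<kappa> * d x y) * g k y) * (exp (\<theta> * K * d x y) * a (\<tau> k y))"
    using gl[of k x y] g0 cone_nonneg[OF assms] by (intro mult_mono) (auto simp: less_imp_le)
  also have "\<dots> = exp (\<kappa> * d x y + \<theta> * K * d x y) * (g k y * a (\<tau> k y))" by (simp add: exp_add)
  also have "\<kappa> * d x y + \<theta> * K * d x y = (K - 1) * d x y" using K_eq by (simp add: distrib_right[symmetric])
  finally show ?thesis .
qed

lemma L_nonneg: "a \<in> lcone \<Longrightarrow> 0 \<le> L a x"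
  unfolding transfer_def using g0 cone_nonneg by (intro sum_nonneg mult_nonneg_nonneg) (auto simp: less_imp_le)

lemma L_le: "a \<in> lcone \<Longrightarrow> L a x \<le> exp ((K - 1) * d x y) * L a y"
  unfolding transfer_def sum_distrib_left by (intro sum_mono term_le)

lemma L_le': assumes "a \<in> lcone" shows "L a x \<le> exp K * L a y"
proof -
  have "(K - 1) * d x y \<le> (K - 1) * 1" using K1 d1 by (intro mult_left_mono) auto
  then have "exp ((K - 1) * d x y) \<le> exp K" by simp
  then show ?thesis using L_le[OF assms, of x y] L_nonneg[OF assms, of y] mult_right_mono order_trans by blast
qed

definition E where "E a x = (\<Sum>k\<in>UNIV. of_real (g k x * a (\<tau> k x)) * H k x)"

lemma M_eq: "M (\<lambda>x. of_real (a x) + \<i> * of_real (b x)) x = 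
    (of_real (L a x) + E a x) + \<i> * (of_real (L b x) + E b x)"
  unfolding transfer_def G_def E_def by (simp add: sum.distrib algebra_simps sum_distrib_left)

lemma E_bound: assumes "a \<in> lcone" shows "norm (E a x) \<le> \<epsilon> * L a x"
proof -
  have "norm (E a x) \<le> (\<Sum>k\<in>UNIV. g k x * a (\<tau> k x) * \<epsilon>)"
    unfolding E_def using H(1) g0 cone_nonneg[OF assms]
    by (intro sum_norm_le) (auto simp: norm_mult abs_mult less_imp_le intro!: mult_left_mono mult_nonneg_nonneg)
  then show ?thesis unfolding transfer_def by (simp add: sum_distrib_left mult.commute)
qed

definition C1 where "C1 = (2 * K + 1) * exp K"

text \<open>The factor \<open>d x y\<close> on the right is the point: the functional
  \<open>exp (K * d x y) * f y - f x\<close> degenerates as \<open>x\<close> and \<open>y\<close>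
  come together, and on the real image it is only of order \<open>d x y\<close>. Two of the three
  error terms carry \<open>exp (K * d x y) - 1\<close>, at most \<open>K * exp K * d x y\<close>,
  and the third carries the Lipschitz bound of \<open>H\<close>; together they produce
  \<open>C1\<close>.\<close>

lemma E_functional:
  assumes "a \<in> lcone"
  shows "norm (of_real (exp (K * d x y)) * E a y - E a x) \<le> \<epsilon> * C1 * (d x y * L a y)"
proof -
  define e where "e = exp (K * d x y)"
  have e1: "e - 1 \<le> K * exp K * d x y"
  proof -
    have "e - 1 \<le> K * d x y * e" unfolding e_def using exp_minus_one_le[of "K * d x y"] K1 d0 by simp
    also have "\<dots> \<le> K * d x y * exp K" unfolding e_def using K1 d0[of x y] d1[of x y]
      by (intro mult_left_mono) (auto simp: mult_left_le)
    finally show ?thesis by (simp add: mult_ac)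
  qed
  have ek: "e \<le> exp K" unfolding e_def using K1 d1[of x y] by (auto simp: mult_left_le)
  have e0: "1 \<le> e" unfolding e_def using K1 d0 by simp
  have t: "norm (of_real e * (of_real (g k y * a (\<tau> k y)) * H k y) - of_real (g k x * a (\<tau> k x)) * H k x)
      \<le> \<epsilon> * C1 * (d x y * (g k y * a (\<tau> k y)))" for k
  proof -
    define p q where "p = g k y * a (\<tau> k y)" and "q = g k x * a (\<tau> k x)"
    have p0: "0 \<le> p" "0 \<le> q" using g0 cone_nonneg[OF assms] by (auto simp: p_def q_def less_imp_le)
    have qp: "q \<le> e * p"
    proof -
      have "exp ((K - 1) * d x y) \<le> e" unfolding e_def using K1 d0 by (simp add: mult_right_mono)
      then show ?thesis using term_le[OF assms, of k x y] p0 unfolding p_def q_def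
        by (meson mult_right_mono order_trans)
    qed
    have pq: "p \<le> e * q"
    proof -
      have "exp ((K - 1) * d y x) \<le> e" unfolding e_def dsym[of y x] using K1 d0 by (simp add: mult_right_mono)
      then show ?thesis using term_le[OF assms, of k y x] p0 unfolding p_def q_def
        by (meson mult_right_mono order_trans)
    qed
    have dpq: "\<bar>p - q\<bar> \<le> (e - 1) * p"
    proof -
      have "p - q \<le> (e - 1) * p"
      proof -
        have "p \<le> e * q" by (rule pq)
        \<comment> \<open>For \<open>e < 2\<close> the factor lost is
          \<open>e * (2 - e) = 1 - (e - 1)^2\<close>, which is at most 1.\<close>
        then have "p * (2 - e) \<le> q"
        proof (cases "e \<ge> 2")
          case True then show ?thesis using p0 by (smt (verit) mult_nonneg_nonpos)
        next
          case False
          have "p * (2 - e) \<le> (e * q) * (2 - e)" using pq False by (intro mult_right_mono) auto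
          also have "\<dots> = q * (1 - (e - 1)\<^sup>2)" by (simp add: power2_eq_square algebra_simps)
          also have "\<dots> \<le> q * 1" using p0 by (intro mult_left_mono) auto
          finally show ?thesis by simp
        qed
        then show ?thesis by (simp add: algebra_simps)
      qed
      moreover have "q - p \<le> (e - 1) * p" using qp by (simp add: algebra_simps)
      ultimately show ?thesis by linarith
    qed
    have "of_real e * (of_real p * H k y) - of_real q * H k x
        = of_real ((e - 1) * p) * H k y + of_real (p - q) * H k y + of_real q * (H k y - H k x)"
      by (simp add: algebra_simps)
    also have "norm \<dots> \<le> (e - 1) * p * \<epsilon> + (e - 1) * p * \<epsilon> + q * (\<epsilon> * d x y)"
    proof (intro order_trans[OF norm_triangle_ineq] add_mono)
      show "norm (of_real ((e - 1) * p) * H k y) \<le> (e - 1) * p * \<epsilon>"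
        using H(1) e0 p0 unfolding norm_mult norm_of_real by (intro mult_mono) auto
      show "norm (of_real (p - q) * H k y) \<le> (e - 1) * p * \<epsilon>"
        using H(1) e0 p0 dpq unfolding norm_mult norm_of_real by (intro mult_mono) auto
      show "norm (of_real q * (H k y - H k x)) \<le> q * (\<epsilon> * d x y)"
        using H(2)[of k x y] p0 unfolding norm_mult norm_of_real by (intro mult_mono) (auto simp: norm_minus_commute)
    qed
    also have "\<dots> \<le> (K * exp K * d x y) * p * \<epsilon> + (K * exp K * d x y) * p * \<epsilon> + (exp K * p) * (\<epsilon> * d x y)"
    proof (intro add_mono mult_right_mono e1 p0 \<epsilon>)
      show "q \<le> exp K * p" using qp mult_right_mono[OF ek p0(1)] by linarith
    qed (use \<epsilon> d0 in simp)
    also have "\<dots> = \<epsilon> * C1 * (d x y * p)" by (simp add: C1_def algebra_simps)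
    finally show ?thesis by (simp add: p_def q_def)
  qed
  have "of_real e * E a y - E a x = (\<Sum>k\<in>UNIV. of_real e * (of_real (g k y * a (\<tau> k y)) * H k y) - of_real (g k x * a (\<tau> k x)) * H k x)"
    unfolding E_def by (simp add: sum_distrib_left sum_subtractf)
  also have "norm \<dots> \<le> (\<Sum>k\<in>UNIV. \<epsilon> * C1 * (d x y * (g k y * a (\<tau> k y))))"
    by (intro sum_norm_le t)
  also have "\<dots> = \<epsilon> * C1 * (d x y * L a y)" by (simp add: transfer_def sum_distrib_left)
  finally show ?thesis unfolding e_def .
qed

text \<open>Ratio of the upper to the lower bounds in \<open>adapted\<close>. The value is dictated
  by the differences, whose upper bound \<open>2 * K * exp K * exp K\<close> has to be written as
  \<open>exp (-K) * \<rho>\<close>.\<close>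

definition \<rho> where "\<rho> = 2 * K * exp (3 * K)"

lemma \<rho>1: "1 \<le> \<rho>"
proof -
  have "1 \<le> exp (3 * K)" using K1 by simp
  then have "1 * 1 \<le> (2 * K) * exp (3 * K)" using K1 by (intro mult_mono) auto
  then show ?thesis by (simp add: \<rho>_def)
qed

text \<open>
  The numbers \<open>e\<close> are the values at the image of \<open>a + i b\<close> of the functionals that define the cone;
  \<open>X\<close> and \<open>Y\<close> are the values for the real operator, and their comparability with \<open>D A\<close> and \<open>D B\<close>
  says that the image of the cone has finite projective diameter.
\<close>

definition adapted :: "real \<Rightarrow> real \<Rightarrow> complex \<Rightarrow> bool" where
  "adapted A B e \<longleftrightarrow> (\<exists>D X Y. 0 \<le> D \<and> exp (-K) * D * A \<le> X \<and> X \<le> exp (-K) * \<rho> * D * A \<and>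
     exp (-K) * D * B \<le> Y \<and> Y \<le> exp (-K) * \<rho> * D * B \<and> norm (e - Complex X Y) \<le> \<epsilon> * C1 * (X + Y))"

text \<open>The vectors \<open>(X, Y)\<close> of all functionals are, up to a factor
  \<open>\<rho>\<close> in each coordinate, multiples of the single vector \<open>(A, B)\<close>.
  Hence the inner product of two of them is at least \<open>1 / (2 * \<rho>^2)\<close> times the
  product of their coordinate sums. The perturbation spoils at most half of the inner product and
  makes each norm at most twice the coordinate sum; this accounts for 12 and 16.\<close>

lemma adapted_pair:
  assumes small: "12 * (\<epsilon> * C1) * \<rho>\<^sup>2 \<le> 1" and A: "0 \<le> A" and B: "0 \<le> B" and e: "adapted A B e" "adapted A B e'"
  shows "1 / (16 * \<rho>\<^sup>2) * (norm e * norm e') \<le> Re (e * cnj e')"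
proof -
  define c where "c = exp (-K)"
  define \<eta> where "\<eta> = \<epsilon> * C1"
  have \<eta>0: "0 \<le> \<eta>" unfolding \<eta>_def C1_def using \<epsilon> K1 by simp
  have c: "0 < c" by (simp add: c_def)
  have r2: "1 \<le> \<rho>\<^sup>2" using \<rho>1 by simp
  have \<eta>: "12 * \<eta> * \<rho>\<^sup>2 \<le> 1" using small by (simp add: \<eta>_def)
  have \<eta>1: "\<eta> \<le> 1"
  proof -
    have "12 * \<eta> * 1 \<le> 12 * \<eta> * \<rho>\<^sup>2" using \<eta>0 r2 by (intro mult_left_mono) auto
    then show ?thesis using \<eta> \<eta>0 by linarith
  qed
  obtain D X Y where D: "0 \<le> D" "c * D * A \<le> X" "X \<le> c * \<rho> * D * A" "c * D * B \<le> Y" "Y \<le> c * \<rho> * D * B"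
      "norm (e - Complex X Y) \<le> \<eta> * (X + Y)"
    using e(1) unfolding adapted_def c_def \<eta>_def by blast
  obtain D' X' Y' where D': "0 \<le> D'" "c * D' * A \<le> X'" "X' \<le> c * \<rho> * D' * A" "c * D' * B \<le> Y'" "Y' \<le> c * \<rho> * D' * B"
      "norm (e' - Complex X' Y') \<le> \<eta> * (X' + Y')"
    using e(2) unfolding adapted_def c_def \<eta>_def by blast
  have nn: "0 \<le> c * D * A" "0 \<le> c * D' * A" "0 \<le> c * D * B" "0 \<le> c * D' * B"
    using c D(1) D'(1) A B by simp_all
  have pos: "0 \<le> X" "0 \<le> Y" "0 \<le> X'" "0 \<le> Y'" using nn D D' by linarith+
  define s s' z z' r r' where "s = X + Y" and "s' = X' + Y'" and "z = Complex X Y" and "z' = Complex X' Y'"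
    and "r = e - z" and "r' = e' - z'"
  have s: "0 \<le> s" "0 \<le> s'" using pos by (simp_all add: s_def s'_def)
  have zs: "norm z \<le> s" "norm z' \<le> s'"
    using cmod_le[of z] cmod_le[of z'] pos by (simp_all add: s_def s'_def z_def z'_def)
  have rs: "norm r \<le> \<eta> * s" "norm r' \<le> \<eta> * s'" using D D' by (simp_all add: r_def r'_def z_def z'_def s_def s'_def)
  have ez: "e = z + r" "e' = z' + r'" by (simp_all add: r_def r'_def)
  define W where "W = X * X' + Y * Y'"
  have ss: "s * s' \<le> 2 * \<rho>\<^sup>2 * W"
  proof -
    have "s \<le> c * \<rho> * D * (A + B)" "s' \<le> c * \<rho> * D' * (A + B)" using D D' by (simp_all add: s_def s'_def distrib_left)
    then have "s * s' \<le> (c * \<rho> * D * (A + B)) * (c * \<rho> * D' * (A + B))" using s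
      by (intro mult_mono) auto
    also have "\<dots> = \<rho>\<^sup>2 * (c * D) * (c * D') * (A + B)\<^sup>2" by (simp add: power2_eq_square)
    also have "\<dots> \<le> \<rho>\<^sup>2 * (c * D) * (c * D') * (2 * (A\<^sup>2 + B\<^sup>2))"
    proof (intro mult_left_mono)
      show "(A + B)\<^sup>2 \<le> 2 * (A\<^sup>2 + B\<^sup>2)" using sum_squares_bound[of A B] by (simp add: power2_sum)
    qed (use c D D' in simp)
    also have "\<dots> = 2 * \<rho>\<^sup>2 * ((c * D * A) * (c * D' * A) + (c * D * B) * (c * D' * B))"
      by (simp add: power2_eq_square algebra_simps)
    also have "\<dots> \<le> 2 * \<rho>\<^sup>2 * W" unfolding W_def using D D' nn pos
      by (intro mult_left_mono add_mono mult_mono) auto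
    finally show ?thesis .
  qed
  have W0: "0 \<le> W" using pos by (simp add: W_def)
  have "Re (e * cnj e') \<ge> W / 2"
  proof -
    define T where "T = z * cnj r' + r * cnj z' + r * cnj r'"
    have e1: "e * cnj e' = z * cnj z' + T"
      unfolding ez T_def by (simp add: algebra_simps)
    have e2: "Re (z * cnj z') = W" by (simp add: z_def z'_def W_def)
    have e3: "norm T \<le> s * (\<eta> * s') + (\<eta> * s) * s' + (\<eta> * s) * (\<eta> * s')"
      unfolding T_def using zs rs s \<eta>0 by (intro order_trans[OF norm_triangle_ineq] add_mono) (auto simp: norm_mult intro!: mult_mono)
    have e4: "s * (\<eta> * s') + (\<eta> * s) * s' + (\<eta> * s) * (\<eta> * s') \<le> 3 * \<eta> * (s * s')"
    proof -
      have "\<eta> * (\<eta> * (s * s')) \<le> 1 * (\<eta> * (s * s'))" using \<eta>1 \<eta>0 s by (intro mult_right_mono) auto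
      then show ?thesis by (simp add: algebra_simps)
    qed
    have e5: "3 * \<eta> * (s * s') \<le> W / 2"
    proof -
      have "3 * \<eta> * (s * s') \<le> 3 * \<eta> * (2 * \<rho>\<^sup>2 * W)" using ss \<eta>0 by (intro mult_left_mono) auto
      also have "\<dots> = (12 * \<eta> * \<rho>\<^sup>2) * (W / 2)" by simp
      also have "\<dots> \<le> 1 * (W / 2)" using \<eta> W0 by (intro mult_right_mono) auto
      finally show ?thesis by simp
    qed
    have "\<bar>Re T\<bar> \<le> norm T" by (rule abs_Re_le_cmod)
    then have "- (W / 2) \<le> Re T" using e3 e4 e5 by linarith
    moreover have "Re (e * cnj e') = W + Re T" unfolding e1 plus_complex.sel e2 ..
    ultimately show ?thesis by linarith
  qed
  moreover have "1 / (16 * \<rho>\<^sup>2) * (norm e * norm e') \<le> W / 2"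
  proof -
    have "norm e \<le> 2 * s"
    proof -
      have "norm e \<le> s + \<eta> * s" unfolding ez using norm_triangle_ineq[of z r] zs(1) rs(1) by linarith
      also have "\<dots> \<le> s + 1 * s" using \<eta>1 s by (intro add_left_mono mult_right_mono) auto
      finally show ?thesis by simp
    qed
    moreover have "norm e' \<le> 2 * s'"
    proof -
      have "norm e' \<le> s' + \<eta> * s'" unfolding ez using norm_triangle_ineq[of z' r'] zs(2) rs(2) by linarith
      also have "\<dots> \<le> s' + 1 * s'" using \<eta>1 s by (intro add_left_mono mult_right_mono) auto
      finally show ?thesis by simp
    qed
    ultimately have "norm e * norm e' \<le> (2 * s) * (2 * s')" using s by (intro mult_mono) auto
    also have "\<dots> \<le> 8 * \<rho>\<^sup>2 * W" using ss by (simp add: mult_ac)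
    finally have le: "norm e * norm e' \<le> 8 * \<rho>\<^sup>2 * W" .
    have p: "0 < 8 * \<rho>\<^sup>2" using r2 by linarith
    have "norm e * norm e' / (8 * \<rho>\<^sup>2) \<le> W"
      unfolding pos_divide_le_eq[OF p] using le by (simp only: mult.commute)
    then show ?thesis by simp
  qed
  ultimately show ?thesis by linarith
qed

lemma adapted_value:
  assumes a: "a \<in> lcone" and b: "b \<in> lcone"
  shows "adapted (L a x0) (L b x0) (M (\<lambda>x. of_real (a x) + \<i> * of_real (b x)) x)"
  unfolding adapted_def
proof (intro exI conjI)
  \<comment> \<open>The witness is \<open>D = 1\<close>; the comparison of \<open>L a\<close> at
    \<open>x\<close> and at \<open>x0\<close> is the Harnack inequality
    \<open>L_le'\<close>.\<close>
  show "(0::real) \<le> 1" by simp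
  have lo: "exp (-K) * 1 * L a x0 \<le> L a x" if "a \<in> lcone" for a
    using L_le'[OF that, of x0 x] by (simp add: exp_minus field_simps)
  have up: "L a x \<le> exp (-K) * \<rho> * 1 * L a x0" if "a \<in> lcone" for a
  proof -
    have "L a x \<le> exp K * L a x0" by (rule L_le'[OF that])
    also have "exp K \<le> exp (-K) * \<rho>"
    proof -
      have "exp (-K) * \<rho> = 2 * K * (exp (- K) * exp (3 * K))" by (simp add: \<rho>_def)
      also have "exp (- K) * exp (3 * K) = exp (2 * K)" by (simp add: exp_add[symmetric])
      finally have "exp (-K) * \<rho> = 2 * K * exp (2 * K)" .
      moreover have "1 * exp K \<le> (2 * K) * exp (2 * K)" using K1 by (intro mult_mono) auto
      ultimately show ?thesis by simp
    qed
    finally show ?thesis using L_nonneg[OF that, of x0] by (simp add: mult_right_mono)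
  qed
  show "exp (-K) * 1 * L a x0 \<le> L a x" "L a x \<le> exp (-K) * \<rho> * 1 * L a x0"
    "exp (-K) * 1 * L b x0 \<le> L b x" "L b x \<le> exp (-K) * \<rho> * 1 * L b x0"
    using lo up a b by blast+
  have "M (\<lambda>x. of_real (a x) + \<i> * of_real (b x)) x - Complex (L a x) (L b x) = E a x + \<i> * E b x"
    unfolding M_eq by (simp add: Complex_eq algebra_simps)
  also have "norm \<dots> \<le> \<epsilon> * L a x + \<epsilon> * L b x"
    using E_bound[OF a, of x] E_bound[OF b, of x] norm_triangle_ineq[of "E a x" "\<i> * E b x"] by (simp add: norm_mult)
  also have "\<dots> \<le> \<epsilon> * C1 * (L a x + L b x)"
  proof -
    have "1 * 1 \<le> (2 * K + 1) * exp K" using K1 by (intro mult_mono) auto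
    then have "1 \<le> C1" by (simp add: C1_def)
    then have "\<epsilon> * (L a x + L b x) * 1 \<le> \<epsilon> * (L a x + L b x) * C1" 
      using \<epsilon> L_nonneg[OF a] L_nonneg[OF b] by (intro mult_left_mono) auto
    then show ?thesis by (simp add: algebra_simps)
  qed
  finally show "norm (M (\<lambda>x. of_real (a x) + \<i> * of_real (b x)) x - Complex (L a x) (L b x)) \<le> \<epsilon> * C1 * (L a x + L b x)" .
qed

text \<open>Here \<open>D = d x y\<close>. The lower bound comes from the unit gained in the
  Lipschitz constant, \<open>exp (K * d x y) - exp ((K - 1) * d x y) \<ge> d x y\<close>; the upper
  one from bounding the difference by \<open>2 * sinh (K * d x y)\<close> times a value of the
  image.\<close>

lemma adapted_difference:
  assumes a: "a \<in> lcone" and b: "b \<in> lcone"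
  defines "v \<equiv> M (\<lambda>x. of_real (a x) + \<i> * of_real (b x))"
  shows "adapted (L a x0) (L b x0) (of_real (exp (K * d x y)) * v y - v x)"
  unfolding adapted_def
proof (intro exI conjI)
  show "0 \<le> d x y" by (rule d0)
  define X where "X a = exp (K * d x y) * L a y - L a x" for a
  have X1: "d x y * L a y \<le> X a" if "a \<in> lcone" for a
  proof -
    have "d x y \<le> exp (K * d x y) - exp ((K - 1) * d x y)"
      using exp_diff_le[of "(K - 1) * d x y" "K * d x y"] K1 d0[of x y] mult_right_mono[OF K1 d0[of x y]]
      by (simp add: algebra_simps)
    then have "d x y * L a y \<le> (exp (K * d x y) - exp ((K - 1) * d x y)) * L a y"
      using L_nonneg[OF that] by (intro mult_right_mono)
    then show ?thesis using L_le[OF that, of x y] by (simp add: X_def algebra_simps)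
  qed
  have lo: "exp (-K) * d x y * L a x0 \<le> X a" if "a \<in> lcone" for a
  proof -
    have "exp (-K) * L a x0 \<le> L a y" using L_le'[OF that, of x0 y] by (simp add: exp_minus field_simps)
    then have "d x y * (exp (-K) * L a x0) \<le> d x y * L a y" using d0 by (intro mult_left_mono)
    then show ?thesis using X1[OF that] by (simp add: mult_ac)
  qed
  have up: "X a \<le> exp (-K) * \<rho> * d x y * L a x0" if "a \<in> lcone" for a
  proof -
    have "L a y \<le> exp ((K - 1) * d x y) * L a x" using L_le[OF that, of y x] dsym[of x y] by simp
    also have "\<dots> \<le> exp (K * d x y) * L a x" using d0[of x y] L_nonneg[OF that] by (intro mult_right_mono) (auto simp: mult_right_mono)
    finally have l: "exp (- (K * d x y)) * L a y \<le> L a x" by (simp add: exp_minus field_simps)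
    define u where "u = K * d x y"
    have u: "0 \<le> u" "u \<le> K" using K1 d0 d1[of x y] by (simp_all add: u_def mult_left_le)
    have "X a \<le> (exp u - exp (-u)) * L a y" using l by (simp add: X_def u_def algebra_simps)
    also have "exp u - exp (-u) \<le> 2 * u * exp u"
    proof -
      have "1 - u \<le> exp (-u)" using exp_ge_add_one_self[of "-u"] by simp
      moreover have "u * 1 \<le> u * exp u" using u by (intro mult_left_mono) auto
      ultimately show ?thesis using exp_minus_one_le[OF u(1)] by simp
    qed
    also have "2 * u * exp u \<le> 2 * u * exp K" using u by (intro mult_left_mono) auto
    finally have "X a \<le> (2 * u * exp K) * L a y" using L_nonneg[OF that, of y] by (simp add: mult_right_mono)
    also have "\<dots> \<le> (2 * u * exp K) * (exp K * L a x0)" using u L_le'[OF that, of y x0] by (intro mult_left_mono) auto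
    also have "\<dots> = 2 * K * (exp K * exp K) * d x y * L a x0" by (simp add: u_def)
    also have "exp K * exp K = exp (- K) * exp (3 * K)" by (simp add: exp_add[symmetric])
    finally show ?thesis by (simp add: \<rho>_def mult_ac)
  qed
  show "exp (-K) * d x y * L a x0 \<le> X a" "X a \<le> exp (-K) * \<rho> * d x y * L a x0"
    "exp (-K) * d x y * L b x0 \<le> X b" "X b \<le> exp (-K) * \<rho> * d x y * L b x0"
    using lo up a b by blast+
  define \<delta> where "\<delta> a = of_real (exp (K * d x y)) * E a y - E a x" for a
  have \<delta>: "norm (\<delta> a) \<le> \<epsilon> * C1 * X a" if "a \<in> lcone" for a
  proof -
    have "norm (\<delta> a) \<le> \<epsilon> * C1 * (d x y * L a y)" unfolding \<delta>_def by (rule E_functional[OF that])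
    also have "\<dots> \<le> \<epsilon> * C1 * X a" using X1[OF that] \<epsilon> K1 by (intro mult_left_mono) (auto simp: C1_def)
    finally show ?thesis .
  qed
  have "of_real (exp (K * d x y)) * v y - v x - Complex (X a) (X b) = \<delta> a + \<i> * \<delta> b"
    unfolding v_def M_eq X_def \<delta>_def by (simp add: Complex_eq algebra_simps)
  also have "norm \<dots> \<le> \<epsilon> * C1 * X a + \<epsilon> * C1 * X b"
    using \<delta>[OF a] \<delta>[OF b] norm_triangle_ineq[of "\<delta> a" "\<i> * \<delta> b"] by (simp add: norm_mult)
  finally show "norm (of_real (exp (K * d x y)) * v y - v x - Complex (X a) (X b)) \<le> \<epsilon> * C1 * (X a + X b)"
    by (simp add: distrib_left)
qed

text \<open>The complexified cone consists of the complex multiples of \<open>a + i b\<close> with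
  \<open>a\<close> and \<open>b\<close> in the real cone. The functionals defining the real cone,
  applied to the image, take values at pairwise acute angles with a uniform margin, so that a single
  rotation moves all of them into the closed first quadrant. Then real and imaginary part both
  satisfy the inequalities of the real cone.\<close>

lemma complex_cone_step:
  assumes small: "12 * (\<epsilon> * C1) * \<rho>\<^sup>2 \<le> 1" and a: "a \<in> lcone" and b: "b \<in> lcone" and pos: "\<And>x. 0 < a x + b x"
  obtains c a' b' where "c \<noteq> 0" "a' \<in> lcone" "b' \<in> lcone" "\<And>x. 0 < a' x + b' x"
    "\<And>x. M (\<lambda>x. of_real (a x) + \<i> * of_real (b x)) x = c * (of_real (a' x) + \<i> * of_real (b' x))"
proof -
  define v where "v = M (\<lambda>x. of_real (a x) + \<i> * of_real (b x))"
  \<comment> \<open>An arbitrary base point: \<open>A\<close> and \<open>B\<close> are the common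
    yardstick for all functionals.\<close>
  fix x0 :: 'x
  define A B where "A = L a x0" and "B = L b x0"
  have A0: "0 \<le> A" "0 \<le> B" using L_nonneg a b by (simp_all add: A_def B_def)
  have LL: "0 < L a x + L b x" for x
  proof -
    have "L a x + L b x = (\<Sum>k\<in>UNIV. g k x * (a (\<tau> k x) + b (\<tau> k x)))"
      by (simp add: transfer_def sum.distrib distrib_left)
    also have "\<dots> > 0" using g0 pos by (intro sum_pos) auto
    finally show ?thesis .
  qed
  define S where "S = range v \<union> {of_real (exp (K * d x y)) * v y - v x | x y. True}"
  have ad: "adapted A B e" if "e \<in> S" for e
    using that adapted_value[OF a b] adapted_difference[OF a b] unfolding S_def A_def B_def v_def by auto
  \<comment> \<open>At a zero the error term would have to cancel both \<open>X\<close> and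
    \<open>Y\<close>, whereas smallness makes twice the error at most a sixth of
    \<open>X + Y\<close>. This also provides the nonzero element that the rotation requires.\<close>
  have v0: "v x \<noteq> 0" for x
  proof
    assume z: "v x = 0"
    define X Y where XY: "X = L a x" "Y = L b x"
    have n: "norm (0 - Complex X Y) \<le> \<epsilon> * C1 * (X + Y)"
    proof -
      have "norm (E a x + \<i> * E b x) \<le> \<epsilon> * X + \<epsilon> * Y"
        using E_bound[OF a, of x] E_bound[OF b, of x] norm_triangle_ineq[of "E a x" "\<i> * E b x"]
        by (simp add: norm_mult XY)
      moreover have "Complex X Y + (E a x + \<i> * E b x) = 0"
        using z unfolding v_def M_eq XY by (simp add: Complex_eq algebra_simps)
      then have "0 - Complex X Y = E a x + \<i> * E b x" using minus_unique by simp
      moreover have "1 * 1 \<le> (2 * K + 1) * exp K" using K1 by (intro mult_mono) auto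
      then have "\<epsilon> * (X + Y) * 1 \<le> \<epsilon> * (X + Y) * C1"
        using \<epsilon> L_nonneg[OF a] L_nonneg[OF b] by (intro mult_left_mono) (auto simp: C1_def XY)
      ultimately show ?thesis by (simp add: algebra_simps)
    qed
    have "\<bar>X\<bar> \<le> norm (0 - Complex X Y)" "\<bar>Y\<bar> \<le> norm (0 - Complex X Y)"
      using abs_Re_le_cmod[of "0 - Complex X Y"] abs_Im_le_cmod[of "0 - Complex X Y"] by simp_all
    then have XY2: "X + Y \<le> 2 * (\<epsilon> * C1 * (X + Y))" using n by linarith
    have XY0: "0 < X + Y" using LL XY by simp
    have "12 * (\<epsilon> * C1) \<le> 1"
    proof -
      have "0 \<le> \<epsilon> * C1" unfolding C1_def using \<epsilon> K1 by simp
      moreover have "1 \<le> \<rho>\<^sup>2" using \<rho>1 by simp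
      ultimately have "12 * (\<epsilon> * C1) * 1 \<le> 12 * (\<epsilon> * C1) * \<rho>\<^sup>2" by (intro mult_left_mono) auto
      then show ?thesis using small by linarith
    qed
    then have "2 * (\<epsilon> * C1 * (X + Y)) \<le> (1/6) * (X + Y)" using XY0 by simp
    then have "X + Y \<le> (1/6) * (X + Y)" by (rule order_trans[OF XY2])
    then show False using XY0 by simp
  qed
  obtain c where c: "c \<noteq> 0" "\<And>e. e \<in> S \<Longrightarrow> 0 \<le> Re (e / c)" "\<And>e. e \<in> S \<Longrightarrow> 0 \<le> Im (e / c)"
  proof (rule quadrant_rotation[where S = S and \<nu> = "1 / (16 * \<rho>\<^sup>2)" and ?e0.0 = "v x0"])
    show "0 < 1 / (16 * \<rho>\<^sup>2)" using \<rho>1 by simp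
    show "1 / (16 * \<rho>\<^sup>2) * (norm e * norm e') \<le> Re (e * cnj e')" if "e \<in> S" "e' \<in> S" for e e'
      by (rule adapted_pair[OF small A0 ad[OF that(1)] ad[OF that(2)]])
  qed (auto simp: S_def v0)
  define a' b' where "a' x = Re (v x / c)" and "b' x = Im (v x / c)" for x
  have n: "0 \<le> a' x" "0 \<le> b' x" for x using c(2,3)[of "v x"] by (auto simp: S_def a'_def b'_def)
  have sp: "(of_real r * p - q) / c = of_real r * (p / c) - q / c" for r p q by (simp add: diff_divide_distrib)
  have m: "of_real (exp (K * d x y)) * v y - v x \<in> S" for x y by (auto simp: S_def)
  have "a' x \<le> exp (K * d x y) * a' y" "b' x \<le> exp (K * d x y) * b' y" for x y
    using c(2,3)[OF m[of x y]] unfolding sp a'_def b'_def minus_complex.sel times_complex.sel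
    by (simp_all only: Re_complex_of_real Im_complex_of_real)
  then have "a' \<in> lcone" "b' \<in> lcone"
    using n by (auto simp: log_lipschitz_cone_def)
  moreover have "v x = c * (of_real (a' x) + \<i> * of_real (b' x))" for x
    using c(1) by (simp add: a'_def b'_def complex_eq[symmetric])
  moreover have "0 < a' x + b' x" for x
  proof (rule ccontr)
    assume "\<not> 0 < a' x + b' x"
    then have "a' x = 0" "b' x = 0" using n[of x] by linarith+
    then show False using v0[of x] calculation(3)[of x] by simp
  qed
  ultimately show ?thesis using that c(1) unfolding v_def by blast
qed

lemma iterates_in_complex_cone:
  assumes small: "12 * (\<epsilon> * C1) * \<rho>\<^sup>2 \<le> 1"
  shows "\<exists>c a b. c \<noteq> 0 \<and> a \<in> lcone \<and> b \<in> lcone \<and> (\<forall>x. 0 < a x + b x) \<and>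
    (M ^^ n) (\<lambda>_. 1) = (\<lambda>x. c * (of_real (a x) + \<i> * of_real (b x)))"
proof (induction n)
  case 0
  have "(\<lambda>_. 1) \<in> lcone" "(\<lambda>_. 0) \<in> lcone" using K1 d0 by (auto simp: log_lipschitz_cone_def)
  then show ?case by (intro exI[of _ 1] exI[of _ "\<lambda>_. 1"] exI[of _ "\<lambda>_. 0"]) auto
next
  case (Suc n)
  then obtain c a b where c: "c \<noteq> 0" "a \<in> lcone" "b \<in> lcone" "\<And>x. 0 < a x + b x"
    "(M ^^ n) (\<lambda>_. 1) = (\<lambda>x. c * (of_real (a x) + \<i> * of_real (b x)))" by blast
  obtain c' a' b' where c': "c' \<noteq> 0" "a' \<in> lcone" "b' \<in> lcone" "\<And>x. 0 < a' x + b' x"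
    "\<And>x. M (\<lambda>x. of_real (a x) + \<i> * of_real (b x)) x = c' * (of_real (a' x) + \<i> * of_real (b' x))"
    using complex_cone_step[OF small c(2-4)] by blast
  have sc: "M (\<lambda>x. c * f x) x = c * M f x" for f x
    by (simp add: transfer_def sum_distrib_left mult_ac)
  have "(M ^^ Suc n) (\<lambda>_. 1) = (\<lambda>x. (c * c') * (of_real (a' x) + \<i> * of_real (b' x)))"
    by (simp add: c(5) c'(5) sc mult.assoc fun_eq_iff)
  then show ?case using c c' by (intro exI[of _ "c * c'"] exI[of _ a'] exI[of _ b']) auto
qed

text \<open>On \<open>c * (a + i b)\<close> the real operator multiplies \<open>a x\<close> and
  \<open>b x\<close> by factors between \<open>\<Gamma> x * exp (-K)\<close> and
  \<open>\<Gamma> x * exp K\<close>, so the quotient has real part at least the smaller factor, and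
  the perturbation takes away at most half of it. The uncontrolled factor \<open>c\<close> cancels
  in the ratio.\<close>

theorem ratio_of_iterates:
  assumes small: "12 * (\<epsilon> * C1) * \<rho>\<^sup>2 \<le> 1"
  defines "U \<equiv> \<lambda>n. (M ^^ n) (\<lambda>_. 1)" and "\<Gamma> \<equiv> \<lambda>x. \<Sum>k\<in>UNIV. g k x"
  shows "U n x \<noteq> 0" "\<Gamma> x * exp (-K) / 2 \<le> Re (U (Suc n) x / U n x)" "norm (U (Suc n) x / U n x) \<le> 4 * \<Gamma> x * exp K"
proof -
  obtain c a b where c: "c \<noteq> 0" "a \<in> lcone" "b \<in> lcone" "\<And>x. 0 < a x + b x"
    and U: "U n = (\<lambda>x. c * (of_real (a x) + \<i> * of_real (b x)))"
    using iterates_in_complex_cone[OF small] unfolding U_def by blast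
  have sc: "M (\<lambda>x. c * f x) x = c * M f x" for f x
    by (simp add: transfer_def sum_distrib_left mult_ac)
  define A B where "A = a x" and "B = b x"
  have AB: "0 \<le> A" "0 \<le> B" "0 < A + B" using c cone_nonneg by (auto simp: A_def B_def)
  define z where "z = Complex A B"
  have z: "of_real (a x) + \<i> * of_real (b x) = z" by (simp add: z_def Complex_eq A_def B_def)
  have z0: "z \<noteq> 0" using AB by (auto simp: z_def complex_eq_iff)
  define r where "r = E a x + \<i> * E b x"
  define y where "y = Complex (L a x) (L b x) + r"
  have Un: "U n x = c * z" unfolding U z ..
  have USn: "U (Suc n) x = c * y"
  proof -
    have "U (Suc n) x = M (U n) x" by (simp add: U_def)
    also have "\<dots> = c * y" unfolding U sc M_eq by (simp add: y_def r_def Complex_eq algebra_simps)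
    finally show ?thesis .
  qed
  show "U n x \<noteq> 0" using Un c z0 by simp
  have q: "U (Suc n) x / U n x = y / z" using Un USn c by simp
  have Lb: "\<Gamma> x * exp (-K) * a x \<le> L a x" "L a x \<le> \<Gamma> x * exp K * a x" if a: "a \<in> lcone" for a
  proof -
    have "g k x * (exp (-K) * a x) \<le> g k x * a (\<tau> k x)" for k
      using cone_le[OF a, of x "\<tau> k x"] g0[of k x] by (intro mult_left_mono) (auto simp: exp_minus field_simps)
    then show "\<Gamma> x * exp (-K) * a x \<le> L a x" unfolding \<Gamma>_def transfer_def sum_distrib_right
      by (intro sum_mono) (simp add: mult_ac)
    have "g k x * a (\<tau> k x) \<le> g k x * (exp K * a x)" for k
      using cone_le[OF a, of "\<tau> k x" x] g0[of k x] by (intro mult_left_mono) auto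
    then show "L a x \<le> \<Gamma> x * exp K * a x" unfolding \<Gamma>_def transfer_def sum_distrib_right
      by (intro sum_mono) (simp add: mult_ac)
  qed
  have \<Gamma>0: "0 \<le> \<Gamma> x" unfolding \<Gamma>_def using g0 by (intro sum_nonneg) (auto simp: less_imp_le)
  have r: "norm r \<le> \<epsilon> * (L a x + L b x)"
    unfolding r_def using E_bound[OF c(2), of x] E_bound[OF c(3), of x] norm_triangle_ineq[of "E a x" "\<i> * E b x"]
    by (simp add: norm_mult distrib_left)
  have LL: "L a x + L b x \<le> \<Gamma> x * exp K * (A + B)"
    using Lb(2)[OF c(2)] Lb(2)[OF c(3)] by (simp add: A_def B_def distrib_left)
  have r': "norm r \<le> \<epsilon> * (\<Gamma> x * exp K * (A + B))" using r LL \<epsilon> mult_left_mono order_trans by blast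
  have zAB: "norm z \<le> A + B" "A + B \<le> 2 * norm z" "(norm z)\<^sup>2 = A\<^sup>2 + B\<^sup>2"
    using cmod_le[of z] abs_Re_le_cmod[of z] abs_Im_le_cmod[of z] AB by (auto simp: z_def cmod_power2)
  \<comment> \<open>Contained in \<open>small\<close>, since \<open>C1 \<ge> 1\<close> and
    \<open>\<rho>^2 \<ge> exp (2 * K)\<close>.\<close>
  have \<epsilon>K: "4 * \<epsilon> * exp (2 * K) \<le> 1"
  proof -
    have "4 * \<epsilon> * exp (2 * K) \<le> (12 * \<epsilon> * C1) * \<rho>\<^sup>2"
    proof (rule mult_mono)
      have "1 * 1 \<le> (2 * K + 1) * exp K" using K1 by (intro mult_mono) auto
      then have "4 * \<epsilon> * 1 \<le> 12 * \<epsilon> * C1" unfolding C1_def using \<epsilon> by (intro mult_mono) auto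
      then show "4 * \<epsilon> \<le> 12 * \<epsilon> * C1" by simp
      have "1 * exp (2 * K) \<le> \<rho> * \<rho>" 
      proof (intro mult_mono)
        have "1 * exp (2 * K) \<le> (2 * K) * exp (3 * K)" using K1 by (intro mult_mono) auto
        then show "exp (2 * K) \<le> \<rho>" by (simp add: \<rho>_def)
      qed (use \<rho>1 in auto)
      then show "exp (2 * K) \<le> \<rho>\<^sup>2" by (simp add: power2_eq_square)
    qed (use \<epsilon> K1 in \<open>auto simp: C1_def\<close>)
    then show ?thesis using small by simp
  qed
  have \<epsilon>1: "\<epsilon> \<le> 1"
  proof -
    have "4 * \<epsilon> * 1 \<le> 4 * \<epsilon> * exp (2 * K)" using K1 \<epsilon> by (intro mult_left_mono) auto
    then show ?thesis using \<epsilon>K \<epsilon> by linarith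
  qed
  have Re_yz: "Re (y * cnj z) \<ge> \<Gamma> x * exp (-K) / 2 * (norm z)\<^sup>2"
  proof -
    have "Re (y * cnj z) = L a x * A + L b x * B + Re (r * cnj z)"
      by (simp add: y_def z_def algebra_simps)
    moreover have "\<Gamma> x * exp (-K) * (norm z)\<^sup>2 \<le> L a x * A + L b x * B"
      using mult_right_mono[OF Lb(1)[OF c(2)] AB(1)] mult_right_mono[OF Lb(1)[OF c(3)] AB(2)]
      unfolding zAB(3) A_def B_def by (simp add: power2_eq_square algebra_simps)
    moreover have "\<bar>Re (r * cnj z)\<bar> \<le> \<Gamma> x * exp (-K) / 2 * (norm z)\<^sup>2"
    proof -
      have "\<bar>Re (r * cnj z)\<bar> \<le> norm r * norm z" using abs_Re_le_cmod[of "r * cnj z"] by (simp add: norm_mult)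
      also have "\<dots> \<le> \<epsilon> * (\<Gamma> x * exp K * (2 * norm z)) * norm z"
        using r' zAB(2) \<epsilon> \<Gamma>0 by (intro mult_right_mono order_trans[OF r'] mult_left_mono) auto
      also have "\<dots> = (4 * \<epsilon> * exp (2 * K)) * (\<Gamma> x * exp (-K) / 2 * (norm z)\<^sup>2)"
      proof -
        have "exp K = exp (2 * K) * exp (-K)" by (simp add: exp_add[symmetric])
        then show ?thesis by (simp add: power2_eq_square)
      qed
      also have "\<dots> \<le> 1 * (\<Gamma> x * exp (-K) / 2 * (norm z)\<^sup>2)" using \<epsilon>K \<Gamma>0 by (intro mult_right_mono) auto
      finally show ?thesis by simp
    qed
    moreover have h: "\<Gamma> x * exp (-K) / 2 * (norm z)\<^sup>2 = (\<Gamma> x * exp (-K) * (norm z)\<^sup>2) / 2" by simp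
    ultimately show ?thesis unfolding h by linarith
  qed
  have "Re (y / z) = Re (y * cnj z) / (norm z)\<^sup>2"
    by (subst complex_div_cnj) (simp add: Re_divide_of_real del: of_real_power add: of_real_power[symmetric])
  also have "\<dots> \<ge> (\<Gamma> x * exp (-K) / 2 * (norm z)\<^sup>2) / (norm z)\<^sup>2"
    using Re_yz by (rule divide_right_mono) simp
  finally show "\<Gamma> x * exp (-K) / 2 \<le> Re (U (Suc n) x / U n x)"
    unfolding q using z0 by simp
  have "norm y \<le> (L a x + L b x) + \<epsilon> * (L a x + L b x)"
    unfolding y_def using cmod_le[of "Complex (L a x) (L b x)"] L_nonneg[OF c(2), of x] L_nonneg[OF c(3), of x] r
    by (intro order_trans[OF norm_triangle_ineq] add_mono) auto
  also have "\<dots> \<le> (L a x + L b x) + 1 * (L a x + L b x)"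
    using \<epsilon>1 L_nonneg[OF c(2), of x] L_nonneg[OF c(3), of x] by (intro add_left_mono mult_right_mono) auto
  also have "\<dots> \<le> 2 * (\<Gamma> x * exp K * (2 * norm z))"
    using LL zAB(2) \<Gamma>0 mult_left_mono[OF zAB(2), of "\<Gamma> x * exp K"] by simp
  finally show "norm (U (Suc n) x / U n x) \<le> 4 * \<Gamma> x * exp K"
    unfolding q norm_divide using z0 by (simp add: field_simps)
qed

end

subsection \<open>Moebius maps close to positive ones\<close>

text \<open>
  The quotient of the two coordinates of the image of \<open>(1, 1)\<close> under the product along a word of
  the matrices with rows \<open>(al, be)\<close> and \<open>(ga, de)\<close>.
\<close>

fun mobius_orbit :: "('k \<Rightarrow> complex) \<Rightarrow> ('k \<Rightarrow> complex) \<Rightarrow> ('k \<Rightarrow> complex) \<Rightarrow> ('k \<Rightarrow> complex) \<Rightarrow> 'k list \<Rightarrow> complex" where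
  "mobius_orbit al be ga de [] = 1"
| "mobius_orbit al be ga de (k # w) = (al k * mobius_orbit al be ga de w + be k) / (ga k * mobius_orbit al be ga de w + de k)"

text \<open>
  Up to a factor the hyperbolic sine of half the hyperbolic distance in the right half-plane. It is
  preferred to the distance because its contraction under a Moebius map is an algebraic identity;
  the contraction persists for complex coefficients close to positive ones.
\<close>

definition hdist :: "complex \<Rightarrow> complex \<Rightarrow> real" where
  "hdist z z' = norm (z - z') / (sqrt (Re z) * sqrt (Re z'))"

text \<open>For positive real coefficients the left side of \<open>c4\<close> is zero, and
  \<open>c6\<close> holds with some \<open>\<theta> < 1\<close> because the difference of two
  positive numbers is smaller in modulus than their sum. In strict form all the conditions are open,
  so they persist for complex coefficients nearby with the same \<open>m\<close>, \<open>B\<close>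
  and \<open>\<theta>\<close>.\<close>

locale mobius_family =
  fixes al be ga de :: "'k::finite \<Rightarrow> complex" and m B \<theta> :: real
  assumes m: "0 < m" and \<theta>: "0 \<le> \<theta>" "\<theta> < 1"
    and bd: "norm (al k) \<le> B" "norm (be k) \<le> B" "norm (ga k) \<le> B" "norm (de k) \<le> B"
    and c1: "m \<le> Re (al k * cnj (ga k))" and c2: "m \<le> Re (be k * cnj (de k))" and c3: "m \<le> Re (ga k * cnj (de k))"
    and c4: "\<bar>Im (al k * cnj (de k)) - Im (be k * cnj (ga k))\<bar> \<le> m"
    and c5: "0 < Re (al k * cnj (de k) + be k * cnj (ga k))"
    and c6: "norm (al k * de k - be k * ga k) \<le> \<theta> * Re (al k * cnj (de k) + be k * cnj (ga k))"
begin

abbreviation "Z \<equiv> mobius_orbit al be ga de"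
abbreviation "N k z \<equiv> al k * z + be k"
abbreviation "E k z \<equiv> ga k * z + de k"
text \<open>Bounds for the orbit in terms of \<open>m\<close> and \<open>B\<close> only; the summand
  1 here and in \<open>c\<close> makes them valid for the initial value 1 of the orbit too.\<close>

definition "C = 1 + 3 * B\<^sup>2 / m"
definition "c = 1 / (1 + 4 * B\<^sup>2 / m)"

lemma B0: "0 < B" 
proof -
  fix k :: 'k
  have "ga k \<noteq> 0" using c3[of k] m by auto
  then have "0 < norm (ga k)" by simp
  then show ?thesis using bd(3)[of k] by linarith
qed

lemma gaE: assumes "0 \<le> Re z" shows "m \<le> norm (ga k) * norm (E k z)"
proof -
  have "cnj (ga k) * E k z = of_real ((norm (ga k))\<^sup>2) * z + cnj (ga k * cnj (de k))"
    unfolding complex_norm_square by (simp add: algebra_simps)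
  then have "Re (cnj (ga k) * E k z) = (norm (ga k))\<^sup>2 * Re z + Re (ga k * cnj (de k))"
    by (simp del: of_real_power times_complex.sel complex_cnj_mult add: complex_cnj_cnj)
      (simp del: of_real_power complex_cnj_mult)
  moreover have "0 \<le> (norm (ga k))\<^sup>2 * Re z" using assms by simp
  ultimately have "m \<le> Re (cnj (ga k) * E k z)" using c3[of k] by linarith
  also have "\<dots> \<le> norm (cnj (ga k) * E k z)" by (rule complex_Re_le_cmod)
  finally show ?thesis by (simp add: norm_mult)
qed

lemma E_lower: assumes "0 \<le> Re z" shows "m / B \<le> norm (E k z)" "E k z \<noteq> 0"
proof -
  have "m \<le> B * norm (E k z)" 
    using gaE[OF assms, of k] mult_right_mono[OF bd(3)[of k] norm_ge_zero[of "E k z"]] by linarith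
  then show "m / B \<le> norm (E k z)" using B0 by (simp add: field_simps)
  then show "E k z \<noteq> 0" using m B0 by (smt (verit) divide_pos_pos norm_zero)
qed

text \<open>In the expansion only the term with \<open>Im z\<close> has no sign; by
  \<open>c4\<close> and \<open>2 * |Im z| \<le> 1 + (norm z)^2\<close> it consumes at most half of
  what \<open>c1\<close> and \<open>c2\<close> supply. The remaining half keeps the image away from
  the imaginary axis, and the term with \<open>Re z\<close> governs the contraction.\<close>

lemma NE: assumes "0 \<le> Re z"
  shows "m * (1 + (norm z)\<^sup>2) / 2 + Re (al k * cnj (de k) + be k * cnj (ga k)) * Re z \<le> Re (N k z * cnj (E k z))"
proof -
  have "N k z * cnj (E k z) = (al k * cnj (ga k)) * of_real ((norm z)\<^sup>2) + (al k * cnj (de k)) * z + (be k * cnj (ga k)) * cnj z + be k * cnj (de k)"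
    unfolding complex_norm_square by (simp add: algebra_simps)
  moreover have g: "Re (a * of_real r + b * z + b' * cnj z + d) = Re a * r + Re (b + b') * Re z - (Im b - Im b') * Im z + Re d" 
    for a b b' d :: complex and r by (simp add: algebra_simps)
  ultimately have eq: "Re (N k z * cnj (E k z)) = Re (al k * cnj (ga k)) * (norm z)\<^sup>2 
      + Re (al k * cnj (de k) + be k * cnj (ga k)) * Re z
      - (Im (al k * cnj (de k)) - Im (be k * cnj (ga k))) * Im z + Re (be k * cnj (de k))"
    by (simp only: g)
  have "(Im (al k * cnj (de k)) - Im (be k * cnj (ga k))) * Im z \<le> \<bar>Im (al k * cnj (de k)) - Im (be k * cnj (ga k))\<bar> * \<bar>Im z\<bar>"
    unfolding abs_mult[symmetric] by (rule abs_ge_self)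
  also have "\<dots> \<le> m * \<bar>Im z\<bar>" by (rule mult_right_mono[OF c4]) simp
  also have "\<dots> \<le> m * ((1 + (norm z)\<^sup>2) / 2)"
  proof (rule mult_left_mono)
    have "2 * \<bar>Im z\<bar> \<le> 1 + \<bar>Im z\<bar>\<^sup>2" using sum_squares_bound[of 1 "\<bar>Im z\<bar>"] by simp
    also have "\<bar>Im z\<bar>\<^sup>2 \<le> (norm z)\<^sup>2" by (intro power_mono abs_Im_le_cmod) simp
    finally show "\<bar>Im z\<bar> \<le> (1 + (norm z)\<^sup>2) / 2" by simp
  qed (use m in simp)
  finally have "(Im (al k * cnj (de k)) - Im (be k * cnj (ga k))) * Im z \<le> m * ((1 + (norm z)\<^sup>2) / 2)" .
  moreover have "m * (norm z)\<^sup>2 \<le> Re (al k * cnj (ga k)) * (norm z)\<^sup>2" using c1[of k] by (intro mult_right_mono) auto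
  moreover have "m * (1 + (norm z)\<^sup>2) / 2 = m * (norm z)\<^sup>2 + m - m * ((1 + (norm z)\<^sup>2) / 2)" by (simp add: field_simps)
  ultimately show ?thesis unfolding eq using c2[of k] by linarith
qed

lemma Re_quot: "Re (a / b) = Re (a * cnj b) / (norm b)\<^sup>2"
  by (subst complex_div_cnj) (simp add: Re_divide_of_real del: of_real_power add: of_real_power[symmetric])

lemma T_Re1: assumes "0 \<le> Re z" shows "c \<le> Re (N k z / E k z)"
proof -
  have p: "0 < Re (al k * cnj (de k) + be k * cnj (ga k)) * Re z \<or> Re z = 0" using assms c5[of k] by (cases "Re z = 0") (auto intro!: mult_pos_pos)
  have l: "m * (1 + (norm z)\<^sup>2) / 2 \<le> Re (N k z * cnj (E k z))" using NE[OF assms, of k] p by (auto simp del: times_complex.sel plus_complex.sel)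
  have En: "0 < (norm (E k z))\<^sup>2" using E_lower[OF assms] by simp
  have "norm (E k z) \<le> B * norm z + B" using bd(3,4)[of k]
    by (intro order_trans[OF norm_triangle_ineq] add_mono) (auto simp: norm_mult intro: mult_right_mono)
  then have "(norm (E k z))\<^sup>2 \<le> (B * norm z + B)\<^sup>2" by (intro power_mono) auto
  also have "\<dots> \<le> 2 * B\<^sup>2 * (1 + (norm z)\<^sup>2)"
  proof -
    have "(norm z + 1)\<^sup>2 \<le> 2 * (1 + (norm z)\<^sup>2)" using sum_squares_bound[of "norm z" 1] by (simp add: power2_sum)
    then have "B\<^sup>2 * (norm z + 1)\<^sup>2 \<le> B\<^sup>2 * (2 * (1 + (norm z)\<^sup>2))" by (intro mult_left_mono) auto
    then show ?thesis by (simp add: power2_eq_square algebra_simps)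
  qed
  finally have u: "(norm (E k z))\<^sup>2 \<le> 2 * B\<^sup>2 * (1 + (norm z)\<^sup>2)" .
  have "c \<le> m / (4 * B\<^sup>2)" 
  proof -
    have "c \<le> 1 / (4 * B\<^sup>2 / m)" unfolding c_def using m B0 
      by (intro divide_left_mono mult_pos_pos add_pos_pos divide_pos_pos) auto
    then show ?thesis by simp
  qed
  also have "\<dots> = (m * (1 + (norm z)\<^sup>2) / 2) / (2 * B\<^sup>2 * (1 + (norm z)\<^sup>2))"
  proof -
    have "1 + (norm z)\<^sup>2 > 0" by (simp add: add_pos_nonneg)
    moreover have "m / (4 * b) = (m * s / 2) / (2 * b * s)" if "0 < s" for s b using that by simp
    ultimately show ?thesis by blast
  qed
  also have "\<dots> \<le> Re (N k z * cnj (E k z)) / (norm (E k z))\<^sup>2"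
  proof (intro frac_le)
    show "0 \<le> Re (N k z * cnj (E k z))" using l m by (smt (verit) divide_nonneg_pos mult_nonneg_nonneg zero_le_power2)
  qed (use l u En in auto)
  finally show ?thesis unfolding Re_quot .
qed

lemma c0: "0 < c" "c \<le> 1" unfolding c_def using m B0 by (auto simp: add_pos_pos)
lemma C1: "1 \<le> C" unfolding C_def using m by simp

text \<open>Subtracting the value \<open>al k / ga k\<close> at infinity leaves the determinant over
  \<open>ga k * E k z\<close>, a denominator bounded below by \<open>gaE\<close>; hence the bound is
  uniform in \<open>z\<close>.\<close>

lemma T_norm: assumes "0 \<le> Re z" shows "norm (N k z / E k z) \<le> C"
proof -
  have g0: "ga k \<noteq> 0" using c3[of k] m by auto
  have E0: "E k z \<noteq> 0" using E_lower[OF assms] by simp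
  have eq: "N k z / E k z = al k / ga k - (al k * de k - be k * ga k) / (ga k * E k z)"
    using g0 E0 by (simp add: divide_simps) (simp add: algebra_simps)
  have mg: "m \<le> norm (ga k) * B"
  proof -
    have "m \<le> norm (ga k * cnj (de k))" using c3[of k] complex_Re_le_cmod order_trans by blast
    also have "\<dots> \<le> norm (ga k) * B" using bd(4)[of k] by (simp add: norm_mult mult_left_mono)
    finally show ?thesis .
  qed
  have "norm (al k / ga k) \<le> B\<^sup>2 / m"
  proof -
    have "norm (al k) * m \<le> B * (norm (ga k) * B)" using bd(1)[of k] mg m B0 by (intro mult_mono) auto
    then show ?thesis using g0 m by (simp add: norm_divide divide_simps power2_eq_square mult_ac)
  qed
  moreover have "norm ((al k * de k - be k * ga k) / (ga k * E k z)) \<le> 2 * B\<^sup>2 / m"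
  proof -
    have "norm (al k * de k - be k * ga k) \<le> B * B + B * B"
      using bd[of k] B0 by (intro order_trans[OF norm_triangle_ineq4] add_mono) (auto simp: norm_mult intro!: mult_mono)
    then show ?thesis unfolding norm_divide using gaE[OF assms, of k] m 
      by (intro frac_le) (auto simp: norm_mult power2_eq_square)
  qed
  ultimately have "norm (N k z / E k z) \<le> B\<^sup>2 / m + 2 * B\<^sup>2 / m"
    unfolding eq by (intro order_trans[OF norm_triangle_ineq4] add_mono)
  then show ?thesis unfolding C_def by (simp add: add_divide_distrib[symmetric])
qed

lemma Z_bounds: "c \<le> Re (Z w)" "norm (Z w) \<le> C"
proof -
  have "c \<le> Re (Z w) \<and> norm (Z w) \<le> C"
  proof (induction w)
    case Nil then show ?case using c0 C1 by simp
  next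
    case (Cons k w)
    then have "0 \<le> Re (Z w)" using c0 by linarith
    then show ?case using T_Re1 T_norm by simp
  qed
  then show "c \<le> Re (Z w)" "norm (Z w) \<le> C" by auto
qed

lemma Z_pos: "0 < Re (Z w)" using Z_bounds(1)[of w] c0 by linarith

text \<open>The difference of two images is the determinant times \<open>z - z'\<close> over both
  denominators, and \<open>NE\<close> bounds the real part of an image below by
  \<open>P * Re z\<close> over the squared modulus of its denominator. In \<open>hdist\<close> the
  denominators cancel, and the modulus of the determinant over \<open>P\<close> remains, at most
  \<open>\<theta>\<close> by \<open>c6\<close>.\<close>

lemma hdist_contract:
  assumes z: "0 < Re z" "0 < Re z'"
  shows "hdist (N k z / E k z) (N k z' / E k z') \<le> \<theta> * hdist z z'"
proof -
  define P where "P = Re (al k * cnj (de k) + be k * cnj (ga k))"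
  have P: "0 < P" using c5[of k] by (simp add: P_def)
  have E0: "E k z \<noteq> 0" "E k z' \<noteq> 0" using E_lower z by (auto simp: less_imp_le)
  have lo: "sqrt (P * Re u) / norm (E k u) \<le> sqrt (Re (N k u / E k u))" if u: "0 < Re u" for u
  proof -
    have "0 \<le> m * (1 + (norm u)\<^sup>2) / 2" using m by simp
    then have "P * Re u \<le> Re (N k u * cnj (E k u))" using NE[of u k] u unfolding P_def by linarith
    then have "P * Re u / (norm (E k u))\<^sup>2 \<le> Re (N k u / E k u)" unfolding Re_quot by (intro divide_right_mono) auto
    then have "sqrt (P * Re u / (norm (E k u))\<^sup>2) \<le> sqrt (Re (N k u / E k u))" by (rule real_sqrt_le_mono)
    then show ?thesis by (simp add: real_sqrt_divide)
  qed
  have "N k z / E k z - N k z' / E k z' = (al k * de k - be k * ga k) * (z - z') / (E k z * E k z')"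
    using E0 by (simp add: divide_simps) (simp add: algebra_simps)
  then have "norm (N k z / E k z - N k z' / E k z') = norm (al k * de k - be k * ga k) * norm (z - z') / (norm (E k z) * norm (E k z'))"
    by (simp add: norm_mult norm_divide)
  also have "\<dots> \<le> (\<theta> * P) * norm (z - z') / (norm (E k z) * norm (E k z'))"
    using c6[of k] unfolding P_def by (intro divide_right_mono mult_right_mono) auto
  finally have n: "norm (N k z / E k z - N k z' / E k z') \<le> (\<theta> * P) * norm (z - z') / (norm (E k z) * norm (E k z'))" .
  have "hdist (N k z / E k z) (N k z' / E k z') \<le> ((\<theta> * P) * norm (z - z') / (norm (E k z) * norm (E k z'))) / 
      ((sqrt (P * Re z) / norm (E k z)) * (sqrt (P * Re z') / norm (E k z')))"
    unfolding hdist_def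
  proof (intro frac_le mult_mono n lo z)
    have "0 \<le> sqrt (P * Re z) / norm (E k z)" using P z by simp
    then show "0 \<le> sqrt (Re (N k z / E k z))" using lo[OF z(1)] by linarith
  qed (use E0 z P \<theta> in \<open>auto intro!: divide_nonneg_nonneg mult_nonneg_nonneg mult_pos_pos divide_pos_pos\<close>)
  also have "\<dots> = \<theta> * hdist z z'"
  proof -
    have "sqrt P * sqrt P = P" using P by simp
    then have "sqrt (P * Re z) * sqrt (P * Re z') = P * (sqrt (Re z) * sqrt (Re z'))"
      by (simp add: real_sqrt_mult)
    then show ?thesis unfolding hdist_def using E0 P z by (simp add: field_simps)
  qed
  finally show ?thesis .
qed

lemma hdist_Z_Cons: "hdist (Z (k # w)) (Z (k # w')) \<le> \<theta> * hdist (Z w) (Z w')"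
  using hdist_contract[OF Z_pos Z_pos] by simp

lemma hdist_nonneg: "0 \<le> hdist (Z w) (Z w')"
  unfolding hdist_def using Z_pos by (intro divide_nonneg_nonneg mult_nonneg_nonneg) (auto simp: less_imp_le)

lemma hdist_Z_bound: "hdist (Z w) (Z w') \<le> 2 * C / c"
proof -
  have s: "sqrt c \<le> sqrt (Re (Z w))" for w using Z_bounds(1) by simp
  have "sqrt c * sqrt c \<le> sqrt (Re (Z w)) * sqrt (Re (Z w'))" using s c0 Z_pos
    by (intro mult_mono) (auto simp: less_imp_le)
  moreover have "norm (Z w - Z w') \<le> 2 * C" using norm_triangle_ineq4[of "Z w" "Z w'"] Z_bounds(2)[of w] Z_bounds(2)[of w'] by linarith
  ultimately show ?thesis unfolding hdist_def using c0 C1 by (intro frac_le) auto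
qed

lemma norm_le_hdist: "norm (Z w - Z w') \<le> C * hdist (Z w) (Z w')"
proof -
  have s: "sqrt (Re (Z w)) \<le> sqrt C" for w using Z_bounds(2)[of w] complex_Re_le_cmod[of "Z w"] by simp
  have "sqrt (Re (Z w)) * sqrt (Re (Z w')) \<le> sqrt C * sqrt C" using s Z_pos C1 by (intro mult_mono) (auto simp: less_imp_le)
  also have "\<dots> = C" using C1 by simp
  finally have le: "norm (Z w - Z w') * (sqrt (Re (Z w)) * sqrt (Re (Z w'))) \<le> norm (Z w - Z w') * C" by (intro mult_left_mono) auto
  have p: "0 < sqrt (Re (Z w)) * sqrt (Re (Z w'))" using Z_pos by simp
  have "norm (Z w - Z w') \<le> norm (Z w - Z w') * C / (sqrt (Re (Z w)) * sqrt (Re (Z w')))"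
    unfolding pos_le_divide_eq[OF p] by (rule le)
  then show ?thesis unfolding hdist_def by (simp only: mult.commute times_divide_eq_right)
qed

lemma Z_prefix: "norm (Z (u @ v) - Z u) \<le> 2 * C\<^sup>2 / c * \<theta> ^ length u"
proof -
  have "hdist (Z (u @ v)) (Z u) \<le> \<theta> ^ length u * (2 * C / c)"
  proof (induction u)
    case Nil show ?case using hdist_Z_bound[of v "[]"] by simp
  next
    case (Cons k u)
    have "hdist (Z ((k # u) @ v)) (Z (k # u)) \<le> \<theta> * hdist (Z (u @ v)) (Z u)"
      using hdist_Z_Cons[of k "u @ v" u] by simp
    also have "\<dots> \<le> \<theta> * (\<theta> ^ length u * (2 * C / c))" using Cons \<theta> by (intro mult_left_mono)
    finally show ?case by simp
  qed
  then have "C * hdist (Z (u @ v)) (Z u) \<le> C * (\<theta> ^ length u * (2 * C / c))" using C1 by (intro mult_left_mono) auto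
  then show ?thesis using norm_le_hdist[of "u @ v" u] by (simp add: power2_eq_square mult_ac)
qed

end

section \<open>Perturbation of positive coefficients, uniformly over words\<close>

lemma tendsto_normD:
  fixes f :: "'p \<Rightarrow> 'a::real_normed_vector"
  shows "(f \<longlongrightarrow> l) \<Phi> \<Longrightarrow> 0 < e \<Longrightarrow> \<forall>\<^sub>F p in \<Phi>. norm (f p - l) < e"
  by (simp add: tendsto_iff dist_norm)

lemma eventually_mobius_family:
  fixes al be ga de :: "'p \<Rightarrow> 'k::finite \<Rightarrow> complex" and al0 be0 ga0 de0 :: "'k \<Rightarrow> real"
  assumes lim: "\<And>k. ((\<lambda>p. al p k) \<longlongrightarrow> of_real (al0 k)) \<Phi>" "\<And>k. ((\<lambda>p. be p k) \<longlongrightarrow> of_real (be0 k)) \<Phi>"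
    "\<And>k. ((\<lambda>p. ga p k) \<longlongrightarrow> of_real (ga0 k)) \<Phi>" "\<And>k. ((\<lambda>p. de p k) \<longlongrightarrow> of_real (de0 k)) \<Phi>"
    and m: "0 < m" and \<theta>: "0 \<le> \<theta>" "\<theta> < 1"
    and bd: "\<And>k. \<bar>al0 k\<bar> < B" "\<And>k. \<bar>be0 k\<bar> < B" "\<And>k. \<bar>ga0 k\<bar> < B" "\<And>k. \<bar>de0 k\<bar> < B"
    and c: "\<And>k. m < al0 k * ga0 k" "\<And>k. m < be0 k * de0 k" "\<And>k. m < ga0 k * de0 k"
      "\<And>k. 0 < al0 k * de0 k + be0 k * ga0 k"
      "\<And>k. \<bar>al0 k * de0 k - be0 k * ga0 k\<bar> < \<theta> * (al0 k * de0 k + be0 k * ga0 k)"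
  shows "\<forall>\<^sub>F p in \<Phi>. mobius_family (al p) (be p) (ga p) (de p) m B \<theta>"
proof -
  note l = lim
  have b: "\<forall>\<^sub>F p in \<Phi>. norm (f p k) < B" if "\<And>k. ((\<lambda>p. f p k) \<longlongrightarrow> of_real (f0 k)) \<Phi>" "\<bar>f0 k\<bar> < B" for f :: "'p \<Rightarrow> 'k \<Rightarrow> complex" and f0 :: "'k \<Rightarrow> real" and k
    using order_tendstoD(2)[OF tendsto_norm[OF that(1)[of k]], of B] that(2) by simp
  have r: "\<forall>\<^sub>F p in \<Phi>. x < Re (f p k * cnj (g p k))"
    if "\<And>k. ((\<lambda>p. f p k) \<longlongrightarrow> of_real (f0 k)) \<Phi>" "\<And>k. ((\<lambda>p. g p k) \<longlongrightarrow> of_real (g0 k)) \<Phi>" "x < f0 k * g0 k"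
    for f g :: "'p \<Rightarrow> 'k \<Rightarrow> complex" and f0 g0 :: "'k \<Rightarrow> real" and x k
  proof (rule order_tendstoD(1)[OF _ that(3)])
    have "((\<lambda>p. Re (f p k * cnj (g p k))) \<longlongrightarrow> Re (of_real (f0 k) * cnj (of_real (g0 k)))) \<Phi>"
      using that by (intro tendsto_intros)
    then show "((\<lambda>p. Re (f p k * cnj (g p k))) \<longlongrightarrow> f0 k * g0 k) \<Phi>" by simp
  qed
  have i: "\<forall>\<^sub>F p in \<Phi>. \<bar>Im (al p k * cnj (de p k)) - Im (be p k * cnj (ga p k))\<bar> < m" for k
  proof (rule order_tendstoD(2)[OF _ m])
    have "((\<lambda>p. \<bar>Im (al p k * cnj (de p k)) - Im (be p k * cnj (ga p k))\<bar>) \<longlongrightarrow> 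
      \<bar>Im (of_real (al0 k) * cnj (of_real (de0 k))) - Im (of_real (be0 k) * cnj (of_real (ga0 k)))\<bar>) \<Phi>"
      using l by (intro tendsto_intros)
    then show "((\<lambda>p. \<bar>Im (al p k * cnj (de p k)) - Im (be p k * cnj (ga p k))\<bar>) \<longlongrightarrow> 0) \<Phi>" by simp
  qed
  have s: "\<forall>\<^sub>F p in \<Phi>. 0 < Re (al p k * cnj (de p k) + be p k * cnj (ga p k))" for k
  proof (rule order_tendstoD(1)[OF _ c(4)[of k]])
    have "((\<lambda>p. Re (al p k * cnj (de p k) + be p k * cnj (ga p k))) \<longlongrightarrow> 
      Re (of_real (al0 k) * cnj (of_real (de0 k)) + of_real (be0 k) * cnj (of_real (ga0 k)))) \<Phi>"
      using l by (intro tendsto_intros)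
    then show "((\<lambda>p. Re (al p k * cnj (de p k) + be p k * cnj (ga p k))) \<longlongrightarrow> al0 k * de0 k + be0 k * ga0 k) \<Phi>" by simp
  qed
  have d: "\<forall>\<^sub>F p in \<Phi>. 0 < \<theta> * Re (al p k * cnj (de p k) + be p k * cnj (ga p k)) - norm (al p k * de p k - be p k * ga p k)" for k
  proof (rule order_tendstoD(1))
    have "((\<lambda>p. \<theta> * Re (al p k * cnj (de p k) + be p k * cnj (ga p k)) - norm (al p k * de p k - be p k * ga p k)) \<longlongrightarrow> 
      \<theta> * Re (of_real (al0 k) * cnj (of_real (de0 k)) + of_real (be0 k) * cnj (of_real (ga0 k)))
        - norm (of_real (al0 k) * of_real (de0 k) - of_real (be0 k) * of_real (ga0 k) :: complex)) \<Phi>"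
      using l by (intro tendsto_intros)
    then show "((\<lambda>p. \<theta> * Re (al p k * cnj (de p k) + be p k * cnj (ga p k)) - norm (al p k * de p k - be p k * ga p k)) \<longlongrightarrow> 
      \<theta> * (al0 k * de0 k + be0 k * ga0 k) - \<bar>al0 k * de0 k - be0 k * ga0 k\<bar>) \<Phi>"
      by (simp flip: of_real_mult of_real_diff)
  qed (use c(5)[of k] in simp)
  have "\<forall>\<^sub>F p in \<Phi>. \<forall>k. norm (al p k) < B \<and> norm (be p k) < B \<and> norm (ga p k) < B \<and> norm (de p k) < B \<and>
    m < Re (al p k * cnj (ga p k)) \<and> m < Re (be p k * cnj (de p k)) \<and> m < Re (ga p k * cnj (de p k)) \<and>
    \<bar>Im (al p k * cnj (de p k)) - Im (be p k * cnj (ga p k))\<bar> < m \<and>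
    0 < Re (al p k * cnj (de p k) + be p k * cnj (ga p k)) \<and>
    0 < \<theta> * Re (al p k * cnj (de p k) + be p k * cnj (ga p k)) - norm (al p k * de p k - be p k * ga p k)"
  proof (intro eventually_all_finite)
    fix k
    note b[where f = al and ?f0.0 = al0, OF l(1) bd(1)[of k]] b[where f = be and ?f0.0 = be0, OF l(2) bd(2)[of k]] b[where f = ga and ?f0.0 = ga0, OF l(3) bd(3)[of k]] b[where f = de and ?f0.0 = de0, OF l(4) bd(4)[of k]]
      r[where f = al and ?f0.0 = al0 and g = ga and ?g0.0 = ga0, OF l(1) l(3) c(1)[of k]] r[where f = be and ?f0.0 = be0 and g = de and ?g0.0 = de0, OF l(2) l(4) c(2)[of k]] r[where f = ga and ?f0.0 = ga0 and g = de and ?g0.0 = de0, OF l(3) l(4) c(3)[of k]] i[of k] s[of k] d[of k]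
    then show "\<forall>\<^sub>F p in \<Phi>. norm (al p k) < B \<and> norm (be p k) < B \<and> norm (ga p k) < B \<and> norm (de p k) < B \<and>
      m < Re (al p k * cnj (ga p k)) \<and> m < Re (be p k * cnj (de p k)) \<and> m < Re (ga p k * cnj (de p k)) \<and>
      \<bar>Im (al p k * cnj (de p k)) - Im (be p k * cnj (ga p k))\<bar> < m \<and>
      0 < Re (al p k * cnj (de p k) + be p k * cnj (ga p k)) \<and>
      0 < \<theta> * Re (al p k * cnj (de p k) + be p k * cnj (ga p k)) - norm (al p k * de p k - be p k * ga p k)"
      by eventually_elim blast
  qed
  then show ?thesis
    by eventually_elim (unfold_locales, use m \<theta> in \<open>auto simp: less_imp_le\<close>)
qed

text \<open>The filter on an abstract parameter type stands for closeness to the real parameter; it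
  is later a filter on pairs of a complex exponent shift and complex coordinates. \<open>a\<close>
  and \<open>b\<close> are the exponents of the denominator and of the determinant
  \<open>D\<close>.\<close>

locale positive_perturbation =
  fixes al be ga de D :: "'p \<Rightarrow> 'k::finite \<Rightarrow> complex" and al0 be0 ga0 de0 D0 :: "'k \<Rightarrow> real"
    and a b :: "'p \<Rightarrow> complex" and a0 b0 :: real and \<Phi> :: "'p filter"
  assumes lim: "\<And>k. ((\<lambda>p. al p k) \<longlongrightarrow> of_real (al0 k)) \<Phi>" "\<And>k. ((\<lambda>p. be p k) \<longlongrightarrow> of_real (be0 k)) \<Phi>"
    "\<And>k. ((\<lambda>p. ga p k) \<longlongrightarrow> of_real (ga0 k)) \<Phi>" "\<And>k. ((\<lambda>p. de p k) \<longlongrightarrow> of_real (de0 k)) \<Phi>"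
    "\<And>k. ((\<lambda>p. D p k) \<longlongrightarrow> of_real (D0 k)) \<Phi>"
    and lima: "(a \<longlongrightarrow> of_real a0) \<Phi>" and limb: "(b \<longlongrightarrow> of_real b0) \<Phi>"
    and pos: "\<And>k. 0 < al0 k" "\<And>k. 0 < be0 k" "\<And>k. 0 < ga0 k" "\<And>k. 0 < de0 k" "\<And>k. 0 < D0 k"
begin

definition Z where "Z p = mobius_orbit (al p) (be p) (ga p) (de p)"
definition Z0 where "Z0 = mobius_orbit (\<lambda>k. of_real (al0 k)) (\<lambda>k. of_real (be0 k)) (\<lambda>k. of_real (ga0 k)) (\<lambda>k. of_real (de0 k))"
definition E where "E p k w = ga p k * Z p w + de p k"
definition E0 where "E0 k w = of_real (ga0 k) * Z0 w + of_real (de0 k)"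
definition \<Lambda> where "\<Lambda> p k w = a p * Ln (E p k w) + b p * Ln (D p k)"
definition \<Lambda>0 where "\<Lambda>0 k w = of_real a0 * Ln (E0 k w) + of_real b0 * Ln (of_real (D0 k))"

lemma finite_pos_lower: "(\<And>k::'k. 0 < f k) \<Longrightarrow> \<exists>m>0. \<forall>k. m < (f k :: real)"
proof -
  assume f: "\<And>k::'k. 0 < f k"
  have "Min (range f) > 0" using f by simp
  moreover have "Min (range f) \<le> f k" for k by simp
  ultimately have "0 < Min (range f) / 2 \<and> (\<forall>k. Min (range f) / 2 < f k)"
    by (smt (verit) field_sum_of_halves)
  then show ?thesis by blast
qed

lemma finite_upper: "\<exists>B. \<forall>k::'k. (f k :: real) < B"
  by (intro exI[of _ "Max (range f) + 1"]) (auto intro: le_less_trans[of _ "Max (range f)"])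

lemma ex_family:
  obtains m B \<theta> where "mobius_family (\<lambda>k. of_real (al0 k)) (\<lambda>k. of_real (be0 k)) (\<lambda>k. of_real (ga0 k)) (\<lambda>k. of_real (de0 k)) m B \<theta>"
    "\<forall>\<^sub>F p in \<Phi>. mobius_family (al p) (be p) (ga p) (de p) m B \<theta>"
proof -
  obtain m where m: "0 < m" "\<And>k. m < min (al0 k * ga0 k) (min (be0 k * de0 k) (ga0 k * de0 k))"
    using finite_pos_lower[of "\<lambda>k. min (al0 k * ga0 k) (min (be0 k * de0 k) (ga0 k * de0 k))"] pos by auto
  obtain B where B: "\<And>k. max (max \<bar>al0 k\<bar> \<bar>be0 k\<bar>) (max \<bar>ga0 k\<bar> \<bar>de0 k\<bar>) < B"
    using finite_upper[of "\<lambda>k. max (max \<bar>al0 k\<bar> \<bar>be0 k\<bar>) (max \<bar>ga0 k\<bar> \<bar>de0 k\<bar>)"] by auto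
  define P where "P k = al0 k * de0 k + be0 k * ga0 k" for k
  define r where "r k = \<bar>al0 k * de0 k - be0 k * ga0 k\<bar> / P k" for k
  have P: "0 < P k" for k unfolding P_def using pos by (simp add: add_pos_pos)
  have "\<bar>al0 k * de0 k - be0 k * ga0 k\<bar> < P k" for k
  proof -
    have "0 < al0 k * de0 k" "0 < be0 k * ga0 k" using pos by simp_all
    then show ?thesis unfolding P_def by linarith
  qed
  then have "r k < 1" for k unfolding r_def using P[of k] by simp
  then obtain e where e: "0 < e" "\<And>k. e < 1 - r k" using finite_pos_lower[of "\<lambda>k. 1 - r k"] by auto
  define \<theta> where "\<theta> = 1 - e"
  have r\<theta>: "r k < \<theta>" for k using e(2)[of k] by (simp add: \<theta>_def)
  \<comment> \<open>The alphabet is a type and therefore nonempty; \<open>undefined\<close> is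
    merely some letter.\<close>
  have "0 \<le> r undefined" unfolding r_def using P[of undefined] by simp
  then have \<theta>: "0 \<le> \<theta>" "\<theta> < 1" using r\<theta>[of undefined] e by (auto simp: \<theta>_def)
  have c5: "\<bar>al0 k * de0 k - be0 k * ga0 k\<bar> < \<theta> * (al0 k * de0 k + be0 k * ga0 k)" for k
    using r\<theta>[of k] P[of k] unfolding r_def P_def by (simp add: pos_divide_less_eq)
  have c4: "0 < al0 k * de0 k + be0 k * ga0 k" for k using P[of k] by (simp add: P_def)
  have "\<forall>\<^sub>F p in principal {()}. mobius_family (\<lambda>k. of_real (al0 k)) (\<lambda>k. of_real (be0 k)) (\<lambda>k. of_real (ga0 k)) (\<lambda>k. of_real (de0 k)) m B \<theta>"
    using m B c4 c5 by (intro eventually_mobius_family[OF _ _ _ _ m(1) \<theta>] tendsto_const) auto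
  \<comment> \<open>The unperturbed family has been treated as a constant family over a one-point
    filter, so that both families share \<open>m\<close>, \<open>B\<close> and
    \<open>\<theta>\<close>.\<close>
  then have 1: "mobius_family (\<lambda>k. of_real (al0 k)) (\<lambda>k. of_real (be0 k)) (\<lambda>k. of_real (ga0 k)) (\<lambda>k. of_real (de0 k)) m B \<theta>"
    by (simp add: eventually_principal)
  have 2: "\<forall>\<^sub>F p in \<Phi>. mobius_family (al p) (be p) (ga p) (de p) m B \<theta>"
    using m B c4 c5 by (intro eventually_mobius_family[OF lim(1-4) m(1) \<theta>]) auto
  show ?thesis using that[OF 1 2] .
qed

lemma Z0_real: "Z0 w \<in> \<real>"
  unfolding Z0_def by (induction w) (auto intro!: Reals_divide Reals_add Reals_mult)

lemma Z0_pos: "0 < Re (Z0 w)"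
  by (rule ex_family) (use mobius_family.Z_pos in \<open>unfold Z0_def, blast\<close>)

lemma E0_real: "E0 k w = of_real (Re (E0 k w))" "de0 k < Re (E0 k w)"
proof -
  obtain z where z: "Z0 w = of_real z" using Z0_real by (auto elim: Reals_cases)
  have "0 < z" using Z0_pos[of w] z by simp
  then show "E0 k w = of_real (Re (E0 k w))" "de0 k < Re (E0 k w)"
    unfolding E0_def z using pos by simp_all
qed

lemma Z_tendsto: "((\<lambda>p. Z p w) \<longlongrightarrow> Z0 w) \<Phi>"
proof (induction w)
  case (Cons k w)
  have "of_real (ga0 k) * Z0 w + of_real (de0 k) \<noteq> 0"
    using E0_real(2)[of k w] pos(4)[of k] unfolding E0_def[symmetric] by auto
  then show ?case unfolding Z_def Z0_def mobius_orbit.simps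
    using Cons lim unfolding Z_def Z0_def by (intro tendsto_intros) auto
qed (simp add: Z_def Z0_def)

text \<open>
  By uniform contraction the orbit depends on all but the first letters of a word only up to a small
  error, so that the convergence, which holds for each word, is uniform over all words.
\<close>

lemma Z_uniform:
  assumes "0 < e"
  shows "\<forall>\<^sub>F p in \<Phi>. \<forall>w. norm (Z p w - Z0 w) < e"
proof -
  obtain m B \<theta> where f0: "mobius_family (\<lambda>k. of_real (al0 k)) (\<lambda>k. of_real (be0 k)) (\<lambda>k. of_real (ga0 k)) (\<lambda>k. of_real (de0 k)) m B \<theta>"
    and f: "\<forall>\<^sub>F p in \<Phi>. mobius_family (al p) (be p) (ga p) (de p) m B \<theta>" by (rule ex_family)
  define A where "A = 2 * (mobius_family.C m B)\<^sup>2 / mobius_family.c m B"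
  have A0: "0 \<le> A" unfolding A_def using mobius_family.C1[OF f0] mobius_family.c0[OF f0] by simp
  have \<theta>: "0 \<le> \<theta>" "\<theta> < 1" using f0 by (auto simp: mobius_family_def)
  have "(\<lambda>n. A * \<theta> ^ n) \<longlonglongrightarrow> A * 0" using \<theta> by (intro tendsto_intros LIMSEQ_power_zero) simp
  then have "\<forall>\<^sub>F n in sequentially. A * \<theta> ^ n < e / 3" using assms by (intro order_tendstoD(2)) auto
  then obtain n where n: "A * \<theta> ^ n < e / 3" by (auto simp: eventually_sequentially)
  have fin: "finite {u :: 'k list. length u \<le> n}" using finite_lists_length_le[of "UNIV :: 'k set" n] by simp
  have "\<forall>\<^sub>F p in \<Phi>. \<forall>u\<in>{u :: 'k list. length u \<le> n}. norm (Z p u - Z0 u) < e / 3"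
    by (rule eventually_ball_finite[OF fin], intro ballI tendsto_normD[OF Z_tendsto] divide_pos_pos assms) simp
  with f show ?thesis
  proof eventually_elim
    case (elim p)
    show ?case
    proof
      fix w :: "'k list"
      define u v where "u = take n w" and "v = drop n w"
      have w: "w = u @ v" by (simp add: u_def v_def)
      have u: "norm (Z p u - Z0 u) < e / 3" using elim(2) by (simp add: u_def)
      show "norm (Z p w - Z0 w) < e"
      proof (cases "length w \<le> n")
        case True
        then have "w = u" by (simp add: u_def)
        then show ?thesis using u assms by simp
      next
        case False
        then have l: "length u = n" by (simp add: u_def)
        have "norm (Z p w - Z p u) \<le> A * \<theta> ^ n" "norm (Z0 w - Z0 u) \<le> A * \<theta> ^ n"
          using mobius_family.Z_prefix[OF elim(1), of u v] mobius_family.Z_prefix[OF f0, of u v]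
          unfolding w A_def Z_def Z0_def l by auto
        moreover have e: "Z p w - Z0 w = (Z p w - Z p u) + (Z p u - Z0 u) - (Z0 w - Z0 u)" by simp
        have "norm (Z p w - Z0 w) \<le> norm (Z p w - Z p u) + norm (Z p u - Z0 u) + norm (Z0 w - Z0 u)"
          unfolding e using norm_triangle_ineq4[of "(Z p w - Z p u) + (Z p u - Z0 u)" "Z0 w - Z0 u"]
            norm_triangle_ineq[of "Z p w - Z p u" "Z p u - Z0 u"] by linarith
        ultimately show ?thesis using u n by linarith
      qed
    qed
  qed
qed

lemma Z0_bound: "\<exists>C>0. \<forall>w. norm (Z0 w) \<le> C"
proof (rule ex_family)
  fix m B \<theta> assume f0: "mobius_family (\<lambda>k. of_real (al0 k)) (\<lambda>k. of_real (be0 k)) (\<lambda>k. of_real (ga0 k)) (\<lambda>k. of_real (de0 k)) m B \<theta>"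
  show ?thesis using mobius_family.Z_bounds(2)[OF f0] mobius_family.C1[OF f0]
    unfolding Z0_def by (intro exI[of _ "mobius_family.C m B"]) auto
qed

lemma E_uniform:
  assumes e: "0 < e"
  shows "\<forall>\<^sub>F p in \<Phi>. \<forall>k w. norm (E p k w - E0 k w) < e"
proof -
  obtain C where C: "0 < C" "\<And>w. norm (Z0 w) \<le> C" using Z0_bound by blast
  obtain B where B: "\<And>k. ga0 k < B" using finite_upper by blast
  have B0: "0 < B" using B[of undefined] pos(3)[of undefined] by linarith
  define e1 where "e1 = min 1 (e / (4 * (B + 1)))"
  have e1: "0 < e1" unfolding e1_def using e B0 by simp
  have e1B: "(B + 1) * e1 \<le> e / 4"
  proof -
    have "(B + 1) * e1 \<le> (B + 1) * (e / (4 * (B + 1)))" unfolding e1_def using B0 by (intro mult_left_mono) auto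
    also have "b * (e / (4 * b)) = e / 4" if "0 < b" for b using that by simp
    from this[of "B + 1"] B0 have "(B + 1) * (e / (4 * (B + 1))) = e / 4" by linarith
    finally show ?thesis .
  qed
  define e2 where "e2 = min 1 (e / (4 * C))"
  have e2: "0 < e2" "e2 \<le> 1" "C * e2 \<le> e / 4" using e C unfolding e2_def by (auto simp: min_def field_simps)
  have 1: "\<forall>\<^sub>F p in \<Phi>. \<forall>k. norm (ga p k - of_real (ga0 k)) < e2"
    using e2 by (intro eventually_all_finite tendsto_normD[OF lim(3)])
  have 2: "\<forall>\<^sub>F p in \<Phi>. \<forall>k. norm (de p k - of_real (de0 k)) < e / 4"
    using e by (intro eventually_all_finite tendsto_normD[OF lim(4)]) simp
  from 1 2 Z_uniform[OF e1] show ?thesis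
  proof eventually_elim
    case (elim p)
    show ?case
    proof (intro allI)
      fix k w
      have g: "norm (ga p k) \<le> B + 1"
      proof -
        have "norm (ga p k) \<le> norm (ga p k - of_real (ga0 k)) + norm (of_real (ga0 k) :: complex)"
          using norm_triangle_ineq[of "ga p k - of_real (ga0 k)" "of_real (ga0 k)"] by simp
        then show ?thesis using elim(1)[rule_format, of k] e2(2) B[of k] pos(3)[of k] by simp
      qed
      have "E p k w - E0 k w = ga p k * (Z p w - Z0 w) + (ga p k - of_real (ga0 k)) * Z0 w + (de p k - of_real (de0 k))"
        by (simp add: E_def E0_def algebra_simps)
      also have "norm \<dots> \<le> (B + 1) * e1 + e2 * C + e / 4"
      proof (intro order_trans[OF norm_triangle_ineq] add_mono)
        show "norm (ga p k * (Z p w - Z0 w)) \<le> (B + 1) * e1"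
          unfolding norm_mult using g elim(3) B0 by (intro mult_mono) (auto simp: less_imp_le)
        show "norm ((ga p k - of_real (ga0 k)) * Z0 w) \<le> e2 * C"
          unfolding norm_mult using C elim(1) e2 by (intro mult_mono) (auto simp: less_imp_le)
        show "norm (de p k - of_real (de0 k)) \<le> e / 4" using elim(2) by (simp add: less_imp_le)
      qed
      also have "\<dots> < e" using e1B e2(3) e by (simp add: mult.commute)
      finally show "norm (E p k w - E0 k w) < e" .
    qed
  qed
qed

lemma Ln_lipschitz:
  assumes "0 < \<delta>" "\<delta> \<le> Re x" "\<delta> \<le> Re y"
  shows "norm (Ln x - Ln y) \<le> 1 / \<delta> * norm (x - y)"
proof (rule field_differentiable_bound[of "{z. \<delta> \<le> Re z}" Ln inverse])
  show "convex {z. \<delta> \<le> Re z}" using convex_halfspace_Re_ge[of \<delta>] by simp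
  fix z assume z: "z \<in> {z. \<delta> \<le> Re z}"
  then have zr: "z \<notin> \<real>\<^sub>\<le>\<^sub>0" using assms by (auto simp: complex_nonpos_Reals_iff)
  show "(Ln has_field_derivative inverse z) (at z within {z. \<delta> \<le> Re z})"
    by (rule has_field_derivative_at_within[OF has_field_derivative_Ln[OF zr]])
  have "\<delta> \<le> norm z" using z complex_Re_le_cmod[of z] by auto
  then have "1 / norm z \<le> 1 / \<delta>" using assms(1) by (intro frac_le) auto
  then show "norm (inverse z) \<le> 1 / \<delta>" by (simp add: norm_inverse inverse_eq_divide norm_divide)
qed (use assms in auto)

lemma E_data:
  "\<exists>\<delta> S. 0 < \<delta> \<and> 0 < S \<and> (\<forall>k w. 2 * \<delta> \<le> Re (E0 k w)) \<and> (\<forall>k w. norm (Ln (E0 k w)) \<le> S) \<and>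
    (\<forall>\<^sub>F p in \<Phi>. \<forall>k w. \<delta> \<le> Re (E p k w))"
proof -
  obtain \<delta>' where d: "0 < \<delta>'" "\<And>k. \<delta>' < de0 k" using finite_pos_lower[of de0] pos(4) by blast
  obtain C where C: "0 < C" "\<And>w. norm (Z0 w) \<le> C" using Z0_bound by blast
  obtain B where B: "\<And>k. max (ga0 k) (de0 k) < B" using finite_upper[of "\<lambda>k. max (ga0 k) (de0 k)"] by blast
  have B0: "0 < B" using B[of undefined] pos(3)[of undefined] by linarith
  have lo: "\<delta>' \<le> Re (E0 k w)" for k w using d(2)[of k] E0_real(2)[of k w] by linarith
  have up: "Re (E0 k w) \<le> B * C + B" for k w
  proof -
    have "norm (E0 k w) \<le> B * C + B" unfolding E0_def using B[of k] pos(3,4)[of k] C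
      by (intro order_trans[OF norm_triangle_ineq] add_mono) (auto simp: norm_mult intro!: mult_mono)
    then show ?thesis using complex_Re_le_cmod order_trans by blast
  qed
  have S: "norm (Ln (E0 k w)) \<le> \<bar>ln \<delta>'\<bar> + \<bar>ln (B * C + B)\<bar> + 1" for k w
  proof -
    define x where "x = Re (E0 k w)"
    have x: "E0 k w = of_real x" "\<delta>' \<le> x" "x \<le> B * C + B" using E0_real(1)[of k w] lo up by (auto simp: x_def)
    have "Ln (E0 k w) = of_real (ln x)" using x d by (simp add: Ln_of_real)
    moreover have "ln \<delta>' \<le> ln x" "ln x \<le> ln (B * C + B)" using x d by auto
    ultimately show ?thesis by simp
  qed
  have "\<forall>\<^sub>F p in \<Phi>. \<forall>k w. norm (E p k w - E0 k w) < \<delta>' / 2" using d by (intro E_uniform) simp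
  then have ev: "\<forall>\<^sub>F p in \<Phi>. \<forall>k w. \<delta>' / 2 \<le> Re (E p k w)"
  proof eventually_elim
    case (elim p)
    show ?case
    proof (intro allI)
      fix k w
      have "\<bar>Re (E p k w - E0 k w)\<bar> < \<delta>' / 2" using elim abs_Re_le_cmod le_less_trans by blast
      then have "Re (E0 k w) - Re (E p k w) < \<delta>' / 2" unfolding minus_complex.sel by linarith
      then show "\<delta>' / 2 \<le> Re (E p k w)" using lo[of k w] by linarith
    qed
  qed
  show ?thesis
    using d lo S ev by (intro exI[of _ "\<delta>' / 2"] exI[of _ "\<bar>ln \<delta>'\<bar> + \<bar>ln (B * C + B)\<bar> + 1"]) simp
qed

lemma \<Lambda>_uniform:
  assumes e: "0 < e"
  shows "\<forall>\<^sub>F p in \<Phi>. \<forall>k w. norm (\<Lambda> p k w - \<Lambda>0 k w) < e"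
proof -
  obtain \<delta> S where ES: "0 < \<delta>" "0 < S" "\<And>k w. 2 * \<delta> \<le> Re (E0 k w)" "\<And>k w. norm (Ln (E0 k w)) \<le> S"
    "\<forall>\<^sub>F p in \<Phi>. \<forall>k w. \<delta> \<le> Re (E p k w)" using E_data by blast
  define A where "A = \<bar>a0\<bar> + 1"
  have A: "0 < A" by (simp add: A_def)
  have 1: "\<forall>\<^sub>F p in \<Phi>. norm (a p - of_real a0) < min 1 (e / (4 * S))"
    using e ES(2) by (intro tendsto_normD[OF lima]) simp
  have 2: "\<forall>\<^sub>F p in \<Phi>. \<forall>k. norm (b p * Ln (D p k) - of_real b0 * Ln (of_real (D0 k))) < e / 4"
  proof (rule eventually_all_finite)
    fix k
    have "((\<lambda>p. b p * Ln (D p k)) \<longlongrightarrow> of_real b0 * Ln (of_real (D0 k))) \<Phi>"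
      using lim(5)[of k] limb pos(5)[of k] by (intro tendsto_intros) auto
    then show "\<forall>\<^sub>F p in \<Phi>. norm (b p * Ln (D p k) - of_real b0 * Ln (of_real (D0 k))) < e / 4"
      using e by (intro tendsto_normD) simp_all
  qed
  have 3: "\<forall>\<^sub>F p in \<Phi>. \<forall>k w. norm (E p k w - E0 k w) < \<delta> * (e / (4 * A))"
    using e ES A by (intro E_uniform) simp
  from 1 2 3 ES(5) show ?thesis
  proof eventually_elim
    case (elim p)
    show ?case
    proof (intro allI)
      fix k w
      have a: "norm (a p) \<le> A"
        using norm_triangle_ineq[of "a p - of_real a0" "of_real a0"] elim(1) by (simp add: A_def)
      have L: "norm (Ln (E p k w) - Ln (E0 k w)) \<le> e / (4 * A)"
      proof -
        have "\<delta> \<le> Re (E0 k w)" using ES(1) ES(3)[of k w] by linarith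
        then have "norm (Ln (E p k w) - Ln (E0 k w)) \<le> 1 / \<delta> * norm (E p k w - E0 k w)"
          using elim(4) ES(1) by (intro Ln_lipschitz) auto
        also have "\<dots> \<le> 1 / \<delta> * (\<delta> * (e / (4 * A)))" using elim(3) ES(1) by (intro mult_left_mono) (auto simp: less_imp_le)
        finally show ?thesis using ES(1) by simp
      qed
      have "\<Lambda> p k w - \<Lambda>0 k w = a p * (Ln (E p k w) - Ln (E0 k w)) + (a p - of_real a0) * Ln (E0 k w)
           + (b p * Ln (D p k) - of_real b0 * Ln (of_real (D0 k)))"
        by (simp add: \<Lambda>_def \<Lambda>0_def algebra_simps)
      also have "norm \<dots> \<le> A * (e / (4 * A)) + (e / (4 * S)) * S + e / 4"
      proof (intro order_trans[OF norm_triangle_ineq] add_mono)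
        show "norm (a p * (Ln (E p k w) - Ln (E0 k w))) \<le> A * (e / (4 * A))"
          unfolding norm_mult using a L A by (intro mult_mono) auto
        show "norm ((a p - of_real a0) * Ln (E0 k w)) \<le> e / (4 * S) * S"
          unfolding norm_mult using elim(1) ES e by (intro mult_mono) auto
        show "norm (b p * Ln (D p k) - of_real b0 * Ln (of_real (D0 k))) \<le> e / 4"
          using elim(2) by (simp add: less_imp_le)
      qed
      also have "\<dots> < e" using A ES(2) e by simp
      finally show "norm (\<Lambda> p k w - \<Lambda>0 k w) < e" .
    qed
  qed
qed

lemma exp_lipschitz_unit:
  assumes "norm x \<le> 1" "norm y \<le> 1"
  shows "norm (exp x - exp y) \<le> 3 * norm (x - y :: complex)"
proof (rule field_differentiable_bound[of "cball 0 1" exp exp])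
  fix z :: complex assume "z \<in> cball 0 1"
  then have "norm (exp z) \<le> exp 1" using complex_Re_le_cmod[of z] by (simp add: order_trans)
  also have "exp (1::real) \<le> 3" by (rule exp_le)
  finally show "norm (exp z) \<le> 3" .
qed (use assms in \<open>auto intro!: derivative_eq_intros\<close>)

lemma \<Lambda>0_real: "\<Lambda>0 k w = of_real (Re (\<Lambda>0 k w))"
proof -
  have "0 < Re (E0 k w)" using E0_real(2)[of k w] pos(4)[of k] by linarith
  then have "Ln (E0 k w) = of_real (ln (Re (E0 k w)))" by (subst E0_real(1)) (rule Ln_of_real)
  moreover have "Ln (of_real (D0 k)) = of_real (ln (D0 k))" using pos(5) by (rule Ln_of_real)
  ultimately show ?thesis unfolding \<Lambda>0_def by simp
qed

definition U where "U p n = ((transfer (#) (\<lambda>k w. exp (\<Lambda> p k w))) ^^ n) (\<lambda>_. 1)"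

text \<open>\<open>perturbed_transfer\<close> is applied to words with the prepending maps as
  branches, the weight \<open>exp \<Lambda>0\<close> and the relative error
  \<open>exp (\<Lambda> - \<Lambda>0) - 1\<close>. Its constants depend on \<open>\<theta>'\<close>
  and \<open>\<kappa>\<close> alone, so \<open>\<epsilon>\<close> can be fixed before
  \<open>p\<close>, and \<open>c\<close> and \<open>C\<close> serve all \<open>p\<close> near the
  limit.\<close>

theorem ratio_bounds:
  "\<exists>c C. 0 < c \<and> (\<forall>\<^sub>F p in \<Phi>. (\<forall>k w. 0 < Re (Z p w) \<and> 0 < Re (E p k w)) \<and> (\<forall>k. 0 < Re (D p k)) \<and>
     (\<forall>n w. U p n w \<noteq> 0 \<and> c \<le> Re (U p (Suc n) w / U p n w) \<and> norm (U p (Suc n) w / U p n w) \<le> C))"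
proof -
  obtain m B \<theta> where f0: "mobius_family (\<lambda>k. of_real (al0 k)) (\<lambda>k. of_real (be0 k)) (\<lambda>k. of_real (ga0 k)) (\<lambda>k. of_real (de0 k)) m B \<theta>"
    and f: "\<forall>\<^sub>F p in \<Phi>. mobius_family (al p) (be p) (ga p) (de p) m B \<theta>" by (rule ex_family)
  have B0: "0 < B" by (rule mobius_family.B0[OF f0])
  define cc CC where "cc = mobius_family.c m B" and "CC = mobius_family.C m B"
  have cc: "0 < cc" "1 \<le> CC" using mobius_family.c0[OF f0] mobius_family.C1[OF f0] by (simp_all add: cc_def CC_def)
  obtain \<delta> S where ES: "0 < \<delta>" "0 < S" "\<And>k w. 2 * \<delta> \<le> Re (E0 k w)" "\<And>k w. norm (Ln (E0 k w)) \<le> S"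
    "\<forall>\<^sub>F p in \<Phi>. \<forall>k w. \<delta> \<le> Re (E p k w)" using E_data by blast
  have \<theta>: "0 \<le> \<theta>" "\<theta> < 1" using f0 by (auto simp: mobius_family_def)
  define A where "A = (\<bar>a0\<bar> + 1) * (1 / \<delta> * (B * CC))"
  have A0: "0 < A" unfolding A_def using ES B0 cc by (intro mult_pos_pos) auto
  \<comment> \<open>Each of the two hyperbolic distances is at most \<open>2 * CC / cc\<close>, so
    dividing their sum by \<open>\<Delta>\<close> gives at most 1.\<close>
  define \<Delta> where "\<Delta> = 4 * CC / cc"
  have \<Delta>0: "0 < \<Delta>" unfolding \<Delta>_def using cc by simp
  define \<kappa> \<theta>' where "\<kappa> = A * \<Delta>" and "\<theta>' = sqrt \<theta>"
  have \<kappa>: "0 < \<kappa>" unfolding \<kappa>_def using A0 \<Delta>0 by simp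
  have \<theta>': "0 \<le> \<theta>'" "\<theta>' < 1" using \<theta> by (auto simp: \<theta>'_def)
  define K where "K = perturbed_transfer.K \<theta>' \<kappa>"
  define q where "q = 12 * (perturbed_transfer.C1 \<theta>' \<kappa>) * (perturbed_transfer.\<rho> \<theta>' \<kappa>)\<^sup>2"
  define \<epsilon> where "\<epsilon> = 1 / (\<bar>q\<bar> + 1)"
  have \<epsilon>0: "0 < \<epsilon>" by (simp add: \<epsilon>_def)
  have \<epsilon>q: "\<epsilon> * q \<le> 1" unfolding \<epsilon>_def by (simp add: pos_divide_le_eq add_nonneg_pos)
  \<comment> \<open>\<open>exp\<close> has Lipschitz constant 3 on the unit disc, whence
    \<open>\<epsilon> / 3\<close> for the supremum of the error. A difference \<open>x\<close> of
    two values of \<open>\<eta>\<close> satisfies both \<open>x \<le> 2 * e1\<close> and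
    \<open>x \<le> \<kappa> * d^2\<close>; multiplying,
    \<open>(3 * x)^2 \<le> 18 * e1 * \<kappa> * d^2\<close>, which is to be at most
    \<open>(\<epsilon> * d)^2\<close>.\<close>
  define e1 where "e1 = min 1 (min (\<epsilon> / 3) (\<epsilon>\<^sup>2 / (18 * \<kappa>)))"
  have e1: "0 < e1" "e1 \<le> 1" "3 * e1 \<le> \<epsilon>" "18 * e1 * \<kappa> \<le> \<epsilon>\<^sup>2"
  proof -
    have "0 < \<epsilon>\<^sup>2 / (18 * \<kappa>)" using \<epsilon>0 \<kappa> by simp
    then show "0 < e1" "e1 \<le> 1" "3 * e1 \<le> \<epsilon>" using \<epsilon>0 by (auto simp: e1_def min_def)
    have "e1 \<le> \<epsilon>\<^sup>2 / (18 * \<kappa>)" unfolding e1_def by simp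
    then have "e1 * (18 * \<kappa>) \<le> \<epsilon>\<^sup>2" using \<kappa> by (simp add: pos_le_divide_eq)
    then show "18 * e1 * \<kappa> \<le> \<epsilon>\<^sup>2" by (simp add: mult_ac)
  qed
  define g where "g k w = exp (Re (\<Lambda>0 k w))" for k w
  obtain S1 where S1: "\<And>k. \<bar>b0\<bar> * norm (Ln (of_real (D0 k) :: complex)) < S1"
    using finite_upper[of "\<lambda>k. \<bar>b0\<bar> * norm (Ln (of_real (D0 k) :: complex))"] by blast
  define S2 where "S2 = \<bar>a0\<bar> * S + S1"
  have \<Lambda>S: "\<bar>Re (\<Lambda>0 k w)\<bar> \<le> S2" for k w
  proof -
    have "\<bar>Re (\<Lambda>0 k w)\<bar> \<le> norm (\<Lambda>0 k w)" by (rule abs_Re_le_cmod)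
    also have "\<dots> \<le> \<bar>a0\<bar> * norm (Ln (E0 k w)) + \<bar>b0\<bar> * norm (Ln (of_real (D0 k) :: complex))"
      unfolding \<Lambda>0_def by (rule order_trans[OF norm_triangle_ineq]) (simp add: norm_mult)
    also have "\<dots> \<le> S2" unfolding S2_def using ES(4)[of k w] S1[of k] by (intro add_mono mult_left_mono) auto
    finally show ?thesis .
  qed
  have gS: "exp (- S2) \<le> g k w" "g k w \<le> exp S2" for k w
    using \<Lambda>S[of k w] unfolding g_def by auto
  define N where "N = real (card (UNIV :: 'k set))"
  have N: "1 \<le> N" unfolding N_def by (simp add: Suc_le_eq card_gt_0_iff)
  have \<Gamma>: "exp (- S2) \<le> (\<Sum>k\<in>UNIV. g k w)" "(\<Sum>k\<in>UNIV. g k w) \<le> N * exp S2" for w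
  proof -
    have "N * exp (- S2) \<le> (\<Sum>k\<in>UNIV. g k w)" unfolding N_def using gS(1) by (intro sum_bounded_below) auto
    moreover have "1 * exp (- S2) \<le> N * exp (- S2)" using N by (intro mult_right_mono) auto
    ultimately show "exp (- S2) \<le> (\<Sum>k\<in>UNIV. g k w)" by linarith
    show "(\<Sum>k\<in>UNIV. g k w) \<le> N * exp S2" unfolding N_def using gS(2) by (intro sum_bounded_above) auto
  qed
  define c C where "c = exp (- S2) * exp (- K) / 2" and "C = 4 * (N * exp S2) * exp K"
  have la: "\<forall>\<^sub>F p in \<Phi>. norm (a p) < \<bar>a0\<bar> + 1"
    using order_tendstoD(2)[OF tendsto_norm[OF lima], of "\<bar>a0\<bar> + 1"] by simp
  have lD: "\<forall>\<^sub>F p in \<Phi>. \<forall>k. 0 < Re (D p k)"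
    using pos(5) by (intro eventually_all_finite order_tendstoD(1)[OF tendsto_Re[OF lim(5)]]) simp
  have "\<forall>\<^sub>F p in \<Phi>. (\<forall>k w. 0 < Re (Z p w) \<and> 0 < Re (E p k w)) \<and> (\<forall>k. 0 < Re (D p k)) \<and>
     (\<forall>n w. U p n w \<noteq> 0 \<and> c \<le> Re (U p (Suc n) w / U p n w) \<and> norm (U p (Suc n) w / U p n w) \<le> C)"
    using f ES(5) \<Lambda>_uniform[OF e1(1)] la lD
  proof eventually_elim
    case (elim p)
    \<comment> \<open>The perturbed log-weight is Lipschitz for the orbit of \<open>p\<close>, the
      unperturbed one for the limit orbit; their difference is controlled only by the two distances
      together.\<close>
    define h where "h w w' = hdist (Z p w) (Z p w')" for w w'
    define h0 where "h0 w w' = hdist (Z0 w) (Z0 w')" for w w'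
    have hn: "0 \<le> h w w'" "0 \<le> h0 w w'" for w w'
      using mobius_family.hdist_nonneg[OF elim(1)] mobius_family.hdist_nonneg[OF f0]
      by (auto simp: h_def h0_def Z_def Z0_def)
    have hb: "h w w' \<le> 2 * CC / cc" "h0 w w' \<le> 2 * CC / cc" for w w'
      using mobius_family.hdist_Z_bound[OF elim(1)] mobius_family.hdist_Z_bound[OF f0]
      by (auto simp: h_def h0_def Z_def Z0_def CC_def cc_def)
    have hc: "h (k # w) (k # w') \<le> \<theta> * h w w'" "h0 (k # w) (k # w') \<le> \<theta> * h0 w w'" for k w w'
      using mobius_family.hdist_Z_Cons[OF elim(1)] mobius_family.hdist_Z_Cons[OF f0]
      by (auto simp: h_def h0_def Z_def Z0_def)
    have hs: "h w w' = h w' w" "h0 w w' = h0 w' w" for w w'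
      by (auto simp: h_def h0_def hdist_def norm_minus_commute mult.commute)
    \<comment> \<open>The square root trades half of the Lipschitz exponent for smallness of the Lipschitz constant
      of the perturbation \<open>\<eta>\<close>, of which only the supremum norm is known to be small.\<close>
    define d where "d w w' = sqrt ((h w w' + h0 w w') / \<Delta>)" for w w'
    have d2: "\<Delta> * (d w w')\<^sup>2 = h w w' + h0 w w'" for w w'
      unfolding d_def using hn[of w w'] \<Delta>0 by simp
    have d01: "0 \<le> d w w'" "d w w' \<le> 1" for w w'
      unfolding d_def using hn[of w w'] hb[of w w'] \<Delta>0 cc by (auto simp: \<Delta>_def divide_simps distrib_right)
    have dd: "(d w w')\<^sup>2 \<le> d w w'" for w w'
      using d01[of w w'] by (simp add: power2_eq_square mult_left_le)
    have dc: "d (k # w) (k # w') \<le> \<theta>' * d w w'" for k w w'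
    proof -
      have "(h (k # w) (k # w') + h0 (k # w) (k # w')) / \<Delta> \<le> \<theta> * ((h w w' + h0 w w') / \<Delta>)"
        using hc[of k w w'] \<Delta>0 by (simp add: divide_right_mono distrib_left)
      then have "d (k # w) (k # w') \<le> sqrt (\<theta> * ((h w w' + h0 w w') / \<Delta>))"
        unfolding d_def by (rule real_sqrt_le_mono)
      then show ?thesis by (simp only: real_sqrt_mult d_def \<theta>'_def)
    qed
    have Ep: "\<delta> \<le> Re (E p k w)" for k w using elim(2) by blast
    have E0p: "\<delta> \<le> Re (E0 k w)" for k w using ES(1) ES(3)[of k w] by linarith
    have L1: "norm (\<Lambda> p k w - \<Lambda> p k w') \<le> A * h w w'" for k w w'
    proof -
      have "norm (\<Lambda> p k w - \<Lambda> p k w') = norm (a p) * norm (Ln (E p k w) - Ln (E p k w'))"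
        by (simp add: \<Lambda>_def norm_mult[symmetric] algebra_simps)
      also have "norm (Ln (E p k w) - Ln (E p k w')) \<le> 1 / \<delta> * norm (E p k w - E p k w')"
        by (rule Ln_lipschitz[OF ES(1) Ep Ep])
      also have "norm (E p k w - E p k w') = norm (ga p k) * norm (Z p w - Z p w')"
        by (simp add: E_def norm_mult[symmetric] algebra_simps)
      also have "\<dots> \<le> B * (CC * h w w')"
        using mobius_family.bd(3)[OF elim(1), of k] mobius_family.norm_le_hdist[OF elim(1), of w w'] B0
        unfolding h_def Z_def CC_def by (intro mult_mono) auto
      finally have "norm (\<Lambda> p k w - \<Lambda> p k w') \<le> norm (a p) * (1 / \<delta> * (B * (CC * h w w')))"
        using ES(1) by (simp add: mult_left_mono divide_right_mono)
      also have "\<dots> \<le> (\<bar>a0\<bar> + 1) * (1 / \<delta> * (B * (CC * h w w')))"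
        using elim(4) hn ES(1) B0 cc by (intro mult_right_mono) auto
      finally show ?thesis by (simp add: A_def mult.assoc)
    qed
    have L0: "norm (\<Lambda>0 k w - \<Lambda>0 k w') \<le> A * h0 w w'" for k w w'
    proof -
      have "norm (\<Lambda>0 k w - \<Lambda>0 k w') = \<bar>a0\<bar> * norm (Ln (E0 k w) - Ln (E0 k w'))"
      proof -
        have "\<Lambda>0 k w - \<Lambda>0 k w' = of_real a0 * (Ln (E0 k w) - Ln (E0 k w'))" by (simp add: \<Lambda>0_def algebra_simps)
        then show ?thesis by (simp add: norm_mult)
      qed
      also have "norm (Ln (E0 k w) - Ln (E0 k w')) \<le> 1 / \<delta> * norm (E0 k w - E0 k w')"
        by (rule Ln_lipschitz[OF ES(1) E0p E0p])
      also have "norm (E0 k w - E0 k w') = norm (of_real (ga0 k) :: complex) * norm (Z0 w - Z0 w')"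
      proof -
        have "E0 k w - E0 k w' = of_real (ga0 k) * (Z0 w - Z0 w')" by (simp add: E0_def algebra_simps)
        then show ?thesis by (simp only: norm_mult)
      qed
      also have "\<dots> \<le> B * (CC * h0 w w')"
        using mobius_family.bd(3)[OF f0, of k] mobius_family.norm_le_hdist[OF f0, of w w'] B0
        unfolding h0_def Z0_def CC_def by (intro mult_mono) auto
      finally have "norm (\<Lambda>0 k w - \<Lambda>0 k w') \<le> \<bar>a0\<bar> * (1 / \<delta> * (B * (CC * h0 w w')))"
        using ES(1) by (simp add: mult_left_mono divide_right_mono)
      also have "\<dots> \<le> (\<bar>a0\<bar> + 1) * (1 / \<delta> * (B * (CC * h0 w w')))"
        using hn ES(1) B0 cc by (intro mult_right_mono) auto
      finally show ?thesis by (simp add: A_def mult.assoc)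
    qed
    define \<eta> where "\<eta> k w = \<Lambda> p k w - \<Lambda>0 k w" for k w
    have \<eta>1: "norm (\<eta> k w) \<le> e1" for k w using elim(3) by (simp add: \<eta>_def less_imp_le)
    have \<eta>d: "norm (\<eta> k w - \<eta> k w') \<le> \<kappa> * (d w w')\<^sup>2" for k w w'
    proof -
      have e: "\<eta> k w - \<eta> k w' = (\<Lambda> p k w - \<Lambda> p k w') - (\<Lambda>0 k w - \<Lambda>0 k w')" by (simp add: \<eta>_def)
      have "norm (\<eta> k w - \<eta> k w') \<le> A * h w w' + A * h0 w w'"
        unfolding e using norm_triangle_ineq4[of "\<Lambda> p k w - \<Lambda> p k w'" "\<Lambda>0 k w - \<Lambda>0 k w'"] L1[of k w w'] L0[of k w w'] by linarith
      also have "\<dots> = A * (\<Delta> * (d w w')\<^sup>2)" unfolding d2 by (simp add: distrib_left)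
      finally show ?thesis by (simp add: \<kappa>_def)
    qed
    have \<eta>3: "3 * norm (\<eta> k w - \<eta> k w') \<le> \<epsilon> * d w w'" for k w w'
    proof -
      define x where "x = norm (\<eta> k w - \<eta> k w')"
      have "x \<le> 2 * e1" unfolding x_def using norm_triangle_ineq4[of "\<eta> k w" "\<eta> k w'"] \<eta>1[of k w] \<eta>1[of k w'] by linarith
      then have "x * x \<le> (2 * e1) * (\<kappa> * (d w w')\<^sup>2)"
        using \<eta>d[of k w w'] e1(1) unfolding x_def by (intro mult_mono) auto
      then have "(3 * x)\<^sup>2 \<le> (18 * e1 * \<kappa>) * (d w w')\<^sup>2" by (simp add: power2_eq_square mult_ac)
      also have "\<dots> \<le> \<epsilon>\<^sup>2 * (d w w')\<^sup>2" using e1(4) by (intro mult_right_mono) auto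
      finally have "(3 * x)\<^sup>2 \<le> (\<epsilon> * d w w')\<^sup>2" by (simp add: power_mult_distrib)
      then show ?thesis unfolding x_def by (rule power2_le_imp_le) (use \<epsilon>0 d01 in simp)
    qed
    define H where "H k w = exp (\<eta> k w) - 1" for k w
    interpret pt: perturbed_transfer "(#)" d g H \<theta>' \<kappa> \<epsilon>
    proof
      fix w w' :: "'k list" and k
      show "0 \<le> d w w'" "d w w' \<le> 1" by (rule d01)+
      show "d w w' = d w' w" using hs by (simp add: d_def)
      show "d (k # w) (k # w') \<le> \<theta>' * d w w'" by (rule dc)
      show "0 < g k w" by (simp add: g_def)
      show "g k w \<le> exp (\<kappa> * d w w') * g k w'"
      proof -
        have "Re (\<Lambda>0 k w) - Re (\<Lambda>0 k w') \<le> norm (\<Lambda>0 k w - \<Lambda>0 k w')" using complex_Re_le_cmod[of "\<Lambda>0 k w - \<Lambda>0 k w'"] by simp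
        also have "\<dots> \<le> A * (h w w' + h0 w w')" using L0[of k w w'] hn[of w w'] A0 by (smt (verit) mult_left_mono)
        also have "\<dots> = \<kappa> * (d w w')\<^sup>2" unfolding d2[symmetric] by (simp add: \<kappa>_def)
        also have "\<dots> \<le> \<kappa> * d w w'" using dd \<kappa> by (intro mult_left_mono) auto
        finally have "Re (\<Lambda>0 k w) \<le> \<kappa> * d w w' + Re (\<Lambda>0 k w')" by simp
        then show ?thesis unfolding g_def exp_add[symmetric] by simp
      qed
      have n1: "norm (\<eta> k w) \<le> 1" for w using \<eta>1[of k w] e1(2) by linarith
      have "norm (H k w) \<le> 3 * norm (\<eta> k w - 0)" unfolding H_def using exp_lipschitz_unit[OF n1, of 0 w] by simp
      then show "norm (H k w) \<le> \<epsilon>" using \<eta>1[of k w] e1(3) by simp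
      have "norm (H k w - H k w') \<le> 3 * norm (\<eta> k w - \<eta> k w')" unfolding H_def using exp_lipschitz_unit[OF n1 n1, of w w'] by simp
      then show "norm (H k w - H k w') \<le> \<epsilon> * d w w'" using \<eta>3[of k w w'] by linarith
    qed (use \<theta>' \<kappa> \<epsilon>0 in auto)
    have GW: "pt.G = (\<lambda>k w. exp (\<Lambda> p k w))"
    proof (intro ext)
      fix k w
      have "of_real (g k w) = exp (\<Lambda>0 k w)" unfolding g_def by (subst \<Lambda>0_real) (simp add: exp_of_real)
      then show "pt.G k w = exp (\<Lambda> p k w)"
        unfolding pt.G_def H_def \<eta>_def by (simp add: exp_add[symmetric])
    qed
    have sm: "12 * (\<epsilon> * pt.C1) * pt.\<rho>\<^sup>2 \<le> 1" using \<epsilon>q unfolding q_def by (simp add: mult_ac)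
    have U: "U p n = ((transfer (#) pt.G) ^^ n) (\<lambda>_. 1)" for n unfolding U_def GW ..
    note R = pt.ratio_of_iterates[OF sm, folded U]
    have KK: "pt.K = K" by (simp add: K_def)
    have "0 < Re (Z p w)" for w using mobius_family.Z_pos[OF elim(1)] unfolding Z_def .
    moreover have "0 < Re (E p k w)" for k w using Ep[of k w] ES(1) by linarith
    moreover have "c \<le> Re (U p (Suc n) w / U p n w)" for n w
    proof -
      have "c \<le> (\<Sum>k\<in>UNIV. g k w) * exp (- K) / 2" unfolding c_def using \<Gamma>(1)[of w] by (intro divide_right_mono mult_right_mono) auto
      then show ?thesis using R(2)[of w n] unfolding KK by linarith
    qed
    moreover have "norm (U p (Suc n) w / U p n w) \<le> C" for n w
    proof -
      have "4 * (\<Sum>k\<in>UNIV. g k w) * exp K \<le> C" unfolding C_def using \<Gamma>(2)[of w] by (intro mult_right_mono mult_left_mono) auto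
      then show ?thesis using R(3)[of n w] unfolding KK by linarith
    qed
    ultimately show ?case using elim(5) R(1) by blast
  qed
  moreover have "0 < c" by (simp add: c_def)
  ultimately show ?thesis by blast
qed

end

subsection \<open>Singular values and the pressure\<close>

lemma norm_mat2_sq: "(norm (A :: real^2^2))\<^sup>2 = (A$1$1)\<^sup>2 + (A$1$2)\<^sup>2 + (A$2$1)\<^sup>2 + (A$2$2)\<^sup>2"
  unfolding norm_vec_def L2_set_def by (simp add: sum_2)

lemma norm_vec2_sq: "(norm (x :: real^2))\<^sup>2 = (x$1)\<^sup>2 + (x$2)\<^sup>2"
  unfolding norm_vec_def L2_set_def by (simp add: sum_2)

lemma cauchy2: "(a * b + c * d)\<^sup>2 \<le> (a\<^sup>2 + c\<^sup>2) * (b\<^sup>2 + d\<^sup>2)" for a b c d :: real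
proof -
  have "(a\<^sup>2 + c\<^sup>2) * (b\<^sup>2 + d\<^sup>2) - (a * b + c * d)\<^sup>2 = (a * d - c * b)\<^sup>2" by (simp add: power2_eq_square algebra_simps)
  then show ?thesis using zero_le_power2[of "a * d - c * b"] by linarith
qed

lemma matrix_mult_2: "((A :: real^2^2) ** B) $ i $ j = A$i$1 * B$1$j + A$i$2 * B$2$j"
  by (simp add: matrix_matrix_mult_def sum_2)

lemma matrix_vector_mult_2: "((A :: real^2^2) *v x) $ i = A$i$1 * x$1 + A$i$2 * x$2"
  by (simp add: matrix_vector_mult_def sum_2)

lemma norm_matrix_mult_le: "norm ((A :: real^2^2) ** (B :: real^2^2)) \<le> norm A * norm B"
proof (rule power2_le_imp_le)
  define r q where "r i = (A$i$1)\<^sup>2 + (A$i$2)\<^sup>2" and "q j = (B$1$j)\<^sup>2 + (B$2$j)\<^sup>2" for i j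
  have c: "((A ** B)$i$j)\<^sup>2 \<le> r i * q j" for i j
    unfolding matrix_mult_2 r_def q_def by (rule cauchy2)
  have "(norm (A ** B))\<^sup>2 \<le> r 1 * q 1 + r 1 * q 2 + r 2 * q 1 + r 2 * q 2"
    unfolding norm_mat2_sq[of "A ** B"] by (intro add_mono c)
  also have "\<dots> = (r 1 + r 2) * (q 1 + q 2)" by (simp add: algebra_simps)
  also have "\<dots> = (norm A * norm B)\<^sup>2" unfolding power_mult_distrib norm_mat2_sq r_def q_def
    by (simp only: add.assoc add.commute add.left_commute)
  finally show "(norm (A ** B))\<^sup>2 \<le> (norm A * norm B)\<^sup>2" .
qed simp

lemma norm_matrix_vector_le: "norm ((A :: real^2^2) *v x) \<le> norm A * norm x"
proof (rule power2_le_imp_le)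
  define r q where "r i = (A$i$1)\<^sup>2 + (A$i$2)\<^sup>2" and "q = (x$1)\<^sup>2 + (x$2)\<^sup>2" for i
  have c: "((A *v x)$i)\<^sup>2 \<le> r i * q" for i
    unfolding matrix_vector_mult_2 r_def q_def by (rule cauchy2)
  have "(norm (A *v x))\<^sup>2 \<le> r 1 * q + r 2 * q"
    unfolding norm_vec2_sq[of "A *v x"] by (intro add_mono c)
  also have "\<dots> = (r 1 + r 2) * q" by (simp add: algebra_simps)
  also have "\<dots> = (norm A * norm x)\<^sup>2" unfolding power_mult_distrib norm_mat2_sq norm_vec2_sq r_def q_def by simp
  finally show "(norm (A *v x))\<^sup>2 \<le> (norm A * norm x)\<^sup>2" .
qed simp

lemma det_le_norm_sq: "2 * \<bar>det (A :: real^2^2)\<bar> \<le> (norm A)\<^sup>2"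
proof -
  have "(norm A)\<^sup>2 - 2 * det A = (A$1$1 - A$2$2)\<^sup>2 + (A$1$2 + A$2$1)\<^sup>2"
    "(norm A)\<^sup>2 + 2 * det A = (A$1$1 + A$2$2)\<^sup>2 + (A$1$2 - A$2$1)\<^sup>2"
    unfolding norm_mat2_sq det_2 by (simp_all add: power2_eq_square algebra_simps)
  then have "0 \<le> (norm A)\<^sup>2 - 2 * det A" "0 \<le> (norm A)\<^sup>2 + 2 * det A" by simp_all
  then show ?thesis by linarith
qed

text \<open>This is the characteristic equation of the Gram matrix, whose trace is the squared
  Frobenius norm and whose determinant is \<open>(det A)^2\<close>.\<close>

lemma gram_eigenvalues_eq:
  "gram_eigenvalues A = {l. l\<^sup>2 - (norm A)\<^sup>2 * l + (det A)\<^sup>2 = 0}"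
proof -
  define G where "G = transpose A ** A"
  have G: "G$i$j = A$1$i * A$1$j + A$2$i * A$2$j" for i j
    unfolding G_def matrix_mult_2 by (simp add: transpose_def)
  have "(\<exists>v. v \<noteq> 0 \<and> G *v v = l *\<^sub>R v) \<longleftrightarrow> l\<^sup>2 - (norm A)\<^sup>2 * l + (det A)\<^sup>2 = 0" for l
  proof -
    have "G *v v = l *\<^sub>R v \<longleftrightarrow> (G - mat l) *v v = 0" for v
    proof -
      have "mat l *v v = l *\<^sub>R v" by (simp add: vec_eq_iff matrix_vector_mult_2 mat_def forall_2)
      then show ?thesis by (simp add: matrix_vector_mult_diff_rdistrib)
    qed
    moreover have "det (G - mat l) \<noteq> 0 \<longleftrightarrow> (\<forall>v. (G - mat l) *v v = 0 \<longrightarrow> v = 0)"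
      unfolding invertible_det_nz[symmetric] invertible_left_inverse matrix_left_invertible_ker ..
    ultimately have "(\<exists>v. v \<noteq> 0 \<and> G *v v = l *\<^sub>R v) \<longleftrightarrow> det (G - mat l) = 0"
      by auto
    also have "det (G - mat l) = l\<^sup>2 - (norm A)\<^sup>2 * l + (det A)\<^sup>2"
      unfolding det_2 norm_mat2_sq by (simp add: G mat_def power2_eq_square algebra_simps)
    finally show ?thesis .
  qed
  then show ?thesis unfolding gram_eigenvalues_def G_def by blast
qed

text \<open>By Vieta the two squared singular values have sum \<open>T\<close> and product
  \<open>(det A)^2\<close>; the discriminant is nonnegative by \<open>det_le_norm_sq\<close>. The
  larger of them lies between \<open>T / 2\<close> and \<open>T\<close>.\<close>

lemma singular_values:
  assumes d: "det (A :: real^2^2) \<noteq> 0"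
  shows "norm A / 2 \<le> sing1 A" "sing1 A \<le> norm A" "0 < sing2 A" "sing1 A * sing2 A = \<bar>det A\<bar>"
    "(norm A)\<^sup>2 \<le> 2 * (sing1 A)\<^sup>2"
proof -
  define T r where "T = (norm A)\<^sup>2" and "r = sqrt (T\<^sup>2 - 4 * (det A)\<^sup>2)"
  have T: "2 * \<bar>det A\<bar> \<le> T" unfolding T_def by (rule det_le_norm_sq)
  have T0: "0 < T" using T d by linarith
  have disc: "0 \<le> T\<^sup>2 - 4 * (det A)\<^sup>2"
    using power_mono[OF T, of 2] by (simp add: power_mult_distrib)
  have r2: "r\<^sup>2 = T\<^sup>2 - 4 * (det A)\<^sup>2" "0 \<le> r" using disc by (simp_all add: r_def)
  have rT: "r < T" 
  proof (rule power2_less_imp_less)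
    show "r\<^sup>2 < T\<^sup>2" unfolding r2 using d by simp
  qed (use T0 in simp)
  define l1 l2 where "l1 = (T + r) / 2" and "l2 = (T - r) / 2"
  have l: "l1 + l2 = T" "l1 * l2 = (det A)\<^sup>2" "l2 \<le> l1" "0 < l2"
  proof -
    show "l1 + l2 = T" "l2 \<le> l1" "0 < l2" using r2 rT by (auto simp: l1_def l2_def field_simps)
    have "l1 * l2 = (T\<^sup>2 - r\<^sup>2) / 4" by (simp add: l1_def l2_def power2_eq_square field_simps)
    then show "l1 * l2 = (det A)\<^sup>2" unfolding r2 by simp
  qed
  have "x\<^sup>2 - T * x + (det A)\<^sup>2 = (x - l1) * (x - l2)" for x
    using l(1,2) by (simp add: power2_eq_square algebra_simps flip: l(1) l(2))
  then have g: "gram_eigenvalues A = {l1, l2}" unfolding gram_eigenvalues_eq T_def[symmetric] by auto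
  have s1: "sing1 A = sqrt l1" unfolding sing1_def g using l by simp
  have s2: "sing2 A = sqrt l2" unfolding sing2_def g using l by simp
  have sq1: "(sing1 A)\<^sup>2 = l1" unfolding s1 using l by simp
  show "0 < sing2 A" unfolding s2 using l by simp
  have "sing1 A * sing2 A = sqrt ((det A)\<^sup>2)" unfolding s1 s2 l(2)[symmetric] by (simp add: real_sqrt_mult)
  then show "sing1 A * sing2 A = \<bar>det A\<bar>" by simp
  show T2: "(norm A)\<^sup>2 \<le> 2 * (sing1 A)\<^sup>2" unfolding sq1 using l by (simp add: T_def)
  have s0: "0 \<le> sing1 A" unfolding s1 using l by simp
  show "sing1 A \<le> norm A" by (rule power2_le_imp_le) (use sq1 l in \<open>simp_all add: T_def\<close>)
  show "norm A / 2 \<le> sing1 A"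
  proof (rule power2_le_imp_le)
    have "(norm A / 2)\<^sup>2 = (norm A)\<^sup>2 / 4" by (simp add: power_divide)
    also have "\<dots> \<le> (sing1 A)\<^sup>2" using T2 zero_le_power2[of "sing1 A"] by linarith
    finally show "(norm A / 2)\<^sup>2 \<le> (sing1 A)\<^sup>2" .
  qed (rule s0)
qed

text \<open>
  For \<open>0 \<le> s\<close> the singular value function is comparable to the norm to the power \<open>norm_exponent s\<close> times the
  determinant to the power \<open>det_exponent s\<close>, since the product of the singular values is the determinant.
\<close>

definition norm_exponent :: "real \<Rightarrow> real" where
  "norm_exponent s = (if s < 1 then s else if s \<le> 2 then 2 - s else 0)"

definition det_exponent :: "real \<Rightarrow> real" where
  "det_exponent s = (if s < 1 then 0 else if s \<le> 2 then s - 1 else s / 2)"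

lemma exponents: "norm_exponent s + 2 * det_exponent s = s" "s \<le> s' \<Longrightarrow> det_exponent s \<le> det_exponent s'"
  "0 \<le> s \<Longrightarrow> 0 \<le> norm_exponent s" "norm_exponent s \<le> 1" "0 \<le> det_exponent s"
  by (auto simp: norm_exponent_def det_exponent_def)

definition svf_norm :: "real \<Rightarrow> real^2^2 \<Rightarrow> real" where
  "svf_norm s A = norm A powr norm_exponent s * \<bar>det A\<bar> powr det_exponent s"

lemma norm_pos_of_det: "det (A :: real^2^2) \<noteq> 0 \<Longrightarrow> 0 < norm A"
  using det_le_norm_sq[of A] by (cases "norm A = 0") auto

lemma svf_norm_pos: "det A \<noteq> 0 \<Longrightarrow> 0 < svf_norm s A"
  unfolding svf_norm_def using norm_pos_of_det by (intro mult_pos_pos) auto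

lemma svf_bounds:
  assumes d: "det A \<noteq> 0" and s: "0 \<le> s"
  shows "svf_norm s A / 2 \<le> svf s A" "svf s A \<le> svf_norm s A"
proof -
  note sv = singular_values[OF d]
  have n0: "0 < norm A" using norm_pos_of_det[OF d] .
  then have s1: "0 < sing1 A" using sv(1) by linarith
  have eq: "svf s A = sing1 A powr norm_exponent s * \<bar>det A\<bar> powr det_exponent s"
  proof -
    consider "s < 1" | "1 \<le> s" "s \<le> 2" | "2 < s" by linarith
    then show ?thesis
    proof cases
      case 1 then show ?thesis using d by (simp add: svf_def norm_exponent_def det_exponent_def)
    next
      case 2
      have "sing1 A powr (2 - s) * \<bar>det A\<bar> powr (s - 1) = sing1 A powr (2 - s) * sing1 A powr (s - 1) * sing2 A powr (s - 1)"
        unfolding sv(4)[symmetric] using s1 sv(3) by (simp add: powr_mult)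
      also have "sing1 A powr (2 - s) * sing1 A powr (s - 1) = sing1 A" using s1 by (simp flip: powr_add)
      finally show ?thesis using 2 by (simp add: svf_def norm_exponent_def det_exponent_def)
    next
      case 3 then show ?thesis using s1 by (simp add: svf_def norm_exponent_def det_exponent_def)
    qed
  qed
  have e: "0 \<le> norm_exponent s" "norm_exponent s \<le> 1" using exponents s by auto
  have "sing1 A powr norm_exponent s \<le> norm A powr norm_exponent s" using sv(2) s1 e by (intro powr_mono2) auto
  then show "svf s A \<le> svf_norm s A" unfolding eq svf_norm_def by (intro mult_right_mono) auto
  have "norm A powr norm_exponent s / 2 \<le> sing1 A powr norm_exponent s"
  proof -
    have "norm A powr norm_exponent s / 2 = norm A powr norm_exponent s / 2 powr 1" by simp
    \<comment> \<open>The exponent is at most 1, so halving the norm costs at most the factor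
      2.\<close>
    also have "\<dots> \<le> norm A powr norm_exponent s / 2 powr norm_exponent s"
      using e by (intro divide_left_mono powr_mono) auto
    also have "\<dots> = (norm A / 2) powr norm_exponent s" using n0 by (simp add: powr_divide)
    also have "\<dots> \<le> sing1 A powr norm_exponent s" using sv(1) n0 e by (intro powr_mono2) auto
    finally show ?thesis .
  qed
  then have "norm A powr norm_exponent s / 2 * \<bar>det A\<bar> powr det_exponent s \<le> sing1 A powr norm_exponent s * \<bar>det A\<bar> powr det_exponent s"
    by (intro mult_right_mono) auto
  then show "svf_norm s A / 2 \<le> svf s A" unfolding eq svf_norm_def by simp
qed

lemma svf_norm_mult:
  assumes "det A \<noteq> 0" "det B \<noteq> 0" "0 \<le> s"
  shows "svf_norm s (A ** B) \<le> svf_norm s A * svf_norm s B"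
proof -
  have "norm (A ** B) powr norm_exponent s \<le> (norm A * norm B) powr norm_exponent s"
    using norm_matrix_mult_le exponents(3)[OF assms(3)] by (intro powr_mono2) auto
  also have "\<dots> = norm A powr norm_exponent s * norm B powr norm_exponent s"
    by (simp add: powr_mult)
  finally have "svf_norm s (A ** B) \<le> (norm A powr norm_exponent s * norm B powr norm_exponent s) * \<bar>det (A ** B)\<bar> powr det_exponent s"
    unfolding svf_norm_def by (intro mult_right_mono) auto
  also have "\<dots> = svf_norm s A * svf_norm s B"
    unfolding svf_norm_def det_mul abs_mult by (simp add: powr_mult)
  finally show ?thesis .
qed

text \<open>The identity \<open>norm_exponent s + 2 * det_exponent s = s\<close> expresses
  homogeneity of degree \<open>s\<close>. Since \<open>det_exponent\<close> grows with
  \<open>s\<close>, its surplus can be traded for twice that power of the norm by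
  \<open>det_le_norm_sq\<close>, and homogeneity leaves exactly the power
  \<open>s' - s\<close>.\<close>

lemma svf_norm_mono:
  assumes d: "det A \<noteq> 0" and s: "s \<le> s'"
  shows "svf_norm s' A \<le> norm A powr (s' - s) * svf_norm s A"
proof -
  have n: "0 < norm A" using norm_pos_of_det[OF d] .
  define b where "b = det_exponent s' - det_exponent s"
  have b: "0 \<le> b" using exponents(2)[OF s] by (simp add: b_def)
  have "svf_norm s' A = norm A powr norm_exponent s' * (\<bar>det A\<bar> powr b * \<bar>det A\<bar> powr det_exponent s)"
    unfolding svf_norm_def powr_add[symmetric] by (simp add: b_def)
  also have "\<dots> \<le> norm A powr norm_exponent s' * ((norm A powr 2) powr b * \<bar>det A\<bar> powr det_exponent s)"
  proof (intro mult_left_mono mult_right_mono powr_mono2 b)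
    show "\<bar>det A\<bar> \<le> norm A powr 2" using det_le_norm_sq[of A] n by (simp add: powr_numeral)
  qed auto
  also have "\<dots> = norm A powr (norm_exponent s' + 2 * b) * \<bar>det A\<bar> powr det_exponent s"
    by (simp only: powr_powr powr_add mult.assoc)
  also have "norm_exponent s' + 2 * b = (s' - s) + norm_exponent s"
    using exponents(1)[of s] exponents(1)[of s'] by (simp add: b_def)
  finally show ?thesis unfolding svf_norm_def by (simp add: powr_add)
qed

section \<open>Sums over words and their exponential growth\<close>

lemma word_mat_append: "word_mat t (u @ v) = word_mat t u ** word_mat t v"
  unfolding word_mat_def by (induction u) (simp_all add: matrix_mul_assoc)

lemma word_mat_simps: "word_mat t [] = mat 1" "word_mat t (k # w) = param_mat t k ** word_mat t w"
  by (simp_all add: word_mat_def)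

lemma det_word_mat: "det (word_mat t w) = (\<Prod>k\<leftarrow>w. det (param_mat t k))"
  by (induction w) (simp_all add: word_mat_simps det_mul)

lemma det_word_mat_nz: "(\<And>k. det (param_mat t k) \<noteq> 0) \<Longrightarrow> det (word_mat t w) \<noteq> 0"
  unfolding det_word_mat by (induction w) auto

definition words :: "nat \<Rightarrow> 'n list set" where "words n = {w. length w = n}"

lemma finite_words [simp]: "finite (words n :: 'n::finite list set)"
  unfolding words_def using finite_lists_length_eq[of "UNIV :: 'n set" n] by simp

lemma words_nonempty: "words n \<noteq> {}"
  unfolding words_def using Ex_list_of_length by auto

lemma sum_words_add:
  "(\<Sum>w\<in>words (n + m). f w) = (\<Sum>u\<in>words n. \<Sum>v\<in>words m. f (u @ v))"
proof -
  have "(\<Sum>u\<in>words n. \<Sum>v\<in>words m. f (u @ v)) = (\<Sum>(u, v)\<in>words n \<times> words m. f (u @ v))"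
    by (simp add: sum.cartesian_product)
  also have "\<dots> = (\<Sum>w\<in>words (n + m). f w)"
    by (rule sum.reindex_bij_witness[where i = "\<lambda>w. (take n w, drop n w)" and j = "\<lambda>(u, v). u @ v"])
      (auto simp: words_def)
  finally show ?thesis ..
qed

definition svf_sum :: "real \<Rightarrow> 'n::finite param \<Rightarrow> nat \<Rightarrow> real" where
  "svf_sum s t n = (\<Sum>w\<in>words n. svf_norm s (word_mat t w))"

lemma svf_sum_pos: "(\<And>k. det (param_mat t k) \<noteq> 0) \<Longrightarrow> 0 < svf_sum s t n"
  unfolding svf_sum_def using words_nonempty by (intro sum_pos svf_norm_pos det_word_mat_nz) auto

lemma svf_sum_add:
  assumes "\<And>k. det (param_mat t k) \<noteq> 0" "0 \<le> s"
  shows "svf_sum s t (n + m) \<le> svf_sum s t n * svf_sum s t m"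
  unfolding svf_sum_def sum_words_add sum_product word_mat_append
  using assms by (intro sum_mono svf_norm_mult det_word_mat_nz)

text \<open>Division with remainder by an almost optimal \<open>m\<close> bounds the quotients for
  large \<open>n\<close> by their infimum up to \<open>e\<close>; the linear lower bound makes this
  infimum finite.\<close>

lemma fekete:
  fixes x :: "nat \<Rightarrow> real"
  assumes sub: "\<And>n m. x (n + m) \<le> x n + x m" and lo: "\<And>n. - c * real n \<le> x n"
  shows "convergent (\<lambda>n. x n / real n)"
proof -
  define S where "S = (\<lambda>n. x n / real n) ` {1..}"
  have lb: "- c \<le> x n / real n" if "1 \<le> n" for n using lo[of n] that by (simp add: le_divide_eq)
  have bb: "bdd_below S" unfolding S_def using lb by (intro bdd_belowI2[of _ "-c"]) auto
  have ne: "S \<noteq> {}" by (auto simp: S_def)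
  define l where "l = Inf S"
  have ge: "l \<le> x n / real n" if "1 \<le> n" for n
    unfolding l_def using bb that by (intro cInf_lower) (auto simp: S_def)
  have "(\<lambda>n. x n / real n) \<longlonglongrightarrow> l"
  proof (rule LIMSEQ_I)
    fix e :: real assume e: "0 < e"
    then have "Inf S < l + e / 2" by (simp add: l_def)
    then obtain m where m: "1 \<le> m" "x m / real m < l + e / 2" using cInf_lessD[OF ne] by (auto simp: S_def)
    define C where "C = \<bar>x m\<bar> + (\<Sum>r\<le>m. \<bar>x r\<bar>)"
    have C0: "0 \<le> C" unfolding C_def by (simp add: sum_nonneg)
    obtain n0 :: nat where n0: "2 * C / e < real n0" using reals_Archimedean2 by blast
    have mult: "x (q * m + r) \<le> real q * x m + x r" for q r
    proof (induction q)
      case (Suc q)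
      have "x (Suc q * m + r) \<le> x m + x (q * m + r)" using sub[of m "q * m + r"] by (simp add: add.assoc)
      then show ?case using Suc by (simp add: algebra_simps)
    qed simp
    show "\<exists>n0. \<forall>n\<ge>n0. norm (x n / real n - l) < e"
    proof (intro exI[of _ "max 1 n0"] allI impI)
      fix n assume n: "max 1 n0 \<le> n"
      then have n1: "1 \<le> n" "0 < real n" by auto
      define q r where "q = n div m" and "r = n mod m"
      have nqr: "n = q * m + r" "r < m" using m by (simp_all add: q_def r_def)
      have rn: "real n = real q * real m + real r" using nqr(1) by (metis of_nat_add of_nat_mult)
      have "x n \<le> real q * x m + x r" using mult[of q r] nqr by simp
      also have "real q * x m = real n * (x m / real m) - real r * (x m / real m)"
        using m rn by (simp add: field_simps)
      also have "- (real r * (x m / real m)) \<le> \<bar>x m\<bar>"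
      proof -
        have "\<bar>real r * (x m / real m)\<bar> = (real r / real m) * \<bar>x m\<bar>" by (simp add: abs_mult)
        also have "\<dots> \<le> 1 * \<bar>x m\<bar>" using nqr m by (intro mult_right_mono) auto
        finally show ?thesis by linarith
      qed
      moreover have "x r \<le> (\<Sum>r\<le>m. \<bar>x r\<bar>)"
        using member_le_sum[of r "{..m}" "\<lambda>r. \<bar>x r\<bar>"] nqr by auto
      ultimately have "x n \<le> real n * (x m / real m) + C" unfolding C_def by linarith
      then have "x n / real n \<le> (real n * (x m / real m) + C) / real n" using n1 by (intro divide_right_mono) auto
      also have "\<dots> = x m / real m + C / real n" using n1 by (simp add: add_divide_distrib)
      also have "C / real n \<le> e / 2"
      proof -
        have "2 * C / e \<le> real n" using n0 n by linarith
        then show ?thesis using e n1 by (simp add: field_simps)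
      qed
      finally have "x n / real n < l + e" using m(2) by linarith
      then show "norm (x n / real n - l) < e" using ge[OF n1(1)] by simp
    qed
  qed
  then show ?thesis by (auto simp: convergent_def)
qed

text \<open>Subadditivity comes from \<open>svf_sum_add\<close>. The linear lower bound is supplied
  by a single word: its term is at least the modulus of its determinant to the power
  \<open>s/2\<close>, and determinants multiply along the word.\<close>

lemma svf_sum_growth:
  assumes d: "\<And>k. det (param_mat t k) \<noteq> 0" and s: "0 \<le> s"
  shows "convergent (\<lambda>n. ln (svf_sum s t n) / real n)"
proof -
  define \<delta> where "\<delta> = min 1 (Min (range (\<lambda>k. \<bar>det (param_mat t k)\<bar>)))"
  have \<delta>: "0 < \<delta>" "\<delta> \<le> 1" using d by (auto simp: \<delta>_def)
  have dk: "\<delta> \<le> \<bar>det (param_mat t k)\<bar>" for k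
    unfolding \<delta>_def by (rule min.coboundedI2) simp
  have dw: "\<delta> ^ length w \<le> \<bar>det (word_mat t w)\<bar>" for w
  proof (induction w)
    case (Cons k w)
    then show ?case using dk[of k] \<delta> by (auto simp: word_mat_simps det_mul abs_mult intro!: mult_mono)
  qed (simp add: word_mat_simps)
  show ?thesis
  proof (rule fekete[where c = "- (s / 2) * ln \<delta>"])
    fix n m
    have "ln (svf_sum s t (n + m)) \<le> ln (svf_sum s t n * svf_sum s t m)"
      using svf_sum_add[OF d s, of n m] svf_sum_pos[OF d, of s] by simp
    then show "ln (svf_sum s t (n + m)) \<le> ln (svf_sum s t n) + ln (svf_sum s t m)"
      using svf_sum_pos[OF d, of s] by (simp add: ln_mult_pos)
  next
    fix n
    obtain w :: "'a list" where w: "w \<in> words n" using words_nonempty by blast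
    have nz: "det (word_mat t w) \<noteq> 0" using d by (rule det_word_mat_nz)
    have "\<bar>det (word_mat t w)\<bar> powr (s / 2) = \<bar>det (word_mat t w)\<bar> powr (norm_exponent s / 2) * \<bar>det (word_mat t w)\<bar> powr det_exponent s"
      unfolding powr_add[symmetric] using exponents(1)[of s] by (simp add: field_simps)
    also have "\<dots> \<le> ((norm (word_mat t w)) powr 2) powr (norm_exponent s / 2) * \<bar>det (word_mat t w)\<bar> powr det_exponent s"
    proof (intro mult_right_mono powr_mono2)
      show "\<bar>det (word_mat t w)\<bar> \<le> norm (word_mat t w) powr 2"
        using det_le_norm_sq[of "word_mat t w"] norm_pos_of_det[OF nz] by (simp add: powr_numeral)
    qed (use exponents(3)[OF s] in auto)
    also have "\<dots> = svf_norm s (word_mat t w)" unfolding svf_norm_def powr_powr by simp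
    also have "\<dots> \<le> svf_sum s t n" unfolding svf_sum_def
      using w svf_norm_pos[OF det_word_mat_nz[OF d]] by (intro member_le_sum) (auto simp: less_imp_le)
    finally have "\<bar>det (word_mat t w)\<bar> powr (s / 2) \<le> svf_sum s t n" .
    moreover have "(\<delta> ^ n) powr (s / 2) \<le> \<bar>det (word_mat t w)\<bar> powr (s / 2)"
      using dw[of w] w \<delta> s by (intro powr_mono2) (auto simp: words_def)
    ultimately have "(\<delta> ^ n) powr (s / 2) \<le> svf_sum s t n" by linarith
    then have "ln ((\<delta> ^ n) powr (s / 2)) \<le> ln (svf_sum s t n)" using \<delta> svf_sum_pos[OF d, of s n]
      by (subst ln_le_cancel_iff) auto
    then show "- (- (s / 2) * ln \<delta>) * real n \<le> ln (svf_sum s t n)"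
      using \<delta> by (simp add: ln_powr ln_realpow mult_ac)
  qed
qed

definition log_pressure :: "real \<Rightarrow> 'n::finite param \<Rightarrow> real" where
  "log_pressure s t = lim (\<lambda>n. ln (svf_sum s t n) / real n)"

lemma log_pressure_limit:
  assumes d: "\<And>k. det (param_mat t k) \<noteq> 0" and s: "0 \<le> s"
  shows "(\<lambda>n. ln (svf_sum s t n) / real n) \<longlonglongrightarrow> log_pressure s t"
  using svf_sum_growth[OF d s] unfolding log_pressure_def by (simp add: convergent_LIMSEQ_iff)

text \<open>Constants independent of \<open>n\<close> disappear after taking logarithms and dividing
  by \<open>n\<close>. This is used for the true singular value function and again for the sums
  produced by the transfer operator.\<close>

lemma log_pressure_comparable:
  assumes d: "\<And>k. det (param_mat t k) \<noteq> 0" and s: "0 \<le> s"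
    and c: "0 < c" "\<And>n. c * svf_sum s t n \<le> X n" "\<And>n. X n \<le> C * svf_sum s t n"
  shows "(\<lambda>n. ln (X n) / real n) \<longlonglongrightarrow> log_pressure s t"
proof -
  note S = svf_sum_pos[OF d, of s]
  have X: "0 < X n" for n using c(1) c(2)[of n] S[of n] by (meson less_le_trans mult_pos_pos)
  have C: "0 < C" using X[of 0] c(3)[of 0] S[of 0] by (meson less_le_trans zero_less_mult_pos2)
  have cn: "(\<lambda>n. a / real n + ln (svf_sum s t n) / real n) \<longlonglongrightarrow> log_pressure s t" for a
  proof -
    have "(\<lambda>n. a / real n) \<longlonglongrightarrow> 0" by (rule lim_const_over_n)
    from tendsto_add[OF this log_pressure_limit[OF d s]] show ?thesis by simp
  qed
  show ?thesis
  proof (rule real_tendsto_sandwich[OF _ _ cn[of "ln c"] cn[of "ln C"]]; intro always_eventually allI)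
    fix n
    have "ln (c * svf_sum s t n) \<le> ln (X n)" using c(1,2) S X by simp
    then show "ln c / real n + ln (svf_sum s t n) / real n \<le> ln (X n) / real n"
      using c(1) S[of n] by (simp add: ln_mult_pos add_divide_distrib[symmetric] divide_right_mono)
    have "ln (X n) \<le> ln (C * svf_sum s t n)" using c(3) S C X by simp
    then show "ln (X n) / real n \<le> ln C / real n + ln (svf_sum s t n) / real n"
      using C S[of n] by (simp add: ln_mult_pos add_divide_distrib[symmetric] divide_right_mono)
  qed
qed

lemma pressure_eq:
  assumes d: "\<And>k. det (param_mat t k) \<noteq> 0" and s: "0 \<le> s"
  shows "pressure_seq s t \<longlonglongrightarrow> exp (log_pressure s t)" "pressure s t = exp (log_pressure s t)"
    "convergent (pressure_seq s t)"
proof -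
  define X where "X n = (\<Sum>w | length w = n. svf s (word_mat t w))" for n
  have lo: "(1/2) * svf_sum s t n \<le> X n" for n
    unfolding X_def svf_sum_def words_def sum_distrib_left
    using svf_bounds(1)[OF det_word_mat_nz[OF d] s] by (intro sum_mono) auto
  have up: "X n \<le> 1 * svf_sum s t n" for n
    unfolding X_def svf_sum_def words_def 
    using svf_bounds(2)[OF det_word_mat_nz[OF d] s] by (simp add: sum_mono)
  have X: "0 < X n" for n using lo[of n] svf_sum_pos[OF d, of s n] by linarith
  have "(\<lambda>n. exp (ln (X n) / real n)) \<longlonglongrightarrow> exp (log_pressure s t)"
    by (intro tendsto_exp log_pressure_comparable[OF d s _ lo up]) simp
  moreover have "pressure_seq s t = (\<lambda>n. exp (ln (X n) / real n))"
  proof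
    \<comment> \<open>Also at \<open>n = 0\<close>, where \<open>1 / 0 = 0\<close> makes both sides
      1.\<close>
    show "pressure_seq s t n = exp (ln (X n) / real n)" for n
      unfolding pressure_seq_def X_def[symmetric] using X[of n] by (simp add: powr_def)
  qed
  ultimately show L: "pressure_seq s t \<longlonglongrightarrow> exp (log_pressure s t)" by simp
  then show "pressure s t = exp (log_pressure s t)" unfolding pressure_def by (rule limI)
  show "convergent (pressure_seq s t)" using L by (auto simp: convergent_def)
qed

text \<open>\<open>svf_norm_mono\<close> is applied word by word, and the constant \<open>C\<close>
  vanishes in the limit. For \<open>\<theta> < 1\<close> the slope \<open>ln \<theta>\<close> is
  negative; this gives both the uniqueness of the zero in \<open>s\<close> and the nonvanishing
  derivative for the implicit function.\<close>

lemma log_pressure_decreasing: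
  assumes d: "\<And>k. det (param_mat t k) \<noteq> 0" and s: "0 \<le> s" "s \<le> s'"
    and C: "0 < C" "0 < \<theta>" and w: "\<And>w. norm (word_mat t w) \<le> C * \<theta> ^ length w"
  shows "log_pressure s' t \<le> log_pressure s t + (s' - s) * ln \<theta>"
proof -
  note S = svf_sum_pos[OF d]
  have "svf_sum s' t n \<le> (C * \<theta> ^ n) powr (s' - s) * svf_sum s t n" for n
    unfolding svf_sum_def sum_distrib_left
  proof (rule sum_mono)
    fix w :: "'a list" assume "w \<in> words n"
    have nz: "det (word_mat t w) \<noteq> 0" using d by (rule det_word_mat_nz)
    have "norm (word_mat t w) powr (s' - s) \<le> (C * \<theta> ^ n) powr (s' - s)"
      using w[of w] s \<open>w \<in> words n\<close> by (intro powr_mono2) (auto simp: words_def)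
    then show "svf_norm s' (word_mat t w) \<le> (C * \<theta> ^ n) powr (s' - s) * svf_norm s (word_mat t w)"
      using svf_norm_mono[OF nz s(2)] svf_norm_pos[OF nz, of s]
      by (meson less_imp_le mult_right_mono order_trans)
  qed
  then have lnle: "ln (svf_sum s' t n) \<le> ln ((C * \<theta> ^ n) powr (s' - s) * svf_sum s t n)" for n
    using S C by (subst ln_le_cancel_iff) auto
  have le: "ln (svf_sum s' t n) \<le> (s' - s) * (ln C + real n * ln \<theta>) + ln (svf_sum s t n)" for n
  proof -
    have p: "0 < C * \<theta> ^ n" using C by simp
    have "ln ((C * \<theta> ^ n) powr (s' - s) * svf_sum s t n) = ln ((C * \<theta> ^ n) powr (s' - s)) + ln (svf_sum s t n)"
      using S[of s n] C by (intro ln_mult_pos) auto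
    also have "ln ((C * \<theta> ^ n) powr (s' - s)) = (s' - s) * ln (C * \<theta> ^ n)" using p by (simp add: ln_powr)
    also have "ln (C * \<theta> ^ n) = ln C + real n * ln \<theta>" using C by (simp add: ln_mult_pos ln_realpow)
    finally show ?thesis using lnle[of n] by simp
  qed
  have lim: "(\<lambda>n. ((s' - s) * ln C) / real n + ln (svf_sum s t n) / real n + (s' - s) * ln \<theta>) \<longlonglongrightarrow> 0 + log_pressure s t + (s' - s) * ln \<theta>"
    by (intro tendsto_intros lim_const_over_n log_pressure_limit[OF d s(1)])
  have s'0: "0 \<le> s'" using s by simp
  have "log_pressure s' t \<le> 0 + log_pressure s t + (s' - s) * ln \<theta>"
  proof (rule tendsto_le[OF sequentially_bot lim log_pressure_limit[OF d s'0]])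
    show "\<forall>\<^sub>F n in sequentially. ln (svf_sum s' t n) / real n \<le> ((s' - s) * ln C) / real n + ln (svf_sum s t n) / real n + (s' - s) * ln \<theta>"
      using eventually_gt_at_top[of 0]
    proof eventually_elim
      case (elim n)
      have "ln (svf_sum s' t n) / real n \<le> ((s' - s) * (ln C + real n * ln \<theta>) + ln (svf_sum s t n)) / real n"
        using le[of n] by (intro divide_right_mono) auto
      also have "\<dots> = ((s' - s) * ln C) / real n + ln (svf_sum s t n) / real n + (s' - s) * ln \<theta>"
        using elim by (simp add: field_simps)
      finally show ?case .
    qed
  qed
  then show ?thesis by simp
qed

subsection \<open>Planar cones and contracting norms\<close>

definition cross2 :: "real^2 \<Rightarrow> real^2 \<Rightarrow> real" where
  "cross2 x y = x$1 * y$2 - x$2 * y$1"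

lemma cross2_diff: "cross2 u (x - y) = cross2 u x - cross2 u y" "cross2 (x - y) u = cross2 x u - cross2 y u"
  and cross2_scale: "cross2 u (r *\<^sub>R x) = r * cross2 u x" "cross2 (r *\<^sub>R x) u = r * cross2 x u"
  and cross2_add: "cross2 u (x + y) = cross2 u x + cross2 u y" "cross2 (x + y) u = cross2 x u + cross2 y u"
  and cross2_self: "cross2 u u = 0"
  by (simp_all add: cross2_def algebra_simps)

lemma interior_pushback:
  fixes C :: "'a::real_normed_vector set"
  assumes "x \<in> interior C"
  obtains e where "0 < e" "x - e *\<^sub>R z \<in> C"
proof -
  obtain r where r: "0 < r" "ball x r \<subseteq> C" using assms mem_interior by blast
  define e where "e = r / (2 * (norm z + 1))"
  have "e * norm z < r"
  proof -
    have "e * norm z \<le> e * (norm z + 1)" using r by (intro mult_left_mono) (auto simp: e_def)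
    also have "\<dots> = r / 2"
    proof -
      have "norm z + 1 \<noteq> 0" using norm_ge_zero[of z] by linarith
      moreover have "r / (2 * n) * n = r / 2" if "n \<noteq> 0" for n using that by simp
      ultimately show ?thesis unfolding e_def by blast
    qed
    finally show ?thesis using r by simp
  qed
  moreover have "0 < e" using r by (simp add: e_def add_nonneg_pos)
  ultimately have "x - e *\<^sub>R z \<in> ball x r" by (simp add: dist_norm)
  then show ?thesis using that \<open>0 < e\<close> r by blast
qed

text \<open>\<open>u\<close> and \<open>v\<close> span the two extreme rays. A convex cone without
  the origin lies on the positive side of a linear functional \<open>a\<close>, so its directions
  form a compact arc, and interior points lie strictly between the ends. Both extreme rays belong to
  the cone, hence are mapped into its interior; this says that the matrices have positive entries in
  the basis \<open>u\<close>, \<open>v\<close>.\<close>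

lemma cone_basis:
  assumes C: "is_cone C" and S: "strictly_preserves S C"
  obtains u v where "0 < cross2 u v"
    "\<And>A. A \<in> S \<Longrightarrow> 0 < cross2 (A *v u) v \<and> 0 < cross2 (A *v v) v \<and> 0 < cross2 u (A *v u) \<and> 0 < cross2 u (A *v v)"
proof -
  have cvx: "convex C" and C0: "0 \<notin> C" and cl: "closedin (top_of_set (- {0})) C"
    and int: "interior C \<noteq> {}" and sc: "\<And>x c. x \<in> C \<Longrightarrow> 0 < c \<Longrightarrow> c *\<^sub>R x \<in> C"
    using C by (auto simp: is_cone_def)
  define K where "K = C \<inter> sphere 0 1"
  obtain T where T: "closed T" "C = - {0} \<inter> T" using cl by (auto simp: closedin_closed)
  have "K = T \<inter> sphere 0 1" unfolding K_def T(2) by auto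
  then have cK: "compact K" using T(1) by (simp add: closed_Int_compact)
  have nK: "x /\<^sub>R norm x \<in> K" if "x \<in> C" for x
    using that sc[OF that, of "inverse (norm x)"] C0 unfolding K_def by (cases "x = 0") auto
  obtain x0 where x0: "x0 \<in> interior C" using int by blast
  then have x0C: "x0 \<in> C" using interior_subset by blast
  have Kne: "K \<noteq> {}" using nK[OF x0C] by blast
  \<comment> \<open>Strict separation from the origin needs a closed convex set; the cone
    accumulates at the origin, but the hull of its unit vectors is compact and still inside the
    cone.\<close>
  have "convex hull K \<subseteq> C" using cvx by (intro hull_minimal) (auto simp: K_def)
  then have "0 \<notin> convex hull K" using C0 by blast
  moreover have "closed (convex hull K)" using cK by (simp add: compact_convex_hull compact_imp_closed)
  ultimately obtain a b where a: "a \<noteq> 0" "0 < b" "\<And>x. x \<in> convex hull K \<Longrightarrow> b < inner a x"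
    using separating_hyperplane_closed_0[of "convex hull K"] by (auto simp: convex_convex_hull)
  have apos: "0 < inner a x" if "x \<in> C" for x
  proof -
    have x: "0 < norm x" using that C0 by (cases "x = 0") auto
    have "0 < inner a (x /\<^sub>R norm x)" using a(2) a(3)[OF hull_inc[OF nK[OF that]]] by linarith
    then show ?thesis using x by (simp add: zero_less_mult_iff)
  qed
  \<comment> \<open>The tangent of the angle from \<open>a\<close> to \<open>x\<close>: it depends
    on the ray only and orders the directions of the cone.\<close>
  define \<sigma> where "\<sigma> x = cross2 a x / inner a x" for x
  have cont: "continuous_on K \<sigma>"
    unfolding \<sigma>_def cross2_def using apos K_def by (intro continuous_intros) (force simp: K_def)
  obtain u where u: "u \<in> K" "\<And>x. x \<in> K \<Longrightarrow> \<sigma> u \<le> \<sigma> x" using continuous_attains_inf[OF cK Kne cont] by blast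
  obtain v where v: "v \<in> K" "\<And>x. x \<in> K \<Longrightarrow> \<sigma> x \<le> \<sigma> v" using continuous_attains_sup[OF cK Kne cont] by blast
  have uvC: "u \<in> C" "v \<in> C" using u v by (auto simp: K_def)
  have \<sigma>n: "\<sigma> (x /\<^sub>R norm x) = \<sigma> x" if "x \<in> C" for x
    using that C0 unfolding \<sigma>_def by (cases "x = 0") (auto simp: cross2_scale)
  have u': "\<sigma> u \<le> \<sigma> x" and v': "\<sigma> x \<le> \<sigma> v" if "x \<in> C" for x
    using u(2)[OF nK[OF that]] v(2)[OF nK[OF that]] \<sigma>n[OF that] by simp_all
  have cr: "inner a a * cross2 x y = inner a x * inner a y * (\<sigma> y - \<sigma> x)" if "x \<in> C" "y \<in> C" for x y
  proof -
    have "inner a x * inner a y * (\<sigma> y - \<sigma> x) = inner a x * cross2 a y - cross2 a x * inner a y"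
      unfolding \<sigma>_def using apos[OF that(1)] apos[OF that(2)] by (simp add: field_simps)
    also have "\<dots> = inner a a * cross2 x y" by (simp add: inner_vec_def sum_2 cross2_def algebra_simps)
    finally show ?thesis ..
  qed
  have aa: "0 < inner a a" using a(1) by simp
  have ge: "0 \<le> cross2 u x" "0 \<le> cross2 x v" if "x \<in> C" for x
  proof -
    have "0 \<le> inner a a * cross2 u x" unfolding cr[OF uvC(1) that]
      using u'[OF that] apos uvC that by (intro mult_nonneg_nonneg) (auto simp: less_imp_le)
    then show "0 \<le> cross2 u x" using aa by (simp add: zero_le_mult_iff)
    have "0 \<le> inner a a * cross2 x v" unfolding cr[OF that uvC(2)]
      using v'[OF that] apos uvC that by (intro mult_nonneg_nonneg) (auto simp: less_imp_le)
    then show "0 \<le> cross2 x v" using aa by (simp add: zero_le_mult_iff)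
  qed
  have nz: "u \<noteq> 0" "v \<noteq> 0" using uvC C0 by auto
  have gt: "0 < cross2 u x" "0 < cross2 x v" if x: "x \<in> interior C" for x
  proof -
    \<comment> \<open>\<open>u\<close> turned by a right angle. An interior point can be moved a
      little against \<open>z\<close> without leaving the cone, so the weak inequality at the moved
      point is strict at \<open>x\<close>.\<close>
    define z where "z = (vector [- u$2, u$1] :: real^2)"
    have "cross2 u z = inner u u" by (simp add: cross2_def z_def inner_vec_def sum_2)
    then have z: "0 < cross2 u z" using nz by simp
    obtain e where e: "0 < e" "x - e *\<^sub>R z \<in> C" using interior_pushback[OF x] by blast
    have "0 < e * cross2 u z" using e z by simp
    then show "0 < cross2 u x" using ge(1)[OF e(2)] by (simp add: cross2_diff cross2_scale)
    define y where "y = (vector [v$2, - v$1] :: real^2)"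
    have "cross2 y v = inner v v" by (simp add: cross2_def y_def inner_vec_def sum_2)
    then have y: "0 < cross2 y v" using nz by simp
    obtain e' where e': "0 < e'" "x - e' *\<^sub>R y \<in> C" using interior_pushback[OF x] by blast
    have "0 < e' * cross2 y v" using e' y by simp
    then show "0 < cross2 x v" using ge(2)[OF e'(2)] by (simp add: cross2_diff cross2_scale)
  qed
  have "0 < cross2 u v"
  proof -
    have "0 < inner a a * cross2 u x0" using gt(1)[OF x0] aa by simp
    then have "0 < inner a u * inner a x0 * (\<sigma> x0 - \<sigma> u)" unfolding cr[OF uvC(1) x0C] .
    moreover have "0 < inner a u * inner a x0" using apos uvC x0C by simp
    ultimately have "\<sigma> u < \<sigma> x0" by (simp add: zero_less_mult_iff)
    then have "\<sigma> u < \<sigma> v" using v'[OF x0C] by linarith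
    then have "0 < inner a u * inner a v * (\<sigma> v - \<sigma> u)" using apos uvC by simp
    then have "0 < inner a a * cross2 u v" unfolding cr[OF uvC] .
    then show ?thesis using aa by (simp add: zero_less_mult_iff)
  qed
  moreover have "A *v u \<in> interior C" "A *v v \<in> interior C" if "A \<in> S" for A
    using S that uvC nz by (auto simp: strictly_preserves_def)
  ultimately show ?thesis using that gt by blast
qed

section \<open>Contraction for nearby parameters\<close>

lemma param_mat_nth:
  "param_mat t k $ 1 $ 1 = t$k$1" "param_mat t k $ 1 $ 2 = t$k$2" "param_mat t k $ 2 $ 1 = t$k$3" "param_mat t k $ 2 $ 2 = t$k$4"
  by (simp_all add: param_mat_def)

lemma tendsto_param_mat:
  fixes t0 :: "'n::finite param"
  shows "((\<lambda>t. param_mat t k) \<longlongrightarrow> param_mat t0 k) (nhds t0)"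
proof (intro vec_tendstoI)
  fix i j :: 2
  have "((\<lambda>t :: 'n param. t $ k $ l) \<longlongrightarrow> t0 $ k $ l) (nhds t0)" for l
    by (intro tendsto_vec_nth filterlim_ident)
  then show "((\<lambda>t. param_mat t k $ i $ j) \<longlongrightarrow> param_mat t0 k $ i $ j) (nhds t0)"
    using exhaust_2[of i] exhaust_2[of j] by (auto simp: param_mat_nth)
qed

lemma matrix_norm_columns: "norm (A :: real^2^2) \<le> norm (A *v axis 1 1) + norm (A *v axis 2 1)"
proof (rule power2_le_imp_le)
  have "(norm A)\<^sup>2 = (norm (A *v axis 1 1))\<^sup>2 + (norm (A *v axis 2 1))\<^sup>2"
    unfolding norm_mat2_sq norm_vec2_sq matrix_vector_mult_2 by (simp add: axis_def)
  also have "\<dots> \<le> (norm (A *v axis 1 1) + norm (A *v axis 2 1))\<^sup>2" by (simp add: power2_sum)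
  finally show "(norm A)\<^sup>2 \<le> (norm (A *v axis 1 1) + norm (A *v axis 2 1))\<^sup>2" .
qed simp

lemma is_norm_equivalent:
  fixes \<nu> :: "real^2 \<Rightarrow> real"
  assumes n: "is_norm \<nu>"
  obtains c M where "0 < c" "0 < M" "\<And>x. c * norm x \<le> \<nu> x" "\<And>x. \<nu> x \<le> M * norm x"
proof -
  have n0: "0 \<le> \<nu> x" "\<nu> x = 0 \<longleftrightarrow> x = 0" "\<nu> (r *\<^sub>R x) = \<bar>r\<bar> * \<nu> x" "\<nu> (x + y) \<le> \<nu> x + \<nu> y" for x y r
    using n by (auto simp: is_norm_def)
  define M where "M = \<nu> (axis 1 1) + \<nu> (axis 2 1) + 1"
  have M: "0 < M" unfolding M_def using n0(1)[of "axis 1 1"] n0(1)[of "axis 2 1"] by linarith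
  have up: "\<nu> x \<le> M * norm x" for x
  proof -
    have "x = x$1 *\<^sub>R axis 1 1 + x$2 *\<^sub>R axis 2 1" by (simp add: vec_eq_iff forall_2 axis_def)
    then have "\<nu> x \<le> \<bar>x$1\<bar> * \<nu> (axis 1 1) + \<bar>x$2\<bar> * \<nu> (axis 2 1)" by (metis n0(3,4))
    also have "\<dots> \<le> norm x * \<nu> (axis 1 1) + norm x * \<nu> (axis 2 1)"
      using n0(1) component_le_norm_cart[of x] by (intro add_mono mult_right_mono) auto
    also have "\<dots> \<le> M * norm x" by (simp add: M_def algebra_simps)
    finally show ?thesis .
  qed
  have lip: "\<bar>\<nu> x - \<nu> y\<bar> \<le> M * norm (x - y)" for x y
  proof -
    have "\<nu> x \<le> \<nu> (x - y) + \<nu> y" "\<nu> y \<le> \<nu> (y - x) + \<nu> x" using n0(4)[of "x - y" y] n0(4)[of "y - x" x] by simp_all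
    then show ?thesis using up[of "x - y"] up[of "y - x"] by (simp add: norm_minus_commute)
  qed
  have cont: "continuous_on (sphere 0 1) \<nu>"
  proof (rule continuous_onI)
    fix x e assume "0 < (e::real)"
    then show "\<exists>d>0. \<forall>x'\<in>sphere 0 1. dist x' x < d \<longrightarrow> dist (\<nu> x') (\<nu> x) \<le> e"
    proof (intro exI[of _ "e / M"] conjI ballI impI)
      fix x' assume "dist x' x < e / M"
      then have "M * norm (x' - x) \<le> e" using M by (simp add: dist_norm field_simps less_imp_le)
      then show "dist (\<nu> x') (\<nu> x) \<le> e" using lip[of x' x] by (simp add: dist_real_def)
    qed (use M in simp)
  qed
  have ne: "sphere 0 1 \<noteq> ({} :: (real^2) set)" by simp
  obtain x0 where x0: "x0 \<in> sphere 0 1" "\<And>x. x \<in> sphere 0 1 \<Longrightarrow> \<nu> x0 \<le> \<nu> x"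
    using continuous_attains_inf[OF compact_sphere ne cont] by blast
  have "0 < \<nu> x0" using n0(1)[of x0] n0(2)[of x0] x0(1) by (cases "x0 = 0") (auto simp: less_le)
  moreover have "\<nu> x0 * norm x \<le> \<nu> x" for x
  proof (cases "x = 0")
    case False
    then have "\<nu> x0 \<le> \<nu> (x /\<^sub>R norm x)" by (intro x0) simp
    also have "\<dots> = \<nu> x / norm x" by (simp add: n0(3) divide_inverse mult.commute)
    finally show ?thesis using False by (simp add: field_simps)
  qed (use n0 in simp)
  ultimately show ?thesis using that M up by blast
qed

text \<open>Only the given norm \<open>\<nu>\<close> contracts letter by letter. There, finitely
  many factors bounded by \<open>\<theta>0 < 1\<close> leave room for a perturbation, and the
  passage from \<open>\<nu>\<close> to the Frobenius norm costs a constant once per word rather than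
  once per letter.\<close>

lemma contracting_nearby:
  fixes t0 :: "'n::finite param"
  assumes "contracting (range (param_mat t0))"
  obtains C \<theta> where "0 < C" "0 < \<theta>" "\<theta> < 1" "\<forall>\<^sub>F t in nhds t0. \<forall>w. norm (word_mat t w) \<le> C * \<theta> ^ length w"
proof -
  obtain \<nu> where \<nu>: "is_norm \<nu>" "\<And>k. induced_onorm \<nu> (param_mat t0 k) < 1"
    using assms by (auto simp: contracting_def)
  have n0: "0 \<le> \<nu> x" "\<nu> x = 0 \<longleftrightarrow> x = 0" "\<nu> (r *\<^sub>R x) = \<bar>r\<bar> * \<nu> x" "\<nu> (x + y) \<le> \<nu> x + \<nu> y" for x y r
    using \<nu>(1) by (auto simp: is_norm_def)
  obtain c M where cM: "0 < c" "0 < M" "\<And>x. c * norm x \<le> \<nu> x" "\<And>x. \<nu> x \<le> M * norm x"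
    using is_norm_equivalent[OF \<nu>(1)] by blast
  have mat: "\<nu> (A *v x) \<le> (M * norm A / c) * \<nu> x" for A x
  proof -
    have "\<nu> (A *v x) \<le> M * (norm A * norm x)" using cM(4)[of "A *v x"] norm_matrix_vector_le[of A x] cM(2)
      by (meson less_imp_le mult_left_mono order_trans)
    also have "\<dots> \<le> M * (norm A * (\<nu> x / c))" using cM(1,2) cM(3)[of x] 
      by (intro mult_left_mono) (auto simp: field_simps)
    finally show ?thesis by simp
  qed
  have ind: "\<nu> (A *v x) \<le> induced_onorm \<nu> A * \<nu> x" for A x
  proof (cases "x = 0")
    case True
    then show ?thesis using n0(2)[of 0] by (simp add: matrix_vector_mult_0_right)
  next
    case False
    then have p: "0 < \<nu> x" using n0(1,2)[of x] by (simp add: less_le)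
    have "\<nu> (A *v x) / \<nu> x \<le> induced_onorm \<nu> A"
      unfolding induced_onorm_def
    proof (rule cSUP_upper)
      show "bdd_above ((\<lambda>x. \<nu> (A *v x) / \<nu> x) ` (- {0}))"
      proof (rule bdd_aboveI2[of _ _ "M * norm A / c"])
        fix y :: "real^2" assume "y \<in> - {0}"
        then have "0 < \<nu> y" using n0(1,2)[of y] by (simp add: less_le)
        then show "\<nu> (A *v y) / \<nu> y \<le> M * norm A / c" using mat[of A y] by (simp add: pos_divide_le_eq)
      qed
    qed (use False in simp)
    then show ?thesis using p by (simp add: pos_divide_le_eq)
  qed
  define \<theta>0 where "\<theta>0 = max 0 (Max (range (\<lambda>k. induced_onorm \<nu> (param_mat t0 k))))"
  have \<theta>0: "0 \<le> \<theta>0" "\<theta>0 < 1" using \<nu>(2) by (auto simp: \<theta>0_def)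
  have \<theta>0k: "induced_onorm \<nu> (param_mat t0 k) \<le> \<theta>0" for k unfolding \<theta>0_def by (rule max.coboundedI2) simp
  define \<theta> where "\<theta> = (1 + \<theta>0) / 2"
  have \<theta>: "0 < \<theta>" "\<theta> < 1" "\<theta>0 < \<theta>" using \<theta>0 by (auto simp: \<theta>_def)
  \<comment> \<open>A change of the matrix by \<open>e\<close> in Frobenius norm changes its bound
    with respect to \<open>\<nu>\<close> by at most
    \<open>M * e / c = \<theta> - \<theta>0\<close>.\<close>
  define e where "e = (\<theta> - \<theta>0) * c / M"
  have e: "0 < e" unfolding e_def using \<theta> cM by simp
  have ev: "\<forall>\<^sub>F t in nhds t0. \<forall>k. dist (param_mat t k) (param_mat t0 k) < e"
    using e by (intro eventually_all_finite tendstoD[OF tendsto_param_mat])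
  have "\<forall>\<^sub>F t in nhds t0. \<forall>w. norm (word_mat t w) \<le> (2 * M / c) * \<theta> ^ length w"
    using ev
  proof eventually_elim
    case (elim t)
    have step: "\<nu> (param_mat t k *v x) \<le> \<theta> * \<nu> x" for k x
    proof -
      have "param_mat t k *v x = param_mat t0 k *v x + (param_mat t k - param_mat t0 k) *v x"
        by (simp add: matrix_vector_mult_diff_rdistrib)
      then have "\<nu> (param_mat t k *v x) \<le> \<nu> (param_mat t0 k *v x) + \<nu> ((param_mat t k - param_mat t0 k) *v x)"
        using n0(4) by metis
      also have "\<nu> (param_mat t0 k *v x) \<le> \<theta>0 * \<nu> x"
        using ind[of "param_mat t0 k" x] \<theta>0k[of k] n0(1)[of x] by (meson mult_right_mono order_trans)
      also have "\<nu> ((param_mat t k - param_mat t0 k) *v x) \<le> (M * e / c) * \<nu> x"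
      proof -
        have "M * norm (param_mat t k - param_mat t0 k) / c \<le> M * e / c"
          using elim[rule_format, of k] cM by (intro divide_right_mono mult_left_mono) (auto simp: dist_norm)
        then show ?thesis using mat[of "param_mat t k - param_mat t0 k" x] n0(1)[of x] by (meson mult_right_mono order_trans)
      qed
      also have "\<theta>0 * \<nu> x + (M * e / c) * \<nu> x = \<theta> * \<nu> x"
      proof -
        have "M * e / c = \<theta> - \<theta>0" unfolding e_def using cM(1,2) by simp
        then have "(M * e / c) * \<nu> x = (\<theta> - \<theta>0) * \<nu> x" by (rule arg_cong)
        then show ?thesis by (simp only: left_diff_distrib)
      qed
      finally show ?thesis by simp
    qed
    have word: "\<nu> (word_mat t w *v x) \<le> \<theta> ^ length w * \<nu> x" for w x
    proof (induction w)
      case Nil then show ?case by (simp add: word_mat_simps)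
    next
      case (Cons k w)
      have "\<nu> (word_mat t (k # w) *v x) \<le> \<theta> * \<nu> (word_mat t w *v x)"
        using step[of k "word_mat t w *v x"] by (simp add: word_mat_simps matrix_vector_mul_assoc)
      also have "\<dots> \<le> \<theta> * (\<theta> ^ length w * \<nu> x)" using Cons \<theta> by (intro mult_left_mono) auto
      finally show ?case by simp
    qed
    have nw: "norm (word_mat t w *v axis i 1) \<le> (M / c) * \<theta> ^ length w" for w i
    proof -
      have "c * norm (word_mat t w *v axis i 1) \<le> \<theta> ^ length w * \<nu> (axis i 1)" using cM(3) word order_trans by blast
      also have "\<dots> \<le> \<theta> ^ length w * (M * 1)" using cM(4)[of "axis i 1"] \<theta> by (intro mult_left_mono) auto
      finally show ?thesis using cM(1) by (simp add: field_simps)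
    qed
    show ?case
    proof
      fix w show "norm (word_mat t w) \<le> (2 * M / c) * \<theta> ^ length w"
        using matrix_norm_columns[of "word_mat t w"] nw[of w 1] nw[of w 2] by simp
    qed
  qed
  then show ?thesis using that[of "2 * M / c" \<theta>] cM \<theta> by simp
qed

subsection \<open>Positive coordinates\<close>

text \<open>Complex powers through principal logarithms: the power \<open>a\<close> of the factor by
  which the second coordinate grows under a letter, times the power \<open>b\<close> of the
  determinant.\<close>

definition weight :: "('k \<Rightarrow> complex) \<Rightarrow> ('k \<Rightarrow> complex) \<Rightarrow> ('k \<Rightarrow> complex) \<Rightarrow> ('k \<Rightarrow> complex) \<Rightarrow> ('k \<Rightarrow> complex) \<Rightarrow> complex \<Rightarrow> complex \<Rightarrow> 'k \<Rightarrow> 'k list \<Rightarrow> complex" where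
  "weight al be ga de D a b k w = exp (a * Ln (ga k * mobius_orbit al be ga de w + de k) + b * Ln (D k))"

definition weight_sum :: "('k::finite \<Rightarrow> complex) \<Rightarrow> ('k \<Rightarrow> complex) \<Rightarrow> ('k \<Rightarrow> complex) \<Rightarrow> ('k \<Rightarrow> complex) \<Rightarrow> ('k \<Rightarrow> complex) \<Rightarrow> complex \<Rightarrow> complex \<Rightarrow> nat \<Rightarrow> 'k list \<Rightarrow> complex" where
  "weight_sum al be ga de D a b n = ((transfer (#) (weight al be ga de D a b)) ^^ n) (\<lambda>_. 1)"

lemma weight_sum_Suc:
  "weight_sum al be ga de D a b (Suc n) w = (\<Sum>k\<in>UNIV. weight al be ga de D a b k w * weight_sum al be ga de D a b n (k # w))"
  by (simp add: weight_sum_def transfer_def)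

lemma weight_sum_0: "weight_sum al be ga de D a b 0 w = 1"
  by (simp add: weight_sum_def)

lemma holomorphic_mobius_orbit:
  assumes hol: "\<And>k. (\<lambda>z. al z k) holomorphic_on S" "\<And>k. (\<lambda>z. be z k) holomorphic_on S"
      "\<And>k. (\<lambda>z. ga z k) holomorphic_on S" "\<And>k. (\<lambda>z. de z k) holomorphic_on S"
    and E: "\<And>z k w. z \<in> S \<Longrightarrow> 0 < Re (ga z k * mobius_orbit (al z) (be z) (ga z) (de z) w + de z k)"
  shows "(\<lambda>z. mobius_orbit (al z) (be z) (ga z) (de z) w) holomorphic_on S"
proof (induction w)
  case (Cons k w)
  have "ga z k * mobius_orbit (al z) (be z) (ga z) (de z) w + de z k \<noteq> 0" if "z \<in> S" for z
    using E[OF that, of k w] by (metis less_irrefl zero_complex.sel(1))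
  then show ?case unfolding mobius_orbit.simps using Cons hol by (intro holomorphic_intros) auto
qed simp

lemma holomorphic_weight_sum:
  assumes hol: "\<And>k. (\<lambda>z. al z k) holomorphic_on S" "\<And>k. (\<lambda>z. be z k) holomorphic_on S"
      "\<And>k. (\<lambda>z. ga z k) holomorphic_on S" "\<And>k. (\<lambda>z. de z k) holomorphic_on S" "\<And>k. (\<lambda>z. D z k) holomorphic_on S"
      "a holomorphic_on S" "b holomorphic_on S"
    and E: "\<And>z k w. z \<in> S \<Longrightarrow> 0 < Re (ga z k * mobius_orbit (al z) (be z) (ga z) (de z) w + de z k)"
    and D: "\<And>z k. z \<in> S \<Longrightarrow> 0 < Re (D z k)"
  shows "(\<lambda>z. weight_sum (al z) (be z) (ga z) (de z) (D z) (a z) (b z) n w) holomorphic_on S"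
proof (induction n arbitrary: w)
  case (Suc n)
  have "ga z k * mobius_orbit (al z) (be z) (ga z) (de z) w + de z k \<notin> \<real>\<^sub>\<le>\<^sub>0" if "z \<in> S" for z k w
    using E[OF that, of k w] complex_nonpos_Reals_iff by fastforce
  moreover have "D z k \<notin> \<real>\<^sub>\<le>\<^sub>0" if "z \<in> S" for z k
    using D[OF that, of k] complex_nonpos_Reals_iff by fastforce
  ultimately show ?case unfolding weight_sum_Suc weight_def
    using Suc hol holomorphic_mobius_orbit[OF hol(1-4) E] by (intro holomorphic_intros) auto
qed (simp add: weight_sum_0)

lemma cross2_le: "\<bar>cross2 x y\<bar> \<le> norm x * norm y"
proof (rule power2_le_imp_le)
  have "(cross2 x y)\<^sup>2 \<le> (norm x * norm y)\<^sup>2"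
    using cauchy2[of "x$1" "y$2" "x$2" "- (y$1)"] unfolding power_mult_distrib norm_vec2_sq cross2_def by (simp add: add.commute)
  then show "\<bar>cross2 x y\<bar>\<^sup>2 \<le> (norm x * norm y)\<^sup>2" by simp
qed simp

locale cone_coordinates =
  fixes t :: "'n::finite param" and u v :: "real^2"
  assumes uv: "0 < cross2 u v"
    and pos: "\<And>k. 0 < cross2 (param_mat t k *v u) v" "\<And>k. 0 < cross2 (param_mat t k *v v) v"
      "\<And>k. 0 < cross2 u (param_mat t k *v u)" "\<And>k. 0 < cross2 u (param_mat t k *v v)"
    and det_nz: "\<And>k. det (param_mat t k) \<noteq> 0"
begin

text \<open>By Cramer's rule \<open>p\<close> and \<open>q\<close> are the coordinates in the basis
  \<open>u\<close>, \<open>v\<close>; see \<open>decomp\<close>.\<close>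

definition p where "p x = cross2 x v / cross2 u v"
definition q where "q x = cross2 u x / cross2 u v"

abbreviation "al k \<equiv> p (param_mat t k *v u)"
abbreviation "be k \<equiv> p (param_mat t k *v v)"
abbreviation "ga k \<equiv> q (param_mat t k *v u)"
abbreviation "de k \<equiv> q (param_mat t k *v v)"

lemma coeff_pos: "0 < al k" "0 < be k" "0 < ga k" "0 < de k"
  using uv pos[of k] by (simp_all add: p_def q_def)

lemma pq_add: "p (x + y) = p x + p y" "q (x + y) = q x + q y" "p (r *\<^sub>R x) = r * p x" "q (r *\<^sub>R x) = r * q x"
  by (simp_all add: p_def q_def cross2_add cross2_scale add_divide_distrib)

lemma decomp: "x = p x *\<^sub>R u + q x *\<^sub>R v"
proof -
  have "cross2 u v *\<^sub>R x = cross2 x v *\<^sub>R u + cross2 u x *\<^sub>R v"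
    by (simp add: vec_eq_iff forall_2 cross2_def algebra_simps)
  moreover have "x = (1 / cross2 u v) *\<^sub>R (cross2 u v *\<^sub>R x)" using uv by simp
  ultimately have "x = (1 / cross2 u v) *\<^sub>R (cross2 x v *\<^sub>R u + cross2 u x *\<^sub>R v)" by (simp only:)
  then show ?thesis using uv by (simp add: p_def q_def scaleR_add_right)
qed

lemma pq_matrix:
  "p (param_mat t k *v x) = al k * p x + be k * q x" "q (param_mat t k *v x) = ga k * p x + de k * q x"
proof -
  have "param_mat t k *v x = p x *\<^sub>R (param_mat t k *v u) + q x *\<^sub>R (param_mat t k *v v)"
    using arg_cong[OF decomp[of x], of "(*v) (param_mat t k)"]
    by (simp only: matrix_vector_right_distrib matrix_vector_mult_scaleR)
  then show "p (param_mat t k *v x) = al k * p x + be k * q x" "q (param_mat t k *v x) = ga k * p x + de k * q x"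
    by (simp_all add: pq_add mult.commute)
qed

definition W where "W w = word_mat t w *v (u + v)"

lemma W_simps: "W [] = u + v" "W (k # w) = param_mat t k *v W w"
  by (simp_all add: W_def word_mat_simps matrix_vector_mul_assoc)

lemma pq_uv: "p u = 1" "q u = 0" "p v = 0" "q v = 1"
  using uv by (simp_all add: p_def q_def cross2_self)

lemma pq_W: "p (W (k # w)) = al k * p (W w) + be k * q (W w)" "q (W (k # w)) = ga k * p (W w) + de k * q (W w)"
  unfolding W_simps by (rule pq_matrix)+

lemma W_pos: "0 < p (W w)" "0 < q (W w)"
proof -
  have "0 < p (W w) \<and> 0 < q (W w)"
  proof (induction w)
    case Nil show ?case by (simp add: W_simps pq_add pq_uv)
  next
    case (Cons k w)
    then show ?case unfolding pq_W using coeff_pos[of k] by (simp add: add_pos_pos)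
  qed
  then show "0 < p (W w)" "0 < q (W w)" by auto
qed

lemma orbit_eq: "mobius_orbit (\<lambda>k. of_real (al k)) (\<lambda>k. of_real (be k)) (\<lambda>k. of_real (ga k)) (\<lambda>k. of_real (de k)) w = of_real (p (W w) / q (W w))"
proof (induction w)
  case (Cons k w)
  have q: "q (W w) \<noteq> 0" using W_pos(2)[of w] by simp
  have e: "\<And>a b. a * (p (W w) / q (W w)) + b = (a * p (W w) + b * q (W w)) / q (W w)" using q by (simp add: field_simps)
  show ?case unfolding mobius_orbit.simps Cons of_real_mult[symmetric] of_real_add[symmetric] of_real_divide[symmetric]
      pq_W e using q by simp
qed (simp add: W_simps pq_add pq_uv)

text \<open>The denominator of the Moebius map at the orbit of \<open>w\<close> is the growth factor
  of the coordinate \<open>q\<close> when the letter is prepended. It is positive, so the principal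
  logarithm is the real one.\<close>

lemma weight_eq:
  "weight (\<lambda>k. of_real (al k)) (\<lambda>k. of_real (be k)) (\<lambda>k. of_real (ga k)) (\<lambda>k. of_real (de k)) 
     (\<lambda>k. of_real \<bar>det (param_mat t k)\<bar>) (of_real a) (of_real b) k w
   = of_real ((q (W (k # w)) / q (W w)) powr a * \<bar>det (param_mat t k)\<bar> powr b)"
proof -
  have q: "0 < q (W w)" "0 < q (W (k # w))" using W_pos(2) by auto
  have "ga k * (p (W w) / q (W w)) + de k = q (W (k # w)) / q (W w)"
    unfolding pq_W using q by (simp add: field_simps)
  then have "of_real (ga k) * mobius_orbit (\<lambda>k. of_real (al k)) (\<lambda>k. of_real (be k)) (\<lambda>k. of_real (ga k)) (\<lambda>k. of_real (de k)) w + of_real (de k) 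
      = (of_real (q (W (k # w)) / q (W w)) :: complex)"
    unfolding orbit_eq by (metis of_real_add of_real_mult)
  moreover have "0 < q (W (k # w)) / q (W w)" using q by simp
  ultimately show ?thesis unfolding weight_def using det_nz[of k] q
    by (simp only: Ln_of_real) (simp add: powr_def exp_add exp_of_real[symmetric] Ln_of_real)
qed

lemma words_1: "words (Suc 0) = range (\<lambda>k :: 'k. [k])"
  unfolding words_def by (auto simp: length_Suc_conv)

text \<open>Growth factors telescope along a word. The operator prepends letters to \<open>x\<close>
  one at a time, so the first letter it adds is the last one of \<open>w\<close>; this is why the
  sum over words is split as \<open>w @ [k]\<close>.\<close>

lemma weight_sum_eq:
  "weight_sum (\<lambda>k. of_real (al k)) (\<lambda>k. of_real (be k)) (\<lambda>k. of_real (ga k)) (\<lambda>k. of_real (de k)) 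
     (\<lambda>k. of_real \<bar>det (param_mat t k)\<bar>) (of_real a) (of_real b) n x
   = of_real (\<Sum>w\<in>words n. (q (W (w @ x)) / q (W x)) powr a * \<bar>det (word_mat t w)\<bar> powr b)"
proof (induction n arbitrary: x)
  case 0
  have "words 0 = {[] :: 'n list}" by (auto simp: words_def)
  then show ?case using W_pos(2)[of x] by (simp add: weight_sum_0 word_mat_simps)
next
  case (Suc n)
  have q: "0 < q (W w)" for w by (rule W_pos)
  have "(\<Sum>w\<in>words (Suc n). (q (W (w @ x)) / q (W x)) powr a * \<bar>det (word_mat t w)\<bar> powr b)
    = (\<Sum>w\<in>words (n + Suc 0). (q (W (w @ x)) / q (W x)) powr a * \<bar>det (word_mat t w)\<bar> powr b)" by simp
  also have "\<dots> = (\<Sum>w\<in>words n. \<Sum>k\<in>UNIV. (q (W (w @ k # x)) / q (W x)) powr a * \<bar>det (word_mat t (w @ [k]))\<bar> powr b)"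
    unfolding sum_words_add words_1 by (subst sum.reindex) (simp_all add: inj_def)
  also have "\<dots> = (\<Sum>k\<in>UNIV. \<Sum>w\<in>words n. (q (W (w @ k # x)) / q (W x)) powr a * \<bar>det (word_mat t (w @ [k]))\<bar> powr b)"
    by (rule sum.swap)
  also have "\<dots> = (\<Sum>k\<in>UNIV. ((q (W (k # x)) / q (W x)) powr a * \<bar>det (param_mat t k)\<bar> powr b) *
      (\<Sum>w\<in>words n. (q (W (w @ k # x)) / q (W (k # x))) powr a * \<bar>det (word_mat t w)\<bar> powr b))"
    unfolding sum_distrib_left
  proof (intro sum.cong refl)
    fix k w
    have "(q (W (w @ k # x)) / q (W x)) powr a = (q (W (k # x)) / q (W x)) powr a * (q (W (w @ k # x)) / q (W (k # x))) powr a"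
    proof -
      have "q (W (w @ k # x)) / q (W x) = (q (W (k # x)) / q (W x)) * (q (W (w @ k # x)) / q (W (k # x)))"
        using q[of "k # x"] by simp
      then show ?thesis using q[of x] q[of "k # x"] q[of "w @ k # x"] by (simp only: powr_mult)
    qed
    moreover have "\<bar>det (word_mat t (w @ [k]))\<bar> powr b = \<bar>det (word_mat t w)\<bar> powr b * \<bar>det (param_mat t k)\<bar> powr b"
      by (simp add: word_mat_append word_mat_simps det_mul abs_mult powr_mult)
    ultimately show "(q (W (w @ k # x)) / q (W x)) powr a * \<bar>det (word_mat t (w @ [k]))\<bar> powr b
      = (q (W (k # x)) / q (W x)) powr a * \<bar>det (param_mat t k)\<bar> powr b * ((q (W (w @ k # x)) / q (W (k # x))) powr a * \<bar>det (word_mat t w)\<bar> powr b)"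
      by simp
  qed
  finally show ?case unfolding weight_sum_Suc weight_eq Suc by simp
qed

lemma word_uv_nonneg: "0 \<le> p (word_mat t w *v u)" "0 \<le> q (word_mat t w *v u)" "0 \<le> p (word_mat t w *v v)" "0 \<le> q (word_mat t w *v v)"
proof -
  have "0 \<le> p (word_mat t w *v x) \<and> 0 \<le> q (word_mat t w *v x)" if "0 \<le> p x" "0 \<le> q x" for x
  proof (induction w)
    case Nil then show ?case using that by (simp add: word_mat_simps)
  next
    case (Cons k w)
    have "p (word_mat t (k # w) *v x) = al k * p (word_mat t w *v x) + be k * q (word_mat t w *v x)"
      "q (word_mat t (k # w) *v x) = ga k * p (word_mat t w *v x) + de k * q (word_mat t w *v x)"
      by (simp_all only: word_mat_simps matrix_vector_mul_assoc[symmetric] pq_matrix[of k "word_mat t w *v x"])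
    then show ?case using Cons coeff_pos[of k] by (simp add: add_nonneg_nonneg less_imp_le)
  qed
  then show "0 \<le> p (word_mat t w *v u)" "0 \<le> q (word_mat t w *v u)" "0 \<le> p (word_mat t w *v v)" "0 \<le> q (word_mat t w *v v)"
    using pq_uv by auto
qed

lemma p_le_q: obtains R where "0 < R" "\<And>w. p (W w) \<le> R * q (W w)"
proof -
  define R where "R = 1 + (\<Sum>k\<in>UNIV. al k / ga k + be k / de k)"
  have nn: "0 \<le> al k / ga k + be k / de k" for k using coeff_pos[of k] by (simp add: add_nonneg_nonneg less_imp_le)
  have R: "al k / ga k + be k / de k \<le> R" for k
    using member_le_sum[of k UNIV "\<lambda>k. al k / ga k + be k / de k"] nn unfolding R_def by simp
  have R1: "1 \<le> R" unfolding R_def using nn by (simp add: sum_nonneg)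
  have "p (W w) \<le> R * q (W w)" for w
  proof (cases w)
    case Nil then show ?thesis using R1 by (simp add: W_simps pq_add pq_uv)
  next
    case (Cons k x)
    have "0 \<le> al k / ga k" "0 \<le> be k / de k" using coeff_pos[of k] by (simp_all add: less_imp_le)
    then have "al k / ga k \<le> R" "be k / de k \<le> R" using R[of k] by linarith+
    then have "al k \<le> R * ga k" "be k \<le> R * de k" using coeff_pos[of k] by (simp_all add: pos_divide_le_eq)
    then have "al k * p (W x) + be k * q (W x) \<le> (R * ga k) * p (W x) + (R * de k) * q (W x)"
      using W_pos[of x] by (intro add_mono mult_right_mono) auto
    then show ?thesis unfolding Cons pq_W by (simp add: algebra_simps)
  qed
  then show ?thesis using that[of R] R1 by simp
qed

text \<open>In the basis \<open>u\<close>, \<open>v\<close> all products have nonnegative entries,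
  so nothing cancels: the coordinates of the image of \<open>u + v\<close> dominate those of the
  images of \<open>u\<close> and \<open>v\<close>, hence the whole matrix. The first coordinate is
  absorbed by \<open>p_le_q\<close>, because a positive matrix maps the quadrant into a proper
  sector.\<close>

lemma q_comparable:
  obtains c C where "0 < c" "0 < C" "\<And>w. c * norm (word_mat t w) \<le> q (W w)" "\<And>w. q (W w) \<le> C * norm (word_mat t w)"
proof -
  obtain R where R: "0 < R" "\<And>w. p (W w) \<le> R * q (W w)" using p_le_q by blast
  \<comment> \<open>The coordinates of the standard basis vectors carry the estimate from
    \<open>u\<close> and \<open>v\<close> to the columns; the final 1 keeps \<open>B\<close>
    positive.\<close>
  define B where "B = (\<bar>p (axis 1 1)\<bar> + \<bar>q (axis 1 1)\<bar> + \<bar>p (axis 2 1)\<bar> + \<bar>q (axis 2 1)\<bar>) * (R * norm u + norm v) + 1"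
  have B: "1 \<le> B" unfolding B_def using R by simp
  have up: "norm (word_mat t w) \<le> B * q (W w)" for w
  proof -
    have sum: "p (W w) = p (word_mat t w *v u) + p (word_mat t w *v v)" "q (W w) = q (word_mat t w *v u) + q (word_mat t w *v v)"
      by (simp_all add: W_def matrix_vector_right_distrib pq_add)
    have nb: "norm (word_mat t w *v x) \<le> (R * norm u + norm v) * q (W w)" if "x = u \<or> x = v" for x
    proof -
      have pp: "0 \<le> p (word_mat t w *v x)" "p (word_mat t w *v x) \<le> R * q (W w)" "0 \<le> q (word_mat t w *v x)" "q (word_mat t w *v x) \<le> q (W w)"
        using that word_uv_nonneg[of w] sum R(2)[of w] by auto
      have "norm (word_mat t w *v x) \<le> \<bar>p (word_mat t w *v x)\<bar> * norm u + \<bar>q (word_mat t w *v x)\<bar> * norm v"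
        using arg_cong[OF decomp[of "word_mat t w *v x"], of norm]
          norm_triangle_ineq[of "p (word_mat t w *v x) *\<^sub>R u" "q (word_mat t w *v x) *\<^sub>R v"] by simp
      also have "\<dots> \<le> (R * q (W w)) * norm u + q (W w) * norm v"
        using pp by (intro add_mono mult_right_mono) auto
      finally show ?thesis by (simp add: algebra_simps)
    qed
    define L where "L = (R * norm u + norm v) * q (W w)"
    have na: "norm (word_mat t w *v x) \<le> (\<bar>p x\<bar> + \<bar>q x\<bar>) * L" for x
    proof -
      have "word_mat t w *v x = p x *\<^sub>R (word_mat t w *v u) + q x *\<^sub>R (word_mat t w *v v)"
        using arg_cong[OF decomp[of x], of "(*v) (word_mat t w)"]
        by (simp only: matrix_vector_right_distrib matrix_vector_mult_scaleR)
      then have "norm (word_mat t w *v x) \<le> \<bar>p x\<bar> * norm (word_mat t w *v u) + \<bar>q x\<bar> * norm (word_mat t w *v v)"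
        by (metis norm_triangle_ineq norm_scaleR)
      also have "\<dots> \<le> \<bar>p x\<bar> * L + \<bar>q x\<bar> * L" unfolding L_def using nb by (intro add_mono mult_left_mono) auto
      finally show ?thesis by (simp add: distrib_right)
    qed
    have "norm (word_mat t w) \<le> (\<bar>p (axis 1 1)\<bar> + \<bar>q (axis 1 1)\<bar>) * L + (\<bar>p (axis 2 1)\<bar> + \<bar>q (axis 2 1)\<bar>) * L"
      using matrix_norm_columns[of "word_mat t w"] na[of "axis 1 1"] na[of "axis 2 1"] by linarith
    also have "\<dots> = (B - 1) * q (W w)" unfolding B_def L_def by (simp add: algebra_simps)
    also have "\<dots> \<le> B * q (W w)" using W_pos(2)[of w] by (intro mult_right_mono) auto
    finally show ?thesis .
  qed
  define C where "C = norm u * norm (u + v) / cross2 u v + 1"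
  have C: "0 < C" unfolding C_def using uv by (simp add: add_nonneg_pos)
  have lo: "q (W w) \<le> C * norm (word_mat t w)" for w
  proof -
    have "q (W w) \<le> norm u * norm (W w) / cross2 u v"
      unfolding q_def using cross2_le[of u "W w"] uv by (intro divide_right_mono) auto
    also have "\<dots> \<le> norm u * (norm (word_mat t w) * norm (u + v)) / cross2 u v"
      unfolding W_def using uv norm_matrix_vector_le by (intro divide_right_mono mult_left_mono) auto
    also have "\<dots> \<le> C * norm (word_mat t w)" unfolding C_def by (simp add: algebra_simps)
    finally show ?thesis .
  qed
  have "1 / B * norm (word_mat t w) \<le> q (W w)" for w using up[of w] B by (simp add: field_simps)
  then show ?thesis using that[of "1 / B" C] B C lo by simp
qed

definition Zr where "Zr a b n = (\<Sum>w\<in>words n. q (W w) powr a * \<bar>det (word_mat t w)\<bar> powr b)"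

lemma Zr_pos: "0 < Zr a b n"
  unfolding Zr_def using words_nonempty W_pos(2) det_word_mat_nz[OF det_nz]
  by (intro sum_pos mult_pos_pos) (auto simp: less_imp_neq[symmetric])

lemma Zr_weight_sum:
  "weight_sum (\<lambda>k. of_real (al k)) (\<lambda>k. of_real (be k)) (\<lambda>k. of_real (ga k)) (\<lambda>k. of_real (de k)) 
     (\<lambda>k. of_real \<bar>det (param_mat t k)\<bar>) (of_real a) (of_real b) n [] = of_real (Zr a b n)"
  unfolding weight_sum_eq Zr_def by (simp add: W_simps pq_add pq_uv)

lemma Zr_growth:
  assumes s: "0 \<le> s"
  shows "(\<lambda>n. ln (Zr (norm_exponent s) (det_exponent s) n) / real n) \<longlonglongrightarrow> log_pressure s t"
proof -
  obtain c C where c: "0 < c" "0 < C" "\<And>w. c * norm (word_mat t w) \<le> q (W w)" "\<And>w. q (W w) \<le> C * norm (word_mat t w)"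
    using q_comparable by blast
  define a b where "a = norm_exponent s" and "b = det_exponent s"
  have a: "0 \<le> a" unfolding a_def using exponents(3) s by simp
  show ?thesis unfolding a_def[symmetric] b_def[symmetric]
  proof (rule log_pressure_comparable[OF det_nz s, where c = "c powr a" and C = "C powr a"])
    fix n
    show "c powr a * svf_sum s t n \<le> Zr a b n"
      unfolding svf_sum_def Zr_def sum_distrib_left svf_norm_def a_def[symmetric] b_def[symmetric]
    proof (rule sum_mono)
      fix w
      have "c powr a * norm (word_mat t w) powr a = (c * norm (word_mat t w)) powr a" using c by (simp add: powr_mult)
      also have "\<dots> \<le> q (W w) powr a" using c a by (intro powr_mono2) auto
      finally show "c powr a * (norm (word_mat t w) powr a * \<bar>det (word_mat t w)\<bar> powr b) \<le> q (W w) powr a * \<bar>det (word_mat t w)\<bar> powr b"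
        unfolding mult.assoc[symmetric] by (intro mult_right_mono) auto
    qed
    show "Zr a b n \<le> C powr a * svf_sum s t n"
      unfolding svf_sum_def Zr_def sum_distrib_left svf_norm_def a_def[symmetric] b_def[symmetric]
    proof (rule sum_mono)
      fix w
      have "q (W w) powr a \<le> (C * norm (word_mat t w)) powr a" using c a W_pos(2)[of w] by (intro powr_mono2) auto
      also have "\<dots> = C powr a * norm (word_mat t w) powr a" using c by (simp add: powr_mult)
      finally show "q (W w) powr a * \<bar>det (word_mat t w)\<bar> powr b \<le> C powr a * (norm (word_mat t w) powr a * \<bar>det (word_mat t w)\<bar> powr b)"
        unfolding mult.assoc[symmetric] by (intro mult_right_mono) auto
    qed
  qed (use c in simp)
qed

end

subsection \<open>Complexification of the pressure\<close>

text \<open>The pullback along one real function that bounds the exponent shift and the coordinates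
  in \<open>B\<close>: what holds eventually then holds on a polydisc with the same radius in every
  variable.\<close>

definition polydisc_filter :: "'b set \<Rightarrow> (complex \<times> ('b \<Rightarrow> complex)) filter" where
  "polydisc_filter B = filtercomap (\<lambda>p. norm (fst p) + (\<Sum>b\<in>B. norm (snd p b))) (nhds 0)"

lemma tendsto_polydisc_filter:
  assumes "finite B"
  shows "(fst \<longlongrightarrow> 0) (polydisc_filter B)" "b \<in> B \<Longrightarrow> ((\<lambda>p. snd p b) \<longlongrightarrow> 0) (polydisc_filter B)"
proof -
  have l: "((\<lambda>p. norm (fst p) + (\<Sum>b\<in>B. norm (snd p b))) \<longlongrightarrow> 0) (polydisc_filter B)"
    unfolding polydisc_filter_def by (rule filterlim_filtercomap)
  show "(fst \<longlongrightarrow> 0) (polydisc_filter B)"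
    by (rule Lim_null_comparison[OF _ l]) (simp add: sum_nonneg)
  assume b: "b \<in> B"
  have "norm (snd p b) \<le> norm (fst p) + (\<Sum>b\<in>B. norm (snd p b))" for p :: "complex \<times> ('a \<Rightarrow> complex)"
  proof -
    have "norm (snd p b) \<le> (\<Sum>b\<in>B. norm (snd p b))" using b assms by (intro member_le_sum) auto
    then show ?thesis using norm_ge_zero[of "fst p"] by linarith
  qed
  then show "((\<lambda>p. snd p b) \<longlongrightarrow> 0) (polydisc_filter B)"
    by (intro Lim_null_comparison[OF _ l] always_eventually allI)
qed

lemma eventually_polydisc_filter:
  assumes "finite B" "eventually P (polydisc_filter B)"
  shows "\<exists>R>0. \<forall>\<xi> \<tau>. norm \<xi> < R \<longrightarrow> \<tau> \<in> polydisc B R \<longrightarrow> P (\<xi>, \<tau>)"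
proof -
  obtain P' where P': "eventually P' (nhds (0::real))" 
    "\<And>p. P' (norm (fst p) + (\<Sum>b\<in>B. norm (snd p b))) \<Longrightarrow> P p"
    using assms(2) unfolding polydisc_filter_def eventually_filtercomap by blast
  obtain e where e: "0 < e" "\<And>x. \<bar>x\<bar> < e \<Longrightarrow> P' x"
    using P'(1) unfolding eventually_nhds_metric by (auto simp: dist_real_def)
  define R where "R = e / (real (card B) + 1)"
  have R: "0 < R" "(real (card B) + 1) * R = e" using e by (auto simp: R_def add_nonneg_pos)
  show ?thesis
  proof (intro exI[of _ R] conjI allI impI R(1))
    fix \<xi> :: complex and \<tau> :: "'a \<Rightarrow> complex" assume x: "norm \<xi> < R" and t: "\<tau> \<in> polydisc B R"
    have "(\<Sum>b\<in>B. norm (\<tau> b)) \<le> (\<Sum>b\<in>B. R)" using t by (intro sum_mono) (auto simp: polydisc_def less_imp_le)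
    then have "norm \<xi> + (\<Sum>b\<in>B. norm (\<tau> b)) < e" using x R(2) by (simp add: algebra_simps)
    moreover have "0 \<le> norm \<xi> + (\<Sum>b\<in>B. norm (\<tau> b))" by (simp add: sum_nonneg)
    ultimately show "P (\<xi>, \<tau>)" using e(2) P'(2)[of "(\<xi>, \<tau>)"] by simp
  qed
qed

section \<open>Matrices with complex entries\<close>

definition cparam :: "'n::finite param \<Rightarrow> ('n param \<Rightarrow> complex) \<Rightarrow> 'n \<Rightarrow> 4 \<Rightarrow> complex" where
  "cparam t \<tau> k j = of_real (t $ k $ j) + \<tau> (axis k (axis j 1))"

definition cform :: "real^2 \<Rightarrow> real^2 \<Rightarrow> (4 \<Rightarrow> complex) \<Rightarrow> complex" where
  "cform a b x = (x 1 * of_real (a$1) + x 2 * of_real (a$2)) * of_real (b$2) - (x 3 * of_real (a$1) + x 4 * of_real (a$2)) * of_real (b$1)"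

definition cdet :: "(4 \<Rightarrow> complex) \<Rightarrow> complex" where
  "cdet x = x 1 * x 4 - x 2 * x 3"

lemma cform_real: "cform a b (\<lambda>j. of_real (t $ k $ j)) = of_real (cross2 (param_mat t k *v a) b)"
  by (simp add: cform_def cross2_def matrix_vector_mult_2 param_mat_nth)

lemma cdet_real: "cdet (\<lambda>j. of_real (t $ k $ j)) = of_real (det (param_mat t k))"
  by (simp add: cdet_def det_2 param_mat_nth)

lemma axis_axis_Basis: "axis k (axis j (1::real)) \<in> Basis"
  by (simp add: axis_in_Basis_iff)

lemma cparam_coords: "cparam t (complex_coords h) k = (\<lambda>j. of_real ((t + h) $ k $ j))"
  using axis_axis_Basis by (auto simp: cparam_def complex_coords_def inner_axis)

lemma holomorphic_cparam:
  "(\<lambda>z. cparam t (\<tau>(b := z)) k j) holomorphic_on S"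
  unfolding cparam_def by (cases "axis k (axis j 1) = b") (auto intro!: holomorphic_intros)

lemma holomorphic_cform: "(\<And>j. (\<lambda>z. x z j) holomorphic_on S) \<Longrightarrow> (\<lambda>z. cform a b (x z)) holomorphic_on S"
  unfolding cform_def by (intro holomorphic_intros)

lemma holomorphic_cdet: "(\<And>j. (\<lambda>z. x z j) holomorphic_on S) \<Longrightarrow> (\<lambda>z. cdet (x z)) holomorphic_on S"
  unfolding cdet_def by (intro holomorphic_intros)

lemma tendsto_cparam: "((\<lambda>p. cparam t (snd p) k j) \<longlongrightarrow> of_real (t $ k $ j)) (polydisc_filter Basis)"
proof -
  have "((\<lambda>p. cparam t (snd p) k j) \<longlongrightarrow> of_real (t $ k $ j) + 0) (polydisc_filter Basis)"
    unfolding cparam_def by (intro tendsto_intros tendsto_polydisc_filter finite_Basis axis_axis_Basis)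
  then show ?thesis by simp
qed

lemma tendsto_cform: "((\<lambda>p. cform a b (cparam t (snd p) k)) \<longlongrightarrow> of_real (cross2 (param_mat t k *v a) b)) (polydisc_filter Basis)"
  unfolding cform_real[symmetric] unfolding cform_def by (intro tendsto_intros tendsto_cparam)

lemma tendsto_cdet: "((\<lambda>p. cdet (cparam t (snd p) k)) \<longlongrightarrow> of_real (det (param_mat t k))) (polydisc_filter Basis)"
  unfolding cdet_real[symmetric] unfolding cdet_def by (intro tendsto_intros tendsto_cparam)

lemma norm_Ln_le:
  assumes "0 < c" "c \<le> Re z" "norm z \<le> C"
  shows "norm (Ln z) \<le> \<bar>ln c\<bar> + \<bar>ln C\<bar> + pi"
proof -
  have z: "c \<le> norm z" "z \<noteq> 0" using assms complex_Re_le_cmod[of z] by auto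
  then have "ln c \<le> ln (norm z)" "ln (norm z) \<le> ln C" using assms by auto
  then have "\<bar>Re (Ln z)\<bar> \<le> \<bar>ln c\<bar> + \<bar>ln C\<bar>" using z by simp
  moreover have "\<bar>Im (Ln z)\<bar> \<le> pi" using z mpi_less_Im_Ln[of z] Im_Ln_le_pi[of z] by simp
  ultimately show ?thesis using cmod_le[of "Ln z"] by linarith
qed

lemma cross2_swap: "cross2 x y = - cross2 y x" by (simp add: cross2_def)

lemma complex_coords_polydisc: "norm h < R \<Longrightarrow> complex_coords h \<in> polydisc Basis R"
  using le_less_trans[OF Basis_le_norm[of _ h]] by (auto simp: polydisc_def complex_coords_def)

text \<open>\<open>Q n\<close> is the logarithm of an iterate divided by \<open>n\<close>. An
  iterate may wind around the origin, so its logarithm is assembled from principal logarithms of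
  consecutive ratios, each in a compact part of the right half-plane. This makes \<open>Q n\<close>
  holomorphic in every variable with a bound independent of \<open>n\<close>; at real arguments the
  sum telescopes to the real logarithm.\<close>

lemma (in cone_coordinates) complex_approximants:
  "\<exists>R M Q. 0 < R \<and>
    (\<forall>n \<xi> \<tau>. norm \<xi> < R \<longrightarrow> \<tau> \<in> polydisc Basis R \<longrightarrow> norm (Q n \<xi> \<tau> :: complex) \<le> M) \<and>
    (\<forall>n \<tau>. \<tau> \<in> polydisc Basis R \<longrightarrow> (\<lambda>\<xi>. Q n \<xi> \<tau>) holomorphic_on ball 0 R) \<and>
    (\<forall>n \<xi> \<tau> b. norm \<xi> < R \<longrightarrow> \<tau> \<in> polydisc Basis R \<longrightarrow> b \<in> Basis \<longrightarrow> (\<lambda>z. Q n \<xi> (\<tau>(b := z))) holomorphic_on ball 0 R) \<and>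
    (\<forall>x h. \<bar>x\<bar> < R \<longrightarrow> norm h < R \<longrightarrow> cone_coordinates (t + h) u v \<longrightarrow> 
       (\<forall>k. sgn (det (param_mat (t + h) k)) = sgn (det (param_mat t k))) \<longrightarrow> 0 \<le> s + x \<longrightarrow>
       norm_exponent (s + x) = a0 + a1 * x \<longrightarrow> det_exponent (s + x) = b0 + b1 * x \<longrightarrow>
       (\<lambda>n. Q n (of_real x) (complex_coords h)) \<longlonglongrightarrow> of_real (log_pressure (s + x) (t + h)))"
proof -
  define \<delta> where "\<delta> = cross2 u v"
  \<comment> \<open>The coordinates \<open>p\<close> and \<open>q\<close> of the images of
    \<open>u\<close> and \<open>v\<close>, complexified; the minus signs exchange the arguments of
    \<open>cross2\<close> in \<open>q\<close>.\<close>
  define Al Be Ga De where "Al \<tau> k = cform u v (cparam t \<tau> k) / of_real \<delta>"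
    and "Be \<tau> k = cform v v (cparam t \<tau> k) / of_real \<delta>" and "Ga \<tau> k = - cform u u (cparam t \<tau> k) / of_real \<delta>"
    and "De \<tau> k = - cform v u (cparam t \<tau> k) / of_real \<delta>" for \<tau> k
  \<comment> \<open>The modulus of the determinant is not holomorphic, but near \<open>t\<close> it
    is the determinant times a constant sign.\<close>
  define Dc where "Dc \<tau> k = of_real (sgn (det (param_mat t k))) * cdet (cparam t \<tau> k)" for \<tau> k
  \<comment> \<open>The exponents continued affinely to complex \<open>\<xi>\<close>; they are the
    true ones as long as \<open>s + x\<close> stays where both are affine.\<close>
  define Ac Bc where "Ac \<xi> = of_real a0 + of_real a1 * \<xi>" and "Bc \<xi> = of_real b0 + of_real b1 * \<xi>" for \<xi> :: complex
  have \<delta>: "0 < \<delta>" "of_real \<delta> \<noteq> (0::complex)" using uv by (simp_all add: \<delta>_def)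
  define WS where "WS p n w = weight_sum (Al (snd p)) (Be (snd p)) (Ga (snd p)) (De (snd p)) (Dc (snd p)) (Ac (fst p)) (Bc (fst p)) n w" for p n w
  interpret pp: positive_perturbation "\<lambda>p. Al (snd p)" "\<lambda>p. Be (snd p)" "\<lambda>p. Ga (snd p)" "\<lambda>p. De (snd p)" "\<lambda>p. Dc (snd p)"
    al be ga de "\<lambda>k. \<bar>det (param_mat t k)\<bar>" "\<lambda>p. Ac (fst p)" "\<lambda>p. Bc (fst p)" a0 b0 "polydisc_filter (Basis :: 'n param set)"
  proof
    fix k
    have "((\<lambda>p. Al (snd p) k) \<longlongrightarrow> of_real (cross2 (param_mat t k *v u) v) / of_real \<delta>) (polydisc_filter (Basis :: 'n param set))"
      unfolding Al_def using \<delta> by (intro tendsto_intros tendsto_cform)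
    then show "((\<lambda>p. Al (snd p) k) \<longlongrightarrow> of_real (al k)) (polydisc_filter (Basis :: 'n param set))" by (simp add: p_def \<delta>_def)
    have "((\<lambda>p. Be (snd p) k) \<longlongrightarrow> of_real (cross2 (param_mat t k *v v) v) / of_real \<delta>) (polydisc_filter (Basis :: 'n param set))"
      unfolding Be_def using \<delta> by (intro tendsto_intros tendsto_cform)
    then show "((\<lambda>p. Be (snd p) k) \<longlongrightarrow> of_real (be k)) (polydisc_filter (Basis :: 'n param set))" by (simp add: p_def \<delta>_def)
    have "((\<lambda>p. Ga (snd p) k) \<longlongrightarrow> - of_real (cross2 (param_mat t k *v u) u) / of_real \<delta>) (polydisc_filter (Basis :: 'n param set))"
      unfolding Ga_def using \<delta> by (intro tendsto_intros tendsto_cform)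
    then show "((\<lambda>p. Ga (snd p) k) \<longlongrightarrow> of_real (ga k)) (polydisc_filter (Basis :: 'n param set))"
      using cross2_swap[of u "param_mat t k *v u"] by (simp add: q_def \<delta>_def)
    have "((\<lambda>p. De (snd p) k) \<longlongrightarrow> - of_real (cross2 (param_mat t k *v v) u) / of_real \<delta>) (polydisc_filter (Basis :: 'n param set))"
      unfolding De_def using \<delta> by (intro tendsto_intros tendsto_cform)
    then show "((\<lambda>p. De (snd p) k) \<longlongrightarrow> of_real (de k)) (polydisc_filter (Basis :: 'n param set))"
      using cross2_swap[of u "param_mat t k *v v"] by (simp add: q_def \<delta>_def)
    have "((\<lambda>p. Dc (snd p) k) \<longlongrightarrow> of_real (sgn (det (param_mat t k))) * of_real (det (param_mat t k))) (polydisc_filter (Basis :: 'n param set))"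
      unfolding Dc_def by (intro tendsto_intros tendsto_cdet)
    moreover have "of_real (sgn (det (param_mat t k))) * of_real (det (param_mat t k)) = (of_real \<bar>det (param_mat t k)\<bar> :: complex)"
      by (simp only: of_real_mult[symmetric] abs_sgn mult.commute)
    ultimately show "((\<lambda>p. Dc (snd p) k) \<longlongrightarrow> of_real \<bar>det (param_mat t k)\<bar>) (polydisc_filter (Basis :: 'n param set))" by simp
    show "0 < al k" "0 < be k" "0 < ga k" "0 < de k" "0 < \<bar>det (param_mat t k)\<bar>" using coeff_pos[of k] det_nz[of k] by simp_all
  next
    have "((\<lambda>p. Ac (fst p)) \<longlongrightarrow> of_real a0 + of_real a1 * 0) (polydisc_filter (Basis :: 'n param set))"
      unfolding Ac_def by (intro tendsto_intros tendsto_polydisc_filter finite_Basis)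
    then show "((\<lambda>p. Ac (fst p)) \<longlongrightarrow> of_real a0) (polydisc_filter (Basis :: 'n param set))" by simp
    have "((\<lambda>p. Bc (fst p)) \<longlongrightarrow> of_real b0 + of_real b1 * 0) (polydisc_filter (Basis :: 'n param set))"
      unfolding Bc_def by (intro tendsto_intros tendsto_polydisc_filter finite_Basis)
    then show "((\<lambda>p. Bc (fst p)) \<longlongrightarrow> of_real b0) (polydisc_filter (Basis :: 'n param set))" by simp
  qed
  have UW: "pp.U p n w = WS p n w" for p n w
    unfolding pp.U_def WS_def weight_sum_def weight_def pp.\<Lambda>_def pp.E_def pp.Z_def ..
  obtain c C where c: "0 < c" and ev: "\<forall>\<^sub>F p in polydisc_filter Basis. (\<forall>k w. 0 < Re (pp.Z p w) \<and> 0 < Re (pp.E p k w)) \<and> (\<forall>k. 0 < Re (Dc (snd p) k)) \<and>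
     (\<forall>n w. WS p n w \<noteq> 0 \<and> c \<le> Re (WS p (Suc n) w / WS p n w) \<and> norm (WS p (Suc n) w / WS p n w) \<le> C)"
    using pp.ratio_bounds unfolding UW by (elim exE conjE)
  obtain R where R: "0 < R" and good': "\<forall>\<xi> \<tau>. norm \<xi> < R \<longrightarrow> \<tau> \<in> polydisc Basis R \<longrightarrow>
     (\<forall>k w. 0 < Re (pp.Z (\<xi>, \<tau>) w) \<and> 0 < Re (pp.E (\<xi>, \<tau>) k w)) \<and> (\<forall>k. 0 < Re (Dc (snd (\<xi>, \<tau>)) k)) \<and>
     (\<forall>n w. WS (\<xi>, \<tau>) n w \<noteq> 0 \<and> c \<le> Re (WS (\<xi>, \<tau>) (Suc n) w / WS (\<xi>, \<tau>) n w) \<and> norm (WS (\<xi>, \<tau>) (Suc n) w / WS (\<xi>, \<tau>) n w) \<le> C)"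
    using eventually_polydisc_filter[OF finite_Basis ev] by (elim exE conjE)
  note good = good'[unfolded snd_conv, rule_format]
  \<comment> \<open>\<open>Q 0 = 0\<close>, as division by zero yields zero; hence the separate
    cases below.\<close>
  define Q where "Q n \<xi> \<tau> = (\<Sum>j<n. Ln (WS (\<xi>, \<tau>) (Suc j) [] / WS (\<xi>, \<tau>) j [])) / of_nat n" for n \<xi> \<tau>
  define M where "M = \<bar>ln c\<bar> + \<bar>ln C\<bar> + pi"
  have M0: "0 \<le> M" unfolding M_def by (simp add: add_nonneg_nonneg)
  have bound: "norm (Q n \<xi> \<tau>) \<le> M" if "norm \<xi> < R" "\<tau> \<in> polydisc Basis R" for n \<xi> \<tau>
  proof (cases "n = 0")
    case False
    have "norm (\<Sum>j<n. Ln (WS (\<xi>, \<tau>) (Suc j) [] / WS (\<xi>, \<tau>) j [])) \<le> (\<Sum>j<n. M)"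
      unfolding M_def using good[OF that] c by (intro sum_norm_le norm_Ln_le) auto
    then show ?thesis using False unfolding Q_def by (simp add: norm_divide pos_divide_le_eq mult.commute)
  qed (simp add: Q_def M0)
  have holWS: "(\<lambda>z. Q n (f z) (g z)) holomorphic_on S"
    if f: "f holomorphic_on S" and g: "\<And>k j. (\<lambda>z. cparam t (g z) k j) holomorphic_on S"
      and fg: "\<And>z. z \<in> S \<Longrightarrow> norm (f z) < R \<and> g z \<in> polydisc Basis R" for n f g S
  proof -
    have W: "(\<lambda>z. WS (f z, g z) n w) holomorphic_on S" for n w
      unfolding WS_def fst_conv snd_conv
    proof (rule holomorphic_weight_sum)
      fix z k w assume z: "z \<in> S"
      note G = good[OF conjunct1[OF fg[OF z]] conjunct2[OF fg[OF z]]]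
      show "0 < Re (Ga (g z) k * mobius_orbit (Al (g z)) (Be (g z)) (Ga (g z)) (De (g z)) w + De (g z) k)"
      proof -
        have "0 < Re (pp.E (f z, g z) k w)" using G by blast
        then show ?thesis by (simp only: pp.E_def pp.Z_def snd_conv)
      qed
      show "0 < Re (Dc (g z) k)" using G by blast
    qed (unfold Al_def Be_def Ga_def De_def Dc_def Ac_def Bc_def, (intro holomorphic_intros holomorphic_cform holomorphic_cdet g f \<delta>(2))+)
    have nz: "WS (f z, g z) j [] \<noteq> 0" and nr: "WS (f z, g z) (Suc j) [] / WS (f z, g z) j [] \<notin> \<real>\<^sub>\<le>\<^sub>0" if z: "z \<in> S" for z j
    proof -
      note G = good[OF conjunct1[OF fg[OF z]] conjunct2[OF fg[OF z]]]
      show "WS (f z, g z) j [] \<noteq> 0" using G by blast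
      have "0 < Re (WS (f z, g z) (Suc j) [] / WS (f z, g z) j [])" using G c by (meson less_le_trans)
      then show "WS (f z, g z) (Suc j) [] / WS (f z, g z) j [] \<notin> \<real>\<^sub>\<le>\<^sub>0" unfolding complex_nonpos_Reals_iff by linarith
    qed
    show ?thesis
    proof (cases "n = 0")
      case False
      then show ?thesis unfolding Q_def using nz nr by (intro holomorphic_intros W) auto
    qed (simp add: Q_def)
  qed
  show ?thesis
  proof (rule exI[of _ R], rule exI[of _ M], rule exI[of _ Q], intro conjI allI impI R bound)
    fix n and \<tau> :: "'n param \<Rightarrow> complex" assume "\<tau> \<in> polydisc Basis R"
    then show "(\<lambda>\<xi>. Q n \<xi> \<tau>) holomorphic_on ball 0 R"
      by (intro holWS[where f = "\<lambda>z. z" and g = "\<lambda>_. \<tau>"]) auto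
  next
    fix n and \<xi> :: complex and b :: "'n param" and \<tau> :: "'n param \<Rightarrow> complex" assume x: "norm \<xi> < R" and t: "\<tau> \<in> polydisc Basis R" and b: "b \<in> Basis"
    show "(\<lambda>z. Q n \<xi> (\<tau>(b := z))) holomorphic_on ball 0 R"
      using x t b by (intro holWS[where f = "\<lambda>_. \<xi>" and g = "\<lambda>z. \<tau>(b := z)"] holomorphic_cparam) (auto simp: polydisc_def)
  next
    fix x and h :: "'n param" assume x: "\<bar>x\<bar> < R" and h: "norm h < R" and cc: "cone_coordinates (t + h) u v"
      and sg': "\<forall>k. sgn (det (param_mat (t + h) k)) = sgn (det (param_mat t k))" and s: "0 \<le> s + x"
      and ne: "norm_exponent (s + x) = a0 + a1 * x" and de: "det_exponent (s + x) = b0 + b1 * x"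
    note sg = sg'[rule_format]
    interpret c2: cone_coordinates "t + h" u v by (rule cc)
    define Zh where "Zh = c2.Zr (norm_exponent (s + x)) (det_exponent (s + x))"
    have Zp: "0 < Zh n" for n unfolding Zh_def by (rule c2.Zr_pos)
    have e: "Al (complex_coords h) = (\<lambda>k. of_real (c2.al k))" "Be (complex_coords h) = (\<lambda>k. of_real (c2.be k))"
      "Ga (complex_coords h) = (\<lambda>k. of_real (c2.ga k))" "De (complex_coords h) = (\<lambda>k. of_real (c2.de k))"
      unfolding Al_def Be_def Ga_def De_def cparam_coords cform_real c2.p_def c2.q_def \<delta>_def
      using cross2_swap[of u] by (auto simp del: vector_add_component)
    have d: "Dc (complex_coords h) = (\<lambda>k. of_real \<bar>det (param_mat (t + h) k)\<bar>)"
      unfolding Dc_def cparam_coords cdet_real by (simp only: sg[symmetric] of_real_mult[symmetric] abs_sgn mult.commute)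
    have ab: "Ac (of_real x) = of_real (norm_exponent (s + x))" "Bc (of_real x) = of_real (det_exponent (s + x))"
      unfolding ne de by (simp_all add: Ac_def Bc_def)
    have WZ: "WS (of_real x, complex_coords h) n [] = of_real (Zh n)" for n
      unfolding WS_def fst_conv snd_conv e d ab Zh_def by (rule c2.Zr_weight_sum)
    have Z0: "Zh 0 = 1"
      using WZ[of 0] unfolding WS_def weight_sum_0 by simp
    have "Q n (of_real x) (complex_coords h) = of_real (ln (Zh n) / real n)" for n
    proof -
      have "Ln (WS (of_real x, complex_coords h) (Suc j) [] / WS (of_real x, complex_coords h) j []) = of_real (ln (Zh (Suc j)) - ln (Zh j))" for j
      proof -
        have "Ln (WS (of_real x, complex_coords h) (Suc j) [] / WS (of_real x, complex_coords h) j []) = Ln (of_real (Zh (Suc j) / Zh j))"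
          unfolding WZ by simp
        also have "\<dots> = of_real (ln (Zh (Suc j) / Zh j))" using Zp by (intro Ln_of_real) simp
        also have "ln (Zh (Suc j) / Zh j) = ln (Zh (Suc j)) - ln (Zh j)" using Zp by (simp add: ln_divide_pos)
        finally show ?thesis .
      qed
      then have "Q n (of_real x) (complex_coords h) = of_real (\<Sum>j<n. ln (Zh (Suc j)) - ln (Zh j)) / of_nat n"
        unfolding Q_def by simp
      also have "(\<Sum>j<n. ln (Zh (Suc j)) - ln (Zh j)) = ln (Zh n)"
        using sum_lessThan_telescope[of "\<lambda>j. ln (Zh j)" n] Z0 by simp
      finally show ?thesis by simp
    qed
    moreover have "(\<lambda>n. of_real (ln (Zh n) / real n) :: complex) \<longlonglongrightarrow> of_real (log_pressure (s + x) (t + h))"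
      unfolding Zh_def by (intro tendsto_of_real c2.Zr_growth s)
    ultimately show "(\<lambda>n. Q n (of_real x) (complex_coords h)) \<longlonglongrightarrow> of_real (log_pressure (s + x) (t + h))" by simp
  qed
qed

lemma (in cone_coordinates) cone_coordinates_nearby:
  "\<forall>\<^sub>F t' in nhds t. cone_coordinates t' u v \<and> (\<forall>k. sgn (det (param_mat t' k)) = sgn (det (param_mat t k)))"
proof -
  have e: "((\<lambda>t'. param_mat t' k $ i $ j) \<longlongrightarrow> param_mat t k $ i $ j) (nhds t)" for k i j
    by (intro tendsto_vec_nth tendsto_param_mat)
  have lc: "((\<lambda>t'. cross2 (param_mat t' k *v a) b) \<longlongrightarrow> cross2 (param_mat t k *v a) b) (nhds t)" for k a b
    unfolding cross2_def matrix_vector_mult_2 by (intro tendsto_intros e)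
  have lc': "((\<lambda>t'. cross2 b (param_mat t' k *v a)) \<longlongrightarrow> cross2 b (param_mat t k *v a)) (nhds t)" for k a b
    unfolding cross2_def matrix_vector_mult_2 by (intro tendsto_intros e)
  have ld: "((\<lambda>t'. det (param_mat t' k)) \<longlongrightarrow> det (param_mat t k)) (nhds t)" for k
    unfolding det_2 by (intro tendsto_intros e)
  have sg: "\<forall>\<^sub>F t' in nhds t. sgn (det (param_mat t' k)) = sgn (det (param_mat t k)) \<and> det (param_mat t' k) \<noteq> 0" for k
  proof (cases "0 < det (param_mat t k)")
    case True
    show ?thesis using order_tendstoD(1)[OF ld True] by eventually_elim (use True in auto)
  next
    case False
    then have n: "det (param_mat t k) < 0" using det_nz[of k] by linarith
    show ?thesis using order_tendstoD(2)[OF ld n] by eventually_elim (use n in auto)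
  qed
  have "\<forall>\<^sub>F t' in nhds t. \<forall>k. 0 < cross2 (param_mat t' k *v u) v"
    using pos(1) by (intro eventually_all_finite order_tendstoD(1)[OF lc])
  moreover have "\<forall>\<^sub>F t' in nhds t. \<forall>k. 0 < cross2 (param_mat t' k *v v) v"
    using pos(2) by (intro eventually_all_finite order_tendstoD(1)[OF lc])
  moreover have "\<forall>\<^sub>F t' in nhds t. \<forall>k. 0 < cross2 u (param_mat t' k *v u)"
    using pos(3) by (intro eventually_all_finite order_tendstoD(1)[OF lc'])
  moreover have "\<forall>\<^sub>F t' in nhds t. \<forall>k. 0 < cross2 u (param_mat t' k *v v)"
    using pos(4) by (intro eventually_all_finite order_tendstoD(1)[OF lc'])
  moreover have "\<forall>\<^sub>F t' in nhds t. \<forall>k. sgn (det (param_mat t' k)) = sgn (det (param_mat t k)) \<and> det (param_mat t' k) \<noteq> 0"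
    by (intro eventually_all_finite sg)
  ultimately show ?thesis
    by eventually_elim (use uv in \<open>auto intro!: cone_coordinates.intro\<close>)
qed

text \<open>Convergence of \<open>Q n\<close> is known at real arguments only. On the polydisc a
  limit is taken along one filter for all points at once, which preserves holomorphy in each
  variable; at real arguments it must agree with the existing limit, the logarithm of the
  pressure.\<close>

theorem (in cone_coordinates) complex_pressure:
  assumes r: "0 < r" and s: "\<And>x. \<bar>x\<bar> < r \<Longrightarrow> 0 \<le> s + x \<and> norm_exponent (s + x) = a0 + a1 * x \<and> det_exponent (s + x) = b0 + b1 * x"
  shows "\<exists>R M F. 0 < R \<and>
    (\<forall>\<xi> \<tau>. norm \<xi> < R \<longrightarrow> \<tau> \<in> polydisc Basis R \<longrightarrow> norm (F \<xi> \<tau> :: complex) \<le> M) \<and>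
    (\<forall>\<tau>. \<tau> \<in> polydisc Basis R \<longrightarrow> (\<lambda>\<xi>. F \<xi> \<tau>) holomorphic_on ball 0 R) \<and>
    (\<forall>\<xi> \<tau> b. norm \<xi> < R \<longrightarrow> \<tau> \<in> polydisc Basis R \<longrightarrow> b \<in> Basis \<longrightarrow> (\<lambda>z. F \<xi> (\<tau>(b := z))) holomorphic_on ball 0 R) \<and>
    (\<forall>x h. \<bar>x\<bar> < R \<longrightarrow> norm h < R \<longrightarrow> F (of_real x) (complex_coords h) = of_real (log_pressure (s + x) (t + h)))"
proof -
  obtain r1 where r1: "0 < r1" "\<And>t'. dist t' t < r1 \<Longrightarrow> cone_coordinates t' u v \<and> (\<forall>k. sgn (det (param_mat t' k)) = sgn (det (param_mat t k)))"
    using cone_coordinates_nearby unfolding eventually_nhds_metric by blast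
  obtain R0 M and Q :: "nat \<Rightarrow> complex \<Rightarrow> ('n param \<Rightarrow> complex) \<Rightarrow> complex" where Q0: "0 < R0"
    and Q1: "\<forall>n \<xi> \<tau>. norm \<xi> < R0 \<longrightarrow> \<tau> \<in> polydisc Basis R0 \<longrightarrow> norm (Q n \<xi> \<tau> :: complex) \<le> M"
    and Q2: "\<forall>n \<tau>. \<tau> \<in> polydisc Basis R0 \<longrightarrow> (\<lambda>\<xi>. Q n \<xi> \<tau>) holomorphic_on ball 0 R0"
    and Q3: "\<forall>n \<xi> \<tau> b. norm \<xi> < R0 \<longrightarrow> \<tau> \<in> polydisc Basis R0 \<longrightarrow> b \<in> Basis \<longrightarrow> (\<lambda>z. Q n \<xi> (\<tau>(b := z))) holomorphic_on ball 0 R0"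
    and Q4: "\<forall>x h. \<bar>x\<bar> < R0 \<longrightarrow> norm h < R0 \<longrightarrow> cone_coordinates (t + h) u v \<longrightarrow> 
       (\<forall>k. sgn (det (param_mat (t + h) k)) = sgn (det (param_mat t k))) \<longrightarrow> 0 \<le> s + x \<longrightarrow>
       norm_exponent (s + x) = a0 + a1 * x \<longrightarrow> det_exponent (s + x) = b0 + b1 * x \<longrightarrow>
       (\<lambda>n. Q n (of_real x) (complex_coords h)) \<longlonglongrightarrow> of_real (log_pressure (s + x) (t + h))"
    using complex_approximants[of s a0 a1 b0 b1] by (elim exE conjE)
  note Q = Q0 Q1[rule_format] Q2[rule_format] Q3[rule_format] Q4[rule_format]
  define R where "R = min R0 (min r r1)"
  have R: "0 < R" "R \<le> R0" "R \<le> r" "R \<le> r1" using Q(1) r r1 by (auto simp: R_def)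
  have sub: "polydisc Basis R \<subseteq> (polydisc Basis R0 :: ('n param \<Rightarrow> complex) set)" using R by (force simp: polydisc_def)
  have M0: "0 \<le> M" using order_trans[OF norm_ge_zero Q(2)[of 0 "\<lambda>_. 0" 0]] Q(1) by (simp add: polydisc_def)
  define X where "X = {p :: complex \<times> ('n param \<Rightarrow> complex). norm (fst p) < R \<and> snd p \<in> (polydisc Basis R :: ('n param \<Rightarrow> complex) set)}"
  \<comment> \<open>Extended by zero off the polydisc, since the compactness argument requires one
    bound for all arguments.\<close>
  define f where "f n p = (if p \<in> X then Q n (fst p) (snd p) else 0)" for n and p :: "complex \<times> ('n param \<Rightarrow> complex)"
  have "norm (f n p) \<le> M" for n p using Q(2)[of "fst p" "snd p" n] M0 R sub by (auto simp: f_def X_def)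
  then obtain G g where G: "G \<noteq> bot" "G \<le> sequentially" and g: "\<And>p. ((\<lambda>n. f n p) \<longlongrightarrow> g p) G" "\<And>p. norm (g p) \<le> M"
    using bounded_functions_filter_limit[of f M] by blast
  define F where "F \<xi> \<tau> = g (\<xi>, \<tau>)" for \<xi> :: complex and \<tau> :: "'n param \<Rightarrow> complex"
  have lim: "((\<lambda>n. Q n \<xi> \<tau>) \<longlongrightarrow> F \<xi> \<tau>) G" if "norm \<xi> < R" "\<tau> \<in> polydisc Basis R" for \<xi> \<tau>
    using g(1)[of "(\<xi>, \<tau>)"] that by (simp add: f_def X_def F_def)
  show ?thesis
  proof (rule exI[of _ R], rule exI[of _ M], rule exI[of _ F], intro conjI allI impI R(1))
    show "norm (F \<xi> \<tau>) \<le> M" for \<xi> \<tau> unfolding F_def by (rule g(2))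
  next
    fix \<tau> :: "'n param \<Rightarrow> complex" assume t: "\<tau> \<in> polydisc Basis R"
    then have t0: "\<tau> \<in> polydisc Basis R0" using sub by blast
    show "(\<lambda>\<xi>. F \<xi> \<tau>) holomorphic_on ball 0 R"
    proof (rule holomorphic_on_pointwise_limit[OF G(1)])
      show "(\<lambda>\<xi>. Q n \<xi> \<tau>) holomorphic_on ball 0 R" for n
        using Q(3)[OF t0] by (rule holomorphic_on_subset) (use R in auto)
      show "norm (Q n z \<tau>) \<le> M" if "z \<in> ball 0 R" for n z using that t0 R by (intro Q(2)) auto
      show "((\<lambda>n. Q n z \<tau>) \<longlongrightarrow> F z \<tau>) G" if "z \<in> ball 0 R" for z using that t by (intro lim) auto
    qed simp
  next
    fix \<xi> :: complex and b :: "'n param" and \<tau> :: "'n param \<Rightarrow> complex" assume x: "norm \<xi> < R" and t: "\<tau> \<in> polydisc Basis R" and b: "b \<in> Basis"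
    have up: "\<tau>(b := z) \<in> polydisc Basis R" if "norm z < R" for z using t b that by (auto simp: polydisc_def)
    have t0: "\<tau> \<in> polydisc Basis R0" using sub t by blast
    have x0: "norm \<xi> < R0" using x R by linarith
    show "(\<lambda>z. F \<xi> (\<tau>(b := z))) holomorphic_on ball 0 R"
    proof (rule holomorphic_on_pointwise_limit[OF G(1)])
      show "(\<lambda>z. Q n \<xi> (\<tau>(b := z))) holomorphic_on ball 0 R" for n
        using Q(4)[OF x0 t0 b] by (rule holomorphic_on_subset) (use R in auto)
      show "norm (Q n \<xi> (\<tau>(b := z))) \<le> M" if "z \<in> ball 0 R" for n z
        using that up[of z] sub x0 by (intro Q(2)) auto
      show "((\<lambda>n. Q n \<xi> (\<tau>(b := z))) \<longlongrightarrow> F \<xi> (\<tau>(b := z))) G" if "z \<in> ball 0 R" for z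
        using that x up by (intro lim) auto
    qed simp
  next
    fix x and h :: "'n param" assume x: "\<bar>x\<bar> < R" and h: "norm h < R"
    have near: "cone_coordinates (t + h) u v" "\<And>k. sgn (det (param_mat (t + h) k)) = sgn (det (param_mat t k))"
      using r1(2)[of "t + h"] h R by (auto simp: dist_norm)
    have "(\<lambda>n. Q n (of_real x) (complex_coords h)) \<longlonglongrightarrow> of_real (log_pressure (s + x) (t + h))"
      using x h R s[of x] near by (intro Q(5)) auto
    then have "((\<lambda>n. Q n (of_real x) (complex_coords h)) \<longlongrightarrow> of_real (log_pressure (s + x) (t + h))) G"
      using G(2) by (rule filterlim_mono[OF _ order_refl])
    moreover have "((\<lambda>n. Q n (of_real x) (complex_coords h)) \<longlongrightarrow> F (of_real x) (complex_coords h)) G"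
      using x complex_coords_polydisc[OF h] by (intro lim) auto
    ultimately show "F (of_real x) (complex_coords h) = of_real (log_pressure (s + x) (t + h))"
      using G(1) by (metis tendsto_unique)
  qed
qed

subsection \<open>Analyticity of the affinity dimension\<close>

lemma real_analytic_on_subset: "real_analytic_on f U \<Longrightarrow> V \<subseteq> U \<Longrightarrow> real_analytic_on f V"
  unfolding real_analytic_on_def by blast

lemma real_analytic_on_cong:
  fixes f g :: "'a::euclidean_space \<Rightarrow> real"
  assumes "real_analytic_on f V" "open V" and eq: "\<And>x. x \<in> V \<Longrightarrow> f x = g x"
  shows "real_analytic_on g V"
  unfolding real_analytic_on_def
proof
  fix x assume x: "x \<in> V"
  obtain c r where r: "0 < r" and c: "\<And>h. norm h < r \<Longrightarrow> ((\<lambda>\<alpha>. c \<alpha> * (\<Prod>b\<in>Basis. (h \<bullet> b) ^ \<alpha> b)) has_sum f (x + h)) multi_indices"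
    using assms(1) x unfolding real_analytic_on_def by blast
  obtain e where e: "0 < e" "ball x e \<subseteq> V" using assms(2) x openE by blast
  show "\<exists>c. \<exists>r>0. \<forall>h. norm h < r \<longrightarrow> ((\<lambda>\<alpha>. c \<alpha> * (\<Prod>b\<in>Basis. (h \<bullet> b) ^ \<alpha> b)) has_sum g (x + h)) multi_indices"
  proof (intro exI[of _ c] exI[of _ "min r e"] conjI allI impI)
    fix h :: 'a assume h: "norm h < min r e"
    then have "x + h \<in> V" using e by (auto simp: dist_norm)
    then show "((\<lambda>\<alpha>. c \<alpha> * (\<Prod>b\<in>Basis. (h \<bullet> b) ^ \<alpha> b)) has_sum g (x + h)) multi_indices"
      using c[of h] h eq by simp
  qed (use r e in simp)
qed

section \<open>Implicit functions of separately holomorphic families\<close>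

locale separately_holomorphic_family =
  fixes F :: "complex \<Rightarrow> ('a::euclidean_space \<Rightarrow> complex) \<Rightarrow> complex" and R M :: real and f :: "real \<Rightarrow> 'a \<Rightarrow> real"
  assumes R: "0 < R"
    and bd: "\<And>\<xi> \<tau>. norm \<xi> < R \<Longrightarrow> \<tau> \<in> polydisc Basis R \<Longrightarrow> norm (F \<xi> \<tau>) \<le> M"
    and hol1: "\<And>\<tau>. \<tau> \<in> polydisc Basis R \<Longrightarrow> (\<lambda>\<xi>. F \<xi> \<tau>) holomorphic_on ball 0 R"
    and hol2: "\<And>\<xi> \<tau> b. norm \<xi> < R \<Longrightarrow> \<tau> \<in> polydisc Basis R \<Longrightarrow> b \<in> Basis \<Longrightarrow> (\<lambda>z. F \<xi> (\<tau>(b := z))) holomorphic_on ball 0 R"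
    and real: "\<And>x h. \<bar>x\<bar> < R \<Longrightarrow> norm h < R \<Longrightarrow> F (of_real x) (complex_coords h) = of_real (f x h)"
begin

lemma real_analytic_exp:
  "real_analytic_on (\<lambda>(s, t). exp (f (s - s0) (t - t0))) (ball (s0, t0) (R/2))"
proof (rule real_analytic_onI[OF R])
  define g where "g \<zeta> = (\<lambda>b. \<zeta> (0::real, b::'a))" for \<zeta> :: "real \<times> 'a \<Rightarrow> complex"
  have B: "(1, 0) \<in> (Basis :: (real \<times> 'a) set)" "(0, b) \<in> (Basis :: (real \<times> 'a) set) \<longleftrightarrow> b \<in> Basis" for b
    by (auto simp: Basis_prod_def)
  have gp: "g \<zeta> \<in> polydisc Basis R" "norm (\<zeta> (1, 0)) < R" if "\<zeta> \<in> polydisc Basis R" for \<zeta>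
    using that B by (auto simp: polydisc_def g_def)
  show "sep_holomorphic Basis R (exp M) (\<lambda>\<zeta>. exp (F (\<zeta> (1, 0)) (g \<zeta>)))"
    unfolding sep_holomorphic_def
  proof (intro ballI conjI)
    fix \<zeta> :: "real \<times> 'a \<Rightarrow> complex" assume z: "\<zeta> \<in> polydisc Basis R"
    note G = gp[OF z]
    show "norm (exp (F (\<zeta> (1, 0)) (g \<zeta>))) \<le> exp M"
      using norm_exp[of "F (\<zeta> (1, 0)) (g \<zeta>)"] bd[OF G(2,1)] by (meson exp_le_cancel_iff order_trans)
    fix b assume "b \<in> (Basis :: (real \<times> 'a) set)"
    then consider "b = (1, 0)" | b' where "b = (0, b')" "b' \<in> Basis" by (auto simp: Basis_prod_def)
    then show "(\<lambda>z. exp (F ((\<zeta>(b := z)) (1, 0)) (g (\<zeta>(b := z))))) holomorphic_on ball 0 R"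
    proof cases
      case 1
      have "g (\<zeta>(b := z)) = g \<zeta>" for z by (auto simp: g_def 1)
      then show ?thesis using hol1[OF G(1)] 1 by (auto intro!: holomorphic_intros)
    next
      case 2
      have "g (\<zeta>(b := z)) = (g \<zeta>)(b' := z)" for z by (auto simp: g_def 2)
      then show ?thesis using hol2[OF G(2,1) 2(2)] 2 by (auto intro!: holomorphic_intros)
    qed
  qed
  fix h :: "real \<times> 'a" assume h: "norm h < R"
  obtain x y where xy: "h = (x, y)" by force
  have "\<bar>x\<bar> \<le> norm h" "norm y \<le> norm h" unfolding xy using norm_fst_le[of x y] norm_snd_le[of y x] by auto
  moreover have "complex_coords h (1, 0) = of_real x" using B by (simp add: complex_coords_def xy)
  moreover have "g (complex_coords h) = complex_coords y" using B by (auto simp: g_def complex_coords_def xy)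
  ultimately show "exp (F (complex_coords h (1, 0)) (g (complex_coords h))) 
      = of_real (case (s0, t0) + h of (s, t) \<Rightarrow> exp (f (s - s0) (t - t0)))"
    using real[of x y] h by (simp add: xy exp_of_real)
qed

lemma update_polydisc: "\<tau> \<in> polydisc Basis r \<Longrightarrow> b \<in> Basis \<Longrightarrow> norm z < r \<Longrightarrow> \<tau>(b := z) \<in> polydisc Basis r"
  by (auto simp: polydisc_def)

lemma polydisc_mono: "r \<le> r' \<Longrightarrow> \<tau> \<in> polydisc B r \<Longrightarrow> \<tau> \<in> polydisc B r'"
  by (force simp: polydisc_def)

lemma zero_polydisc: "0 < r \<Longrightarrow> (\<lambda>_. 0) \<in> polydisc B r"
  by (auto simp: polydisc_def)

text \<open>The coordinates are switched on one at a time, and each step is the Lipschitz estimate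
  for a bounded holomorphic function of one variable. The result is a modulus of continuity at zero
  that is uniform in \<open>\<xi>\<close>.\<close>

lemma lipschitz_in_parameters:
  assumes x: "norm \<xi> < R" and t: "\<tau> \<in> polydisc Basis r" and r: "0 < r" "r \<le> R/2"
  shows "norm (F \<xi> \<tau> - F \<xi> (\<lambda>_. 0)) \<le> real (card (Basis :: 'a set)) * (4 * M / R * r)"
proof -
  define T where "T B = (\<lambda>b. if b \<in> B then \<tau> b else 0)" for B
  have M0: "0 \<le> M" using order_trans[OF norm_ge_zero bd[of 0 "\<lambda>_. 0"]] R zero_polydisc by auto
  have "norm (F \<xi> (T B) - F \<xi> (\<lambda>_. 0)) \<le> real (card B) * (4 * M / R * r)" if "finite B" "B \<subseteq> Basis" for B
    using that
  proof (induction B)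
    case empty
    then show ?case by (simp add: T_def)
  next
    case (insert b B)
    have TB: "T B \<in> polydisc Basis R" using t r by (auto simp: polydisc_def T_def intro: less_le_trans)
    have b: "b \<in> Basis" using insert by auto
    have e: "T (insert b B) = (T B)(b := \<tau> b)" "T B = (T B)(b := 0)" using insert by (auto simp: T_def)
    have tb: "norm (\<tau> b) < r" using t b by (auto simp: polydisc_def)
    have "norm (F \<xi> ((T B)(b := \<tau> b)) - F \<xi> ((T B)(b := 0))) \<le> 4 * M / R * norm (\<tau> b - 0)"
    proof (rule holomorphic_bounded_lipschitz[OF hol2[OF x TB b] _ R])
      show "norm (F \<xi> ((T B)(b := z))) \<le> M" if "z \<in> ball 0 R" for z
        using that by (intro bd[OF x] update_polydisc TB b) auto
    qed (use tb r R in auto)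
    also have "\<dots> \<le> 4 * M / R * r" using tb M0 R by (intro mult_left_mono) auto
    finally have "norm (F \<xi> (T (insert b B)) - F \<xi> (T B)) \<le> 4 * M / R * r" using e by simp
    moreover have "norm (F \<xi> (T B) - F \<xi> (\<lambda>_. 0)) \<le> real (card B) * (4 * M / R * r)" using insert by auto
    ultimately have "norm (F \<xi> (T (insert b B)) - F \<xi> (\<lambda>_. 0)) \<le> 4 * M / R * r + real (card B) * (4 * M / R * r)"
      using norm_triangle_ineq[of "F \<xi> (T (insert b B)) - F \<xi> (T B)" "F \<xi> (T B) - F \<xi> (\<lambda>_. 0)"] by simp
    also have "\<dots> = real (card (insert b B)) * (4 * M / R * r)"
      by (simp only: card_insert_disjoint[OF insert.hyps] of_nat_Suc distrib_right mult_1 add.commute)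
    finally show ?case .
  qed
  moreover have "T Basis = \<tau>" using t by (auto simp: T_def polydisc_def)
  ultimately show ?thesis by (metis finite_Basis order_refl)
qed

text \<open>The complex derivative is the limit of difference quotients along positive numbers
  \<open>x n\<close>, and these quotients are real and at most \<open>L\<close>. That
  \<open>\<kappa>\<close> is real keeps the Newton iterates real at real parameters.\<close>

lemma derivative_at_root:
  assumes f0: "f 0 0 = 0" and L: "L < 0" and fL: "\<And>x. 0 < x \<Longrightarrow> x < R \<Longrightarrow> f x 0 \<le> L * x"
  defines "\<kappa> \<equiv> deriv (\<lambda>\<xi>. F \<xi> (\<lambda>_. 0)) 0"
  shows "\<kappa> \<noteq> 0" "\<kappa> \<in> \<real>"
proof -
  have cc0: "complex_coords (0::'a) = (\<lambda>_. 0)" by (auto simp: complex_coords_def)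
  define x where "x n = R / (real n + 2)" for n
  have x: "0 < x n" "x n < R" for n
  proof -
    show "0 < x n" using R by (simp add: x_def)
    have "R / (real n + 2) \<le> R / 2" using R by (intro divide_left_mono) auto
    then show "x n < R" using R unfolding x_def by linarith
  qed
  have "(\<lambda>n. x n) \<longlonglongrightarrow> 0" unfolding x_def by real_asymp
  then have "(\<lambda>n. of_real (x n) :: complex) \<longlonglongrightarrow> of_real 0" by (rule tendsto_of_real)
  then have xl: "filterlim (\<lambda>n. of_real (x n) :: complex) (at 0) sequentially"
    using x by (auto simp: filterlim_at less_imp_neq[symmetric])
  have g: "F (of_real (x n)) (\<lambda>_. 0) = of_real (f (x n) 0)" for n
    using real[of "x n" 0] x[of n] R by (simp add: cc0)
  have g0: "F 0 (\<lambda>_. 0) = 0" using real[of 0 0] R f0 by (simp add: cc0)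
  have "((\<lambda>\<xi>. F \<xi> (\<lambda>_. 0)) has_field_derivative \<kappa>) (at 0)"
    unfolding \<kappa>_def using holomorphic_derivI[OF hol1[OF zero_polydisc[OF R]] open_ball, of 0] R by simp
  then have "((\<lambda>h. (F (0 + h) (\<lambda>_. 0) - F 0 (\<lambda>_. 0)) / h) \<longlongrightarrow> \<kappa>) (at 0)"
    unfolding has_field_derivative_iff by (simp add: DERIV_def)
  then have "(\<lambda>n. (F (0 + of_real (x n)) (\<lambda>_. 0) - F 0 (\<lambda>_. 0)) / of_real (x n)) \<longlonglongrightarrow> \<kappa>"
    using xl by (rule filterlim_compose)
  then have lim: "(\<lambda>n. of_real (f (x n) 0 / x n)) \<longlonglongrightarrow> \<kappa>" by (simp add: g g0)
  have "(\<lambda>n. f (x n) 0 / x n) \<longlonglongrightarrow> Re \<kappa>" using tendsto_Re[OF lim] by (simp del: of_real_divide)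
  moreover have "f (x n) 0 / x n \<le> L" for n using fL[OF x] x[of n] by (simp add: pos_divide_le_eq)
  ultimately have "Re \<kappa> \<le> L" by (intro LIMSEQ_le_const2) auto
  then show "\<kappa> \<noteq> 0" using L by auto
  have "(\<lambda>n. 0) \<longlonglongrightarrow> Im \<kappa>" using tendsto_Im[OF lim] by (simp del: of_real_divide)
  then have "Im \<kappa> = 0" by (simp add: LIMSEQ_const_iff)
  then show "\<kappa> \<in> \<real>" by (simp add: complex_is_Real_iff)
qed

text \<open>The implicit function is the limit of the simplified Newton iteration, a uniform contraction whose iterates are holomorphic.\<close>

theorem implicit_root:
  assumes f0: "f 0 0 = 0" and L: "L < 0" and fL: "\<And>x. 0 < x \<Longrightarrow> x < R \<Longrightarrow> f x 0 \<le> L * x"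
    and \<epsilon>: "0 < \<epsilon>"
  shows "\<exists>r \<rho> \<sigma>. 0 < r \<and> r \<le> R \<and> \<rho> \<le> \<epsilon> \<and> sep_holomorphic Basis r \<rho> \<sigma> \<and>
    (\<forall>h. norm h < r \<longrightarrow> (\<exists>x. \<bar>x\<bar> \<le> \<rho> \<and> \<sigma> (complex_coords h) = of_real x \<and> f x h = 0))"
proof -
  define g where "g \<xi> = F \<xi> (\<lambda>_. 0)" for \<xi>
  define \<kappa> where "\<kappa> = deriv g 0"
  have \<kappa>: "\<kappa> \<noteq> 0" "\<kappa> \<in> \<real>" using derivative_at_root[OF f0 L fL] unfolding \<kappa>_def g_def by auto
  have n\<kappa>: "0 < norm \<kappa>" using \<kappa> by simp
  have cc0: "complex_coords (0::'a) = (\<lambda>_. 0)" by (auto simp: complex_coords_def)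
  have g0: "g 0 = 0" using real[of 0 0] R f0 by (simp add: cc0 g_def)
  have M0: "0 \<le> M" using order_trans[OF norm_ge_zero bd[of 0 "\<lambda>_. 0"]] R zero_polydisc by auto
  have hg: "g holomorphic_on ball 0 R" unfolding g_def using hol1[OF zero_polydisc[OF R]] .
  have "isCont (deriv g) 0"
    using holomorphic_deriv[OF hg open_ball] R holomorphic_on_imp_continuous_on continuous_on_eq_continuous_at[OF open_ball]
    by (metis centre_in_ball)
  then obtain d where d: "0 < d" "\<And>z. dist z 0 < d \<Longrightarrow> dist (deriv g z) (deriv g 0) < norm \<kappa> / 4"
    using n\<kappa> unfolding continuous_at_eps_delta by (metis divide_pos_pos zero_less_numeral)
  \<comment> \<open>\<open>d/2\<close> keeps \<open>deriv g\<close> within a quarter of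
    \<open>norm \<kappa>\<close> of \<open>\<kappa>\<close>, \<open>R/4\<close> is what the
    substitution of iterates into \<open>F\<close> allows, and \<open>\<epsilon>\<close> is the
    prescribed bound on the root.\<close>
  define \<rho> where "\<rho> = min (d/2) (min (R/4) \<epsilon>)"
  have \<rho>: "0 < \<rho>" "\<rho> < d" "\<rho> \<le> R/4" "\<rho> \<le> \<epsilon>" using d R \<epsilon> by (auto simp: \<rho>_def)
  have gl: "norm ((g x - \<kappa> * x) - (g y - \<kappa> * y)) \<le> norm \<kappa> / 4 * norm (x - y)" if "x \<in> cball 0 \<rho>" "y \<in> cball 0 \<rho>" for x y
  proof (rule field_differentiable_bound[OF convex_cball _ _ that])
    fix z :: complex assume z: "z \<in> cball 0 \<rho>"
    then have "z \<in> ball 0 R" using \<rho> R by auto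
    then have "(g has_field_derivative deriv g z) (at z)" using holomorphic_derivI[OF hg open_ball] by blast
    then have "((\<lambda>x. g x - \<kappa> * x) has_field_derivative (deriv g z - \<kappa>)) (at z)"
      by (auto intro!: derivative_eq_intros)
    then show "((\<lambda>x. g x - \<kappa> * x) has_field_derivative (deriv g z - \<kappa>)) (at z within cball 0 \<rho>)"
      by (rule has_field_derivative_at_within)
    show "norm (deriv g z - \<kappa>) \<le> norm \<kappa> / 4" using d(2)[of z] z \<rho> by (auto simp: \<kappa>_def dist_norm)
  qed
  define c where "c = real (card (Basis :: 'a set)) * (4 * M / R) + 1"
  have c: "1 \<le> c" unfolding c_def using M0 R by simp
  \<comment> \<open>\<open>A\<close>, the variation of \<open>F\<close> in the parameters, is at
    most \<open>c * r\<close>. The entry \<open>\<rho>/2\<close> lets the iteration move the centre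
    by at most \<open>\<rho>/2\<close>; \<open>R/16\<close> makes the Lipschitz constant
    \<open>4 * A / R\<close> of the parameter-dependent part at most a quarter of
    \<open>norm \<kappa>\<close>.\<close>
  define r where "r = min (R/2) (norm \<kappa> * min (\<rho>/2) (R/16) / c)"
  have r: "0 < r" "r \<le> R/2" "r \<le> R" using R c n\<kappa> \<rho> by (auto simp: r_def)
  define A where "A = real (card (Basis :: 'a set)) * (4 * M / R * r)"
  have A: "A \<le> norm \<kappa> * \<rho> / 2" "A \<le> norm \<kappa> * R / 16"
  proof -
    have "A \<le> c * r" unfolding A_def c_def using r by (simp add: algebra_simps)
    also have "\<dots> \<le> c * (norm \<kappa> * min (\<rho>/2) (R/16) / c)" using c by (intro mult_left_mono) (auto simp: r_def)
    also have "\<dots> = norm \<kappa> * min (\<rho>/2) (R/16)" using c by simp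
    finally have "A \<le> norm \<kappa> * min (\<rho>/2) (R/16)" .
    moreover have "norm \<kappa> * min (\<rho>/2) (R/16) \<le> norm \<kappa> * (\<rho>/2)" "norm \<kappa> * min (\<rho>/2) (R/16) \<le> norm \<kappa> * (R/16)"
      by (intro mult_left_mono; simp)+
    ultimately show "A \<le> norm \<kappa> * \<rho> / 2" "A \<le> norm \<kappa> * R / 16" by simp_all
  qed
  define \<Phi> where "\<Phi> \<tau> \<xi> = \<xi> - F \<xi> \<tau> / \<kappa>" for \<tau> \<xi>
  have dl: "norm ((F x \<tau> - g x) - (F y \<tau> - g y)) \<le> norm \<kappa> / 4 * norm (x - y)"
    if t: "\<tau> \<in> polydisc Basis r" and xy: "x \<in> cball 0 \<rho>" "y \<in> cball 0 \<rho>" for \<tau> x y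
  proof -
    have "norm ((F x \<tau> - g x) - (F y \<tau> - g y)) \<le> 4 * A / R * norm (x - y)"
    proof (rule holomorphic_bounded_lipschitz[where c = 0])
      show "(\<lambda>z. F z \<tau> - g z) holomorphic_on ball 0 R"
        using hol1[OF polydisc_mono[OF r(3) t]] hg by (intro holomorphic_intros)
      show "norm (F z \<tau> - g z) \<le> A" if "z \<in> ball 0 R" for z
        unfolding g_def A_def using lipschitz_in_parameters[OF _ t r(1,2), of z] that by simp
    qed (use R \<rho> xy in auto)
    also have "4 * A / R \<le> norm \<kappa> / 4" using A(2) R by (simp add: field_simps)
    finally show ?thesis by (simp add: mult_right_mono)
  qed
  have contr: "norm (\<Phi> \<tau> x - \<Phi> \<tau> y) \<le> 1/2 * norm (x - y)"
    if t: "\<tau> \<in> polydisc Basis r" and xy: "x \<in> cball 0 \<rho>" "y \<in> cball 0 \<rho>" for \<tau> x y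
  proof -
    \<comment> \<open>One quarter of \<open>norm \<kappa>\<close> is spent on the nonlinearity of
      \<open>g\<close> and one on the parameters; hence the contraction factor 1/2.\<close>
    define e where "e = ((g x - \<kappa> * x) - (g y - \<kappa> * y)) + ((F x \<tau> - g x) - (F y \<tau> - g y))"
    have "\<Phi> \<tau> x - \<Phi> \<tau> y = - e / \<kappa>" unfolding e_def \<Phi>_def using \<kappa>(1) by (simp add: field_simps)
    then have "norm (\<Phi> \<tau> x - \<Phi> \<tau> y) = norm e / norm \<kappa>" by (simp add: norm_divide)
    also have "norm e \<le> norm \<kappa> / 4 * norm (x - y) + norm \<kappa> / 4 * norm (x - y)"
      unfolding e_def by (intro order_trans[OF norm_triangle_ineq] add_mono gl dl t xy)
    finally show ?thesis using n\<kappa> by (simp add: divide_right_mono field_simps)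
  qed
  have \<Phi>0: "norm (\<Phi> \<tau> 0) \<le> \<rho> / 2" if t: "\<tau> \<in> polydisc Basis r" for \<tau>
  proof -
    have "norm (F 0 \<tau>) \<le> A" using lipschitz_in_parameters[OF _ t r(1,2), of 0] R g0 by (simp add: A_def g_def)
    then have "norm (F 0 \<tau>) \<le> norm \<kappa> * \<rho> / 2" using A(1) by linarith
    then show ?thesis unfolding \<Phi>_def using n\<kappa> by (simp add: norm_divide field_simps)
  qed
  have maps: "\<Phi> \<tau> x \<in> cball 0 \<rho>" if t: "\<tau> \<in> polydisc Basis r" and x: "x \<in> cball 0 \<rho>" for \<tau> x
  proof -
    have "norm (\<Phi> \<tau> x) \<le> norm (\<Phi> \<tau> x - \<Phi> \<tau> 0) + norm (\<Phi> \<tau> 0)" using norm_triangle_ineq[of "\<Phi> \<tau> x - \<Phi> \<tau> 0" "\<Phi> \<tau> 0"] by simp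
    also have "\<dots> \<le> 1/2 * norm (x - 0) + \<rho> / 2" using contr[OF t x, of 0] \<Phi>0[OF t] \<rho>(1) by (intro add_mono) auto
    finally show ?thesis using x by simp
  qed
  define \<sigma>' where "\<sigma>' n \<tau> = (\<Phi> \<tau> ^^ n) 0" for n \<tau>
  have \<sigma>'S: "\<sigma>' (Suc n) \<tau> = \<Phi> \<tau> (\<sigma>' n \<tau>)" "\<sigma>' 0 \<tau> = 0" for n \<tau> by (simp_all add: \<sigma>'_def)
  have \<sigma>'b: "\<sigma>' n \<tau> \<in> cball 0 \<rho>" if t: "\<tau> \<in> polydisc Basis r" for n \<tau>
    by (induction n) (use \<rho> maps[OF t] in \<open>auto simp: \<sigma>'S\<close>)
  have fixp: "\<exists>!x\<in>cball 0 \<rho>. \<Phi> \<tau> x = x" if t: "\<tau> \<in> polydisc Basis r" for \<tau>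
    by (rule Banach_fix[where c = "1/2"]) (use maps[OF t] contr[OF t] \<rho> in \<open>auto simp: dist_norm complete_eq_closed\<close>)
  define \<sigma> where "\<sigma> \<tau> = (THE x. x \<in> cball 0 \<rho> \<and> \<Phi> \<tau> x = x)" for \<tau>
  have \<sigma>: "\<sigma> \<tau> \<in> cball 0 \<rho>" "\<Phi> \<tau> (\<sigma> \<tau>) = \<sigma> \<tau>" if t: "\<tau> \<in> polydisc Basis r" for \<tau>
    using theI'[of "\<lambda>x. x \<in> cball 0 \<rho> \<and> \<Phi> \<tau> x = x"] fixp[OF t] unfolding \<sigma>_def by blast+
  have \<sigma>lim: "(\<lambda>n. \<sigma>' n \<tau>) \<longlonglongrightarrow> \<sigma> \<tau>" if t: "\<tau> \<in> polydisc Basis r" for \<tau>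
  proof -
    have b: "norm (\<sigma>' n \<tau> - \<sigma> \<tau>) \<le> (1/2) ^ n * \<rho>" for n
    proof (induction n)
      case 0 then show ?case using \<sigma>(1)[OF t] by (simp add: \<sigma>'S)
    next
      case (Suc n)
      have "norm (\<sigma>' (Suc n) \<tau> - \<sigma> \<tau>) = norm (\<Phi> \<tau> (\<sigma>' n \<tau>) - \<Phi> \<tau> (\<sigma> \<tau>))" by (simp add: \<sigma>'S \<sigma>(2)[OF t])
      also have "\<dots> \<le> 1/2 * norm (\<sigma>' n \<tau> - \<sigma> \<tau>)" by (rule contr[OF t \<sigma>'b[OF t] \<sigma>(1)[OF t]])
      also have "\<dots> \<le> 1/2 * ((1/2) ^ n * \<rho>)" using Suc by (intro mult_left_mono) auto
      finally show ?case by simp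
    qed
    have l: "(\<lambda>n. (1/2) ^ n * \<rho>) \<longlonglongrightarrow> 0"
      by (rule tendsto_mult_left_zero[OF LIMSEQ_power_zero]) simp
    have "(\<lambda>n. \<sigma>' n \<tau> - \<sigma> \<tau>) \<longlonglongrightarrow> 0"
      by (rule Lim_null_comparison[OF always_eventually l]) (use b in blast)
    then show ?thesis by (rule LIM_zero_cancel)
  qed
  have \<sigma>'hol: "(\<lambda>z. \<sigma>' n (\<tau>(b := z))) holomorphic_on ball 0 r" if t: "\<tau> \<in> polydisc Basis r" and b: "b \<in> Basis" for n \<tau> b
  proof (induction n)
    case 0 then show ?case by (simp add: \<sigma>'S)
  next
    case (Suc n)
    have tz: "\<tau>(b := z) \<in> polydisc Basis r" if "z \<in> ball 0 r" for z using update_polydisc[OF t b] that by simp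
    have tzR: "\<tau>(b := z) \<in> polydisc Basis R" if "z \<in> ball 0 r" for z by (rule polydisc_mono[OF r(3) tz[OF that]])
    have "(\<lambda>z. F (\<sigma>' n (\<tau>(b := z))) (\<tau>(b := z))) holomorphic_on ball 0 r"
    proof (rule holomorphic_on_compose_sep[OF R, where M = M and \<phi> = "\<lambda>\<xi> z. F \<xi> (\<tau>(b := z))"])
      show "(\<lambda>\<xi>. F \<xi> (\<tau>(b := w))) holomorphic_on ball 0 R" if "w \<in> ball 0 r" for w using hol1[OF tzR[OF that]] .
      show "(\<lambda>w. F \<xi> (\<tau>(b := w))) holomorphic_on ball 0 r" if "\<xi> \<in> ball 0 R" for \<xi>
        by (rule holomorphic_on_subset[OF hol2[OF _ polydisc_mono[OF r(3) t] b]]) (use that r in auto)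
      show "norm (F \<xi> (\<tau>(b := w))) \<le> M" if "\<xi> \<in> ball 0 R" "w \<in> ball 0 r" for \<xi> w
        using that tzR by (intro bd) auto
      show "norm (\<sigma>' n (\<tau>(b := w))) \<le> R / 4" if "w \<in> ball 0 r" for w
        using \<sigma>'b[OF tz[OF that], of n] \<rho> by simp
    qed (rule open_ball Suc)+
    then show ?case unfolding \<sigma>'S \<Phi>_def using Suc \<kappa>(1) by (intro holomorphic_intros)
  qed
  have "sep_holomorphic Basis r \<rho> \<sigma>"
    unfolding sep_holomorphic_def
  proof (intro ballI conjI)
    fix \<tau> :: "'a \<Rightarrow> complex" assume t: "\<tau> \<in> polydisc Basis r"
    show "norm (\<sigma> \<tau>) \<le> \<rho>" using \<sigma>(1)[OF t] by simp
    fix b :: 'a assume b: "b \<in> Basis"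
    have tz: "\<tau>(b := z) \<in> polydisc Basis r" if "z \<in> ball 0 r" for z using update_polydisc[OF t b] that by simp
    show "(\<lambda>z. \<sigma> (\<tau>(b := z))) holomorphic_on ball 0 r"
    proof (rule holomorphic_on_pointwise_limit[OF sequentially_bot \<sigma>'hol[OF t b] open_ball])
      show "norm (\<sigma>' n (\<tau>(b := z))) \<le> \<rho>" if "z \<in> ball 0 r" for n z using \<sigma>'b[OF tz[OF that], of n] by simp
      show "(\<lambda>n. \<sigma>' n (\<tau>(b := z))) \<longlonglongrightarrow> \<sigma> (\<tau>(b := z))" if "z \<in> ball 0 r" for z by (rule \<sigma>lim[OF tz[OF that]])
    qed
  qed
  moreover have "\<exists>x. \<bar>x\<bar> \<le> \<rho> \<and> \<sigma> (complex_coords h) = of_real x \<and> f x h = 0" if h: "norm h < r" for h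
  proof -
    have t: "complex_coords h \<in> polydisc Basis r" by (rule complex_coords_polydisc[OF h])
    have hR: "norm h < R" using h r by linarith
    have re: "\<sigma>' n (complex_coords h) \<in> \<real>" for n
    proof (induction n)
      case (Suc n)
      then obtain x where x: "\<sigma>' n (complex_coords h) = of_real x" by (auto elim: Reals_cases)
      have "\<bar>x\<bar> < R" using \<sigma>'b[OF t, of n] x \<rho> R by simp
      then show ?case unfolding \<sigma>'S \<Phi>_def x real[OF _ hR] using \<kappa>(2) by (simp add: real[OF _ hR])
    qed (simp add: \<sigma>'S)
    have "\<sigma> (complex_coords h) \<in> \<real>"
      using closed_sequentially[OF closed_complex_Reals, of "\<lambda>n. \<sigma>' n (complex_coords h)"] re \<sigma>lim[OF t] by blast
    then obtain x where x: "\<sigma> (complex_coords h) = of_real x" by (auto elim: Reals_cases)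
    have xr: "\<bar>x\<bar> \<le> \<rho>" using \<sigma>(1)[OF t] x by simp
    then have xR: "\<bar>x\<bar> < R" using \<rho> R by linarith
    have "F (of_real x) (complex_coords h) / \<kappa> = 0" using \<sigma>(2)[OF t] unfolding x \<Phi>_def by simp
    then have "f x h = 0" using \<kappa>(1) real[OF xR hR] by simp
    then show ?thesis using x xr by blast
  qed
  ultimately show ?thesis using r \<rho> by blast
qed

end

text \<open>The kinks of the two exponents at 1 and 2 are the reason for keeping \<open>s0\<close>
  away from these values: on each open interval the exponents are affine and so extend to complex
  \<open>s\<close>.\<close>

lemma affine_exponents:
  assumes "s0 \<in> {0<..<1} \<union> {1<..<2}"
  obtains r a0 a1 b0 b1 where "0 < r"
    "\<And>x. \<bar>x\<bar> < r \<Longrightarrow> 0 < s0 + x \<and> norm_exponent (s0 + x) = a0 + a1 * x \<and> det_exponent (s0 + x) = b0 + b1 * x"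
proof (cases "s0 < 1")
  case True
  show ?thesis
    by (rule that[of "min s0 (1 - s0)" s0 1 0 0]) (use True assms in \<open>auto simp: norm_exponent_def det_exponent_def\<close>)
next
  case False
  then have s: "1 < s0" "s0 < 2" using assms by auto
  show ?thesis
    by (rule that[of "min (s0 - 1) (2 - s0)" "2 - s0" "-1" "s0 - 1" 1])
      (use s in \<open>auto simp: norm_exponent_def det_exponent_def\<close>)
qed

lemma eventually_param_cube:
  assumes "t0 \<in> param_cube"
  shows "\<forall>\<^sub>F t in nhds t0. t \<in> param_cube"
proof -
  have l: "((\<lambda>t. t $ k $ j) \<longlongrightarrow> t0 $ k $ j) (nhds t0)" for k j
    by (intro tendsto_vec_nth filterlim_ident)
  have "\<forall>\<^sub>F t in nhds t0. - 1 < t $ k $ j \<and> t $ k $ j < 1" for k j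
    using assms by (intro eventually_conj order_tendstoD[OF l]) (auto simp: param_cube_def)
  then have "\<forall>\<^sub>F t in nhds t0. \<forall>k j. - 1 < t $ k $ j \<and> t $ k $ j < 1"
    by (intro eventually_all_finite)
  then show ?thesis by (simp add: param_cube_def)
qed

theorem theorem1p2:
  fixes t0 :: "'n::finite param" and s0 :: real
  assumes "t0 \<in> param_cube"
    and "\<forall>k. invertible (param_mat t0 k)"
    and "irreducible_mats (range (param_mat t0))"
    and "\<exists>C. is_cone C \<and> strictly_preserves (range (param_mat t0)) C"
    and "contracting (range (param_mat t0))"
    and "has_affinity_dim t0"
    and "s0 = affinity_dim t0"
    and "s0 \<in> {0<..<1} \<union> {1<..<2}"
  shows "\<exists>(U :: 'n param set) (U' :: real set).
    open U \<and> t0 \<in> U \<and> U \<subseteq> param_cube \<and> open U' \<and> s0 \<in> U' \<and>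
    U' \<subseteq> {0..} \<and> (\<forall>t\<in>U. \<forall>k. invertible (param_mat t k)) \<and>
    (\<forall>s\<in>U'. \<forall>t\<in>U. convergent (pressure_seq s t)) \<and>
    real_analytic_on (\<lambda>(s, t). pressure s t) (U' \<times> U) \<and>
    (\<forall>t\<in>U. has_affinity_dim t) \<and>
    real_analytic_on affinity_dim U"
proof -
  obtain C where C: "is_cone C" "strictly_preserves (range (param_mat t0)) C" using assms(4) by blast
  obtain u v where uv: "0 < cross2 u v"
    "\<And>A. A \<in> range (param_mat t0) \<Longrightarrow> 0 < cross2 (A *v u) v \<and> 0 < cross2 (A *v v) v \<and> 0 < cross2 u (A *v u) \<and> 0 < cross2 u (A *v v)"
    using cone_basis[OF C] by blast
  interpret cone_coordinates t0 u v
    by unfold_locales (use uv assms(2) in \<open>auto simp: invertible_det_nz\<close>)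
  obtain r0 a0 a1 b0 b1 where r0: "0 < r0"
    and ex: "\<And>x. \<bar>x\<bar> < r0 \<Longrightarrow> 0 < s0 + x \<and> norm_exponent (s0 + x) = a0 + a1 * x \<and> det_exponent (s0 + x) = b0 + b1 * x"
    using affine_exponents[OF assms(8)] by blast
  have ex': "0 \<le> s0 + x \<and> norm_exponent (s0 + x) = a0 + a1 * x \<and> det_exponent (s0 + x) = b0 + b1 * x" if "\<bar>x\<bar> < r0" for x
    using ex[OF that] by auto
  define f where "f x h = log_pressure (s0 + x) (t0 + h)" for x h
  obtain R M F where "separately_holomorphic_family F R M f"
    using complex_pressure[OF r0 ex'] unfolding separately_holomorphic_family_def f_def by blast
  then interpret fam: separately_holomorphic_family F R M f .
  obtain K \<theta> where K: "0 < K" "0 < \<theta>" "\<theta> < 1" "\<forall>\<^sub>F t in nhds t0. \<forall>w. norm (word_mat t w) \<le> K * \<theta> ^ length w"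
    using contracting_nearby[OF assms(5)] by blast
  have "\<forall>\<^sub>F t in nhds t0. t \<in> param_cube \<and> cone_coordinates t u v \<and> (\<forall>w. norm (word_mat t w) \<le> K * \<theta> ^ length w)"
    using eventually_param_cube[OF assms(1)] cone_coordinates_nearby K(4) by eventually_elim blast
  then obtain r1 where r1: "0 < r1" and near: "\<And>t. dist t t0 < r1 \<Longrightarrow> t \<in> param_cube \<and> cone_coordinates t u v \<and> (\<forall>w. norm (word_mat t w) \<le> K * \<theta> ^ length w)"
    unfolding eventually_nhds_metric by blast
  have det: "det (param_mat t k) \<noteq> 0" if "dist t t0 < r1" for t k
    using near[OF that] cone_coordinates.det_nz by blast
  have dec: "log_pressure s' t \<le> log_pressure s t + (s' - s) * ln \<theta>" if "dist t t0 < r1" "0 \<le> s" "s \<le> s'" for t s s'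
    using near[OF that(1)] K that by (intro log_pressure_decreasing[where C = K] det) auto
  have ln\<theta>: "ln \<theta> < 0" using K by simp
  have press: "pressure s t = exp (log_pressure s t)" "convergent (pressure_seq s t)" if "dist t t0 < r1" "0 \<le> s" for t s
    using pressure_eq[OF det[OF that(1)] that(2)] by auto
  \<comment> \<open>The decay estimate holds for all nonnegative exponents, not just near
    \<open>s0\<close>, so a zero found near \<open>s0\<close> is the only positive one, as the
    description in \<open>affinity_dim\<close> demands.\<close>
  have uniq: "s = s'" if "dist t t0 < r1" "0 < s" "0 < s'" "log_pressure s t = 0" "log_pressure s' t = 0" for t s s'
  proof -
    have "\<not> a < b" if ab: "0 < a" "log_pressure a t = 0" "log_pressure b t = 0" for a b
    proof
      assume "a < b"
      then have "0 \<le> (b - a) * ln \<theta>" using dec[of t a b] ab \<open>dist t t0 < r1\<close> by simp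
      moreover have "(b - a) * ln \<theta> < 0" using \<open>a < b\<close> ln\<theta> by (simp add: mult_less_0_iff)
      ultimately show False by linarith
    qed
    then show ?thesis using that by (meson linorder_neqE_linordered_idom)
  qed
  have dim: "has_affinity_dim t \<and> affinity_dim t = s" if "dist t t0 < r1" "0 < s" "log_pressure s t = 0" for t s
  proof -
    have iff: "0 < s' \<and> pressure s' t = 1 \<longleftrightarrow> s' = s" for s'
      using press(1)[OF that(1), of s'] uniq[OF that(1), of s' s] that by auto
    show ?thesis unfolding has_affinity_dim_def affinity_dim_def iff by simp
  qed
  have s0: "0 < s0" "pressure s0 t0 = 1"
  proof -
    have "0 < affinity_dim t0 \<and> pressure (affinity_dim t0) t0 = 1"
      using assms(6) unfolding has_affinity_dim_def affinity_dim_def by (rule theI')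
    then show "0 < s0" "pressure s0 t0 = 1" using assms(7) by auto
  qed
  have f0: "f 0 0 = 0" using press(1)[of t0 s0] s0 r1 by (simp add: f_def)
  have fL: "f x 0 \<le> ln \<theta> * x" if "0 < x" for x
    using dec[of t0 s0 "s0 + x"] that s0 r1 f0 by (simp add: f_def mult.commute)
  \<comment> \<open>Keeps the root at least \<open>s0 / 2\<close>, hence positive, so that it is the
    dimension.\<close>
  define \<epsilon> where "\<epsilon> = s0 / 2"
  have \<epsilon>: "0 < \<epsilon>" using s0 by (simp add: \<epsilon>_def)
  obtain r \<rho> \<sigma> where r: "0 < r" "r \<le> R" "\<rho> \<le> \<epsilon>" and sep: "sep_holomorphic Basis r \<rho> \<sigma>"
    and root: "\<And>h. norm h < r \<Longrightarrow> \<exists>x. \<bar>x\<bar> \<le> \<rho> \<and> \<sigma> (complex_coords h) = of_real x \<and> f x h = 0"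
    using fam.implicit_root[OF f0 ln\<theta> fL \<epsilon>] by blast
  \<comment> \<open>\<open>r1\<close> is for the open conditions, \<open>r / 2\<close> and
    \<open>R / 8\<close> for the balls on which the expansions are known (in the product two radii
    add up), and \<open>s0\<close> keeps the exponents positive.\<close>
  define e where "e = min r1 (min r (min (R / 4) s0)) / 2"
  have e: "0 < e" "e < r1" "e \<le> r / 2" "e \<le> R / 8" "e < s0" using r1 r fam.R s0 by (auto simp: e_def min_def)
  define U U' where "U = ball t0 e" and "U' = ball s0 e"
  have U: "dist t t0 < r1" if "t \<in> U" for t using that e by (auto simp: U_def dist_commute)
  have U': "0 < s" if "s \<in> U'" for s using that e by (auto simp: U'_def dist_real_def)
  have root': "\<exists>s. has_affinity_dim (t0 + h) \<and> affinity_dim (t0 + h) = s \<and> 0 < s \<and> s0 + \<sigma> (complex_coords h) = of_real s"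
    if h: "norm h < r" "norm h < r1" for h
  proof -
    obtain x where x: "\<bar>x\<bar> \<le> \<rho>" "\<sigma> (complex_coords h) = of_real x" "f x h = 0" using root[OF h(1)] by blast
    have p: "0 < s0 + x" using x(1) r(3) s0 by (simp add: \<epsilon>_def abs_le_iff)
    have "has_affinity_dim (t0 + h) \<and> affinity_dim (t0 + h) = s0 + x"
      using h x p by (intro dim) (auto simp: dist_norm f_def)
    then show ?thesis using x p by auto
  qed
  have "real_analytic_on (\<lambda>(s, t). pressure s t) (U' \<times> U)"
  proof -
    have "real_analytic_on (\<lambda>(s, t). exp (f (s - s0) (t - t0))) (U' \<times> U)"
    proof (rule real_analytic_on_subset[OF fam.real_analytic_exp])
      show "U' \<times> U \<subseteq> ball (s0, t0) (R / 2)"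
      proof safe
        fix s t assume st: "s \<in> U'" "t \<in> U"
        have "dist (s0, t0) (s, t) \<le> dist s0 s + dist t0 t"
          unfolding dist_prod_def using sqrt_sum_squares_le_sum[of "dist s0 s" "dist t0 t"] by simp
        also have "\<dots> < R / 2" using st e fam.R by (auto simp: U_def U'_def)
        finally show "(s, t) \<in> ball (s0, t0) (R / 2)" by simp
      qed
    qed
    then show ?thesis
    proof (rule real_analytic_on_cong)
      show "open (U' \<times> U)" unfolding U_def U'_def by (intro open_Times open_ball)
      show "(case x of (s, t) \<Rightarrow> exp (f (s - s0) (t - t0))) = (case x of (s, t) \<Rightarrow> pressure s t)" if "x \<in> U' \<times> U" for x
        using that press(1)[OF U] U' by (auto simp: f_def less_imp_le)
    qed
  qed
  moreover have rt: "has_affinity_dim t \<and> of_real (affinity_dim t) = s0 + \<sigma> (complex_coords (t - t0))" if "t \<in> U" for t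
  proof -
    have "norm (t - t0) < r" "norm (t - t0) < r1" using that e r by (auto simp: U_def dist_norm norm_minus_commute)
    from root'[OF this] show ?thesis by auto
  qed
  moreover have "real_analytic_on affinity_dim U"
  proof -
    have "sep_holomorphic Basis r (s0 + \<rho>) (\<lambda>\<tau>. of_real s0 + \<sigma> \<tau>)"
      unfolding sep_holomorphic_def
    proof (intro ballI conjI)
      fix \<tau> :: "'n param \<Rightarrow> complex" and b :: "'n param" assume t: "\<tau> \<in> polydisc Basis r"
      show "norm (of_real s0 + \<sigma> \<tau>) \<le> s0 + \<rho>"
        using sep t s0 by (intro order_trans[OF norm_triangle_ineq] add_mono) (auto simp: sep_holomorphic_def)
      show "(\<lambda>z. of_real s0 + \<sigma> (\<tau>(b := z))) holomorphic_on ball 0 r" if "b \<in> Basis"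
        using sep t that by (intro holomorphic_intros) (auto simp: sep_holomorphic_def)
    qed
    then have "real_analytic_on (\<lambda>t. s0 + Re (\<sigma> (complex_coords (t - t0)))) (ball t0 (r / 2))"
    proof (rule real_analytic_onI[OF r(1)])
      fix h :: "'n param" assume "norm h < r"
      then obtain x where "\<sigma> (complex_coords h) = of_real x" using root by blast
      then show "of_real s0 + \<sigma> (complex_coords h) = of_real (s0 + Re (\<sigma> (complex_coords (t0 + h - t0))))" by simp
    qed
    then have "real_analytic_on (\<lambda>t. s0 + Re (\<sigma> (complex_coords (t - t0)))) U"
      by (rule real_analytic_on_subset) (use e in \<open>auto simp: U_def\<close>)
    then show ?thesis
    proof (rule real_analytic_on_cong)
      fix t assume "t \<in> U"
      then have "Re (of_real (affinity_dim t)) = Re (s0 + \<sigma> (complex_coords (t - t0)))" using rt by simp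
      then show "s0 + Re (\<sigma> (complex_coords (t - t0))) = affinity_dim t" by simp
    qed (simp add: U_def)
  qed
  moreover have "open U" "t0 \<in> U" "open U'" "s0 \<in> U'" using e by (auto simp: U_def U'_def)
  moreover have "U \<subseteq> param_cube" using near U by blast
  moreover have "U' \<subseteq> {0..}" using U' by (auto simp: less_imp_le)
  moreover have "\<forall>t\<in>U. \<forall>k. invertible (param_mat t k)" using det U by (simp add: invertible_det_nz)
  moreover have "\<forall>s\<in>U'. \<forall>t\<in>U. convergent (pressure_seq s t)" using press(2) U U' by (simp add: less_imp_le)
  ultimately show ?thesis by (intro exI[of _ U] exI[of _ U']) blast
qed

end
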